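(* Assume that for every integer $k\ge1$, every $\ell\in\{1,\dots,k\}$, every $k$-bounded partition $\lambda$ and every copy $\mathbb A_T^{(k)}$ of the super atom $\mathbb A_\lambda^{(k)}$, there is a tableau $T'$ of shape $\lambda\cup(\ell^{k-\ell+1})$ such that $\mathbb B_{(\ell^{k-\ell+1})}\,\mathbb A_T^{(k)}=\mathbb A_{T'}^{(k)}$ is a copy of $\mathbb A^{(k)}_{\lambda\cup(\ell^{k-\ell+1})}$. Let $k\ge1$ and assume also that the atoms $A_\lambda^{(k)}[X;t]$, $\lambda$ ranging over all $k$-bounded partitions, form a basis of $V_k$. Then the (images of the) $k$-irreducible atoms at $t=1$, i.e. $A_\lambda^{(k)}[X;1]$ with $\lambda$ a $k$-irreducible partition, form a basis of the quotient ring $V_k(1)/\mathcal I_k$.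
   Context: $V_k$ is the $\mathbb Q(q,t)$-span of the functions $S_\lambda[X/(1-t)]$ with $\lambda_1\le k$, where $S_\lambda[X/(1-t)]$ is the image of the Schur function $S_\lambda$ under $p_i\mapsto p_i/(1-t^i)$; at $t=1$ one sets $V_k(1)=\mathbb Q[h_1,\dots,h_k]$ ($h_i$ the complete symmetric functions). $\mathcal I_k$ is the ideal of $V_k(1)$ generated by the Schur functions $S_{(\ell^{k+1-\ell})}$, $\ell=1,\dots,k$. A $k$-bounded partition is $k$-irreducible if for each $i=0,\dots,k-1$ it has no more than $i$ parts equal to $k-i$. $\lambda\cup\mu$ is the partition rearrangement of the parts of $\lambda$ and $\mu$. Tableaux. Diagrams of partitions are drawn with row $i$ (counted from the bottom) of length $\lambda_i$. $\ell(\lambda)$ is the number of nonzero parts, and $\lambda$ is $k$-bounded if $\lambda_1\le k$. A tableau is a filling of a partition diagram by positive integers, nondecreasing along rows (left to right) and strictly increasing up columns. It is identified with its reading word, obtained by reading rows left to right, from the top row to the bottom row. The evaluation of a word is $(\rho_1,\rho_2,\dots)$, $\rho_i$ being the number of letters $i$. $\equiv$ denotes Knuth (plactic) equivalence: $acb\equiv cab$ for $a\le b<c$ and $bac\equiv bca$ for $a<b\le c$. Every word is Knuth equivalent to a unique tableau. $\mathbb H_0$ is the empty tableau. Sets of tableaux are identified with formal sums of their elements, and operators are extended linearly. Symmetric group action. $\sigma_i$ acts on a word through its subword in the letters $i,i+1$: successively pair every factor $(i+1)\,i$ (ignoring already paired letters) until the unpaired letters form $i^r(i+1)^s$; replace these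 by $i^s(i+1)^r$. This gives an action of the symmetric group on words, sending tableaux to tableaux of the same shape. Promotion. For $T$ of evaluation $(\lambda_1,\dots,\lambda_m)$, $\mathbb B_r(T)=\sigma_1\cdots\sigma_m\,\mathbb R_r T$, where $\mathbb R_rT$ is the sum of all tableaux obtained by adding to $T$ a horizontal $r$-strip of letters $m+1$. Rectangular promotion. The operator $\sigma_1^{(h)}$ acts on words $w$ in the letters $1,\dots,h+1$: let $(P(w),Q(w))$ be the Robinson–Schensted pair of $w$ ($P(w)$ the tableau Knuth equivalent to $w$, $Q(w)$ standard); let $w''$ be obtained from $w$ by erasing all letters $1$ and decreasing the others by $1$; the shape of $P(w'')$ differs from that of $P(w)$ by a horizontal strip; let $T'$ be obtained from $P(w'')$ by filling this strip with letters $h+1$; then $\sigma_1^{(h)}(w)$ is the word $w'$ with $(P(w'),Q(w'))=(T',Q(w))$. $\sigma_i^{(h)}$ acts on a word by applying the same operation (with letters shifted by $i-1$) to its subword in the letters $i,\dots,i+h$, leaving other letters in place. For $T$ of evaluation $(\lambda_1,\dots,\lambda_m)$, $\mathbb B_{(\ell^h)}(T)=\sigma_1^{(h)}\cdots\sigma_m^{(h)}\,\mathbb R_{(\ell^h)}T$, where $\mathbb R_{(\ell^h)}T$ is the sum of all tableaux obtained from $T$ by adding a horizontal $\ell$-strip of letters $m+1$, then a horizontal $\ell$-strip of letters $m+2$, ..., then a horizontal $\ell$-strip of letters $m+h$, such that the tableau is Yamanouchi in the added letters (every right factor of its reading word contains at least as many letters $m+i$ as letters $m+j$ for $1\le i<j\le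 h$). Filtering. The main hook-length is $h_M(\lambda)=\lambda_1+\ell(\lambda)-1$. The $k$-split of a $k$-bounded $\lambda$ is the sequence $\lambda^{\to k}=(\lambda^{(1)},\dots,\lambda^{(r)})$ obtained by cutting $\lambda$ (keeping the order of its parts) into consecutive partitions with $h_M(\lambda^{(i)})=k$ for all $i\ne r$ (the last one may have main hook-length less than $k$). For a tableau $T$ whose shape contains $\lambda$, let $T_\lambda$ be its subtableau of shape $\lambda$, $T_1$ the part of $T$ outside $T_\lambda$ in the first $\ell(\lambda)$ rows, $T_2$ the part of $T$ above those rows, and $\overline T$ the unique tableau Knuth equivalent to the word $T_1T_2$ (reading word of $T_1$ followed by that of $T_2$). $S(\lambda)$ is the set of tableaux of shape $\lambda$ and evaluation $(0^m,\lambda_1,\lambda_2,\dots)$, $m\in\mathbb N$. The restricted $\lambda$-katabolism is $\overline{\mathbb K}_\lambda(T)=\overline T$ if $\lambda\subseteq\mathrm{shape}(T)$ and $T_\lambda\in S(\lambda)$, and $0$ otherwise. For $S=(\lambda^{(1)},\dots,\lambda^{(r)})$, $\mathbb P_S(T)=T$ if $\overline{\mathbb K}_{\lambda^{(r)}}\cdots\overline{\mathbb K}_{\lambda^{(1)}}(T)=\mathbb H_0$, and $0$ otherwise. Super atoms. $\mathbb A^{(k)}_0=\mathbb H_0$ and, for a $k$-bounded partition $\lambda$, $\mathbb A_\lambda^{(k)}=\mathbb P_{\lambda^{\to k}}\,\mathbb B_{\lambda_1}\big(\mathbb A^{(k)}_{(\lambda_2,\lambda_3,\dots)}\big)$. Charge.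 For a word $w$ whose evaluation is a partition: read $w$ from right to left, cyclically. Starting at the right end with label $\ell=0$, label with $\ell$ the first $1$ met, then the first $2$ met after it, then the first $3$ after that, etc., increasing $\ell$ by $1$ each time one passes from the left end of $w$ back to its right end. When the letters are exhausted repeat on the unlabeled letters, again from the right end with $\ell=0$, until all letters are labeled. $\mathrm{charge}(w)$ is the sum of the labels. If the evaluation is not a partition, first apply a permutation $\sigma$ (via the $\sigma_i$) making it one and set $\mathrm{charge}(w)=\mathrm{charge}(\sigma w)$. Atoms. $S_\lambda[X]$ is the Schur function in $X=x_1+x_2+\cdots$. $\digamma$ is the linear map $\digamma(T)=t^{\mathrm{charge}(T)}S_{\mathrm{shape}(T)}[X]$, and $A_\lambda^{(k)}[X;t]=\digamma(\mathbb A_\lambda^{(k)})$. Cyclage posets and copies. If a tableau word is $T=xw$ with $x$ a letter that is not the smallest letter of $T$, the cyclage of $T$ is the tableau Knuth equivalent to $wx$; if $T=wx$ with $x$ not the smallest letter of $T$, the cocyclage of $T$ is the tableau Knuth equivalent to $xw$. On tableaux of partition evaluation a cyclage raises charge by $1$ and a cocyclage lowers it by $1$. For a set $\mathbb T$ of tableaux of the same evaluation, $(\mathbb T,<_{cc})$ is the poset (ranked by charge) obtained by linking $T,T'\in\mathbb T$ when one of $\sigma T,\sigma T'$ is obtained from the other by a cyclage or a cocyclage, $\sigma$ being a permutation (acting via the $\sigma_i$) that makes the evaluation a partition. $\Gamma_{\mathbb T}$ is its Hasse diagram with each vertex labeled by the shape of the corresponding tableau, and $\Gamma_\lambda^{(k)}=\Gamma_{\mathbb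 T}$ for $\mathbb T=\mathbb A_\lambda^{(k)}$. A set $\mathbb T$ of tableaux (all of the same evaluation) is called a copy of $\mathbb A^{(k)}_{\mathrm{shape}(T)}$, and is denoted $\mathbb A_T^{(k)}$, if $T$ is the tableau of minimal charge in $\mathbb T$ and $\Gamma_{\mathbb T}=\Gamma^{(k)}_{\mathrm{shape}(T)}$. *)

theory Defs
  imports
    "HOL-Library.Multiset"
    "HOL-Library.Poly_Mapping"
    "HOL-Computational_Algebra.Fraction_Field"
    "HOL-Computational_Algebra.Polynomial"
    "HOL-Algebra.Embedded_Algebras"
    "HOL-Algebra.Generated_Rings"
    "HOL-Algebra.QuotRing"
    "Jordan_Normal_Form.Determinant"
begin

section \<open>Partitions\<close>

type_synonym ptn = "nat list"

definition is_partition :: "ptn \<Rightarrow> bool" where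
  "is_partition p \<longleftrightarrow> sorted_wrt (\<ge>) p \<and> 0 \<notin> set p"

text \<open>Parts are numbered from 0 and continued by zeros.\<close>

definition part :: "ptn \<Rightarrow> nat \<Rightarrow> nat" where
  "part p i = (if i < length p then p ! i else 0)"

definition bounded_partition :: "nat \<Rightarrow> ptn \<Rightarrow> bool" where
  "bounded_partition k p \<longleftrightarrow> is_partition p \<and> (\<forall>x\<in>set p. x \<le> k)"

definition irreducible_partition :: "nat \<Rightarrow> ptn \<Rightarrow> bool" where
  "irreducible_partition k p \<longleftrightarrow>
     bounded_partition k p \<and> (\<forall>i<k. count_list p (k - i) \<le> i)"

definition partition_union :: "ptn \<Rightarrow> ptn \<Rightarrow> ptn" where
  "partition_union p r = rev (sort (p @ r))"

definition contained :: "ptn \<Rightarrow> ptn \<Rightarrow> bool" where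
  "contained p r \<longleftrightarrow> (\<forall>i. part p i \<le> part r i)"

definition horizontal_strip :: "ptn \<Rightarrow> ptn \<Rightarrow> bool" where
  "horizontal_strip p r \<longleftrightarrow> (\<forall>i. part p i \<le> part r i \<and> part r (Suc i) \<le> part p i)"

definition main_hook :: "ptn \<Rightarrow> nat" where
  "main_hook p = part p 0 + length p - 1"

text \<open>A block with largest part \<open>x \<le> k\<close> has main hook-length \<open>k\<close> iff it has \<open>k - x + 1\<close> parts.\<close>

function ksplit :: "nat \<Rightarrow> ptn \<Rightarrow> ptn list" where
  "ksplit k [] = []"
| "ksplit k (x # p) = (x # take (k - x) p) # ksplit k (drop (k - x) p)"
  by pat_completeness auto
termination by (relation "measure (\<lambda>(k, p). length p)") auto

lemma concat_ksplit: "concat (ksplit k p) = p"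
  by (induction k p rule: ksplit.induct) auto

lemma ksplit_hooks:
  assumes "\<forall>x\<in>set p. x \<le> k"
  shows "(\<forall>s\<in>set (butlast (ksplit k p)). main_hook s = k) \<and>
         (\<forall>s\<in>set (ksplit k p). s \<noteq> [] \<and> main_hook s \<le> k)"
  using assms
proof (induction k p rule: ksplit.induct)
  case (2 k x p)
  have x: "x \<le> k" using 2 by auto
  have "\<forall>y\<in>set (drop (k - x) p). y \<le> k" using 2 by (auto dest: in_set_dropD)
  note IH = 2(1)[OF this]
  have le: "main_hook (x # take (k - x) p) \<le> k"
    using x by (auto simp: main_hook_def part_def)
  have "main_hook (x # take (k - x) p) = k" if "ksplit k (drop (k - x) p) \<noteq> []"
  proof -
    have "drop (k - x) p \<noteq> []" using that by (metis ksplit.simps(1))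
    then show ?thesis using x by (auto simp: main_hook_def part_def)
  qed
  then show ?case using IH le by auto
qed auto


section \<open>Words and tableaux\<close>

type_synonym word = "nat list"

definition max_letter :: "word \<Rightarrow> nat" where
  "max_letter w = Max (insert 0 (set w))"

definition evaluation :: "word \<Rightarrow> nat list" where
  "evaluation w = map (count_list w) [1..<Suc (max_letter w)]"

text \<open>A filling is the list of its rows, the bottom row first.\<close>

type_synonym filling = "nat list list"

definition row_at :: "filling \<Rightarrow> nat \<Rightarrow> nat list" where
  "row_at R i = (if i < length R then R ! i else [])"

definition tableau_filling :: "filling \<Rightarrow> bool" where
  "tableau_filling R \<longleftrightarrow>
     is_partition (map length R) \<and>
     (\<forall>r\<in>set R. sorted r \<and> 0 \<notin> set r) \<and>
     (\<forall>i j. Suc i < length R \<longrightarrow> j < length (R ! Suc i) \<longrightarrow> R ! i ! j < R ! Suc i ! j)"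

definition reading_word :: "filling \<Rightarrow> word" where
  "reading_word R = concat (rev R)"

text \<open>Tableaux are represented by their reading words, from which the rows can be recovered.\<close>

type_synonym tableau = word

definition is_tableau :: "word \<Rightarrow> bool" where
  "is_tableau w \<longleftrightarrow> (\<exists>R. tableau_filling R \<and> reading_word R = w)"

definition rows :: "tableau \<Rightarrow> filling" where
  "rows T = (THE R. tableau_filling R \<and> reading_word R = T)"

definition shape :: "tableau \<Rightarrow> ptn" where
  "shape T = map length (rows T)"

inductive knuth_step :: "word \<Rightarrow> word \<Rightarrow> bool" where
  "a \<le> b \<Longrightarrow> b < c \<Longrightarrow> knuth_step (u @ [a, c, b] @ v) (u @ [c, a, b] @ v)"
| "a < b \<Longrightarrow> b \<le> c \<Longrightarrow> knuth_step (u @ [b, a, c] @ v) (u @ [b, c, a] @ v)"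

definition knuth_equiv :: "word \<Rightarrow> word \<Rightarrow> bool" where
  "knuth_equiv = equivclp knuth_step"

definition P_tableau :: "word \<Rightarrow> tableau" where
  "P_tableau w = (THE T. is_tableau T \<and> knuth_equiv T w)"

text \<open>\<open>fill_strip R p x\<close> extends the rows of \<open>R\<close> by letters \<open>x\<close> to a filling of the shape \<open>p\<close>.\<close>

definition fill_strip :: "filling \<Rightarrow> ptn \<Rightarrow> nat \<Rightarrow> filling" where
  "fill_strip R p x = map (\<lambda>i. row_at R i @ replicate (p ! i - length (row_at R i)) x) [0..<length p]"

text \<open>The recording tableau has the entry \<open>n\<close> in the cell by which the shape of the
  \<open>P\<close>-tableau grows when the \<open>n\<close>-th letter is appended.\<close>

fun recording :: "word \<Rightarrow> nat \<Rightarrow> filling" where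
  "recording w 0 = []"
| "recording w (Suc n) =
     fill_strip (recording w n) (shape (P_tableau (take (Suc n) w))) (Suc n)"

definition Q_tableau :: "word \<Rightarrow> filling" where
  "Q_tableau w = recording w (length w)"


section \<open>The symmetric group action\<close>

text \<open>\<open>cancel_pairs i st xs\<close> scans the list \<open>xs\<close> of pairs (position, letter), keeping on the stack
  \<open>st\<close> (last one first) the letters still unpaired and deleting every factor \<open>(i+1) i\<close>.\<close>

fun cancel_pairs :: "nat \<Rightarrow> (nat \<times> nat) list \<Rightarrow> (nat \<times> nat) list \<Rightarrow> (nat \<times> nat) list" where
  "cancel_pairs i st [] = rev st"
| "cancel_pairs i [] (x # xs) = cancel_pairs i [x] xs"
| "cancel_pairs i (y # st) (x # xs) =
     (if snd y = Suc i \<and> snd x = i then cancel_pairs i st xs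
      else cancel_pairs i (x # y # st) xs)"

definition unpaired :: "nat \<Rightarrow> word \<Rightarrow> (nat \<times> nat) list" where
  "unpaired i w = cancel_pairs i [] (filter (\<lambda>(_, x). x = i \<or> x = Suc i) (zip [0..<length w] w))"

definition sigma :: "nat \<Rightarrow> word \<Rightarrow> word" where
  "sigma i w =
     (let ps = map fst (unpaired i w);
          r = count_list (map snd (unpaired i w)) i;
          s = length ps - r
      in fold (\<lambda>(n, x) v. v[n := x]) (zip ps (replicate s i @ replicate r (Suc i))) w)"

text \<open>\<open>sigmas [i\<^sub>1, \<dots>, i\<^sub>n]\<close> is \<open>\<sigma>\<close> with indices \<open>i\<^sub>1\<close> up to \<open>i\<^sub>n\<close>, the last factor acting first.\<close>

definition sigmas :: "nat list \<Rightarrow> word \<Rightarrow> word" where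
  "sigmas is w = foldr sigma is w"

definition straightens :: "nat list \<Rightarrow> word \<Rightarrow> bool" where
  "straightens is w \<longleftrightarrow> 0 \<notin> set is \<and> is_partition (evaluation (sigmas is w))"


section \<open>Promotion operators\<close>

text \<open>Formal sums of tableaux are multisets of tableaux.  All sets converted by
  \<open>mset_set\<close> below are finite.\<close>

type_synonym tableau_sum = "tableau multiset"

definition extend_linearly :: "(tableau \<Rightarrow> tableau_sum) \<Rightarrow> tableau_sum \<Rightarrow> tableau_sum" where
  "extend_linearly f A = (\<Sum>T\<in>#A. f T)"

definition strip_shapes :: "nat \<Rightarrow> ptn \<Rightarrow> ptn set" where
  "strip_shapes r p =
     {s. is_partition s \<and> horizontal_strip p s \<and> sum_list s = sum_list p + r}"

lemma finite_strip_shapes: "finite (strip_shapes r p)"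
proof -
  let ?n = "sum_list p + r"
  have "length s \<le> ?n \<and> set s \<subseteq> {..?n}" if "s \<in> strip_shapes r p" for s
  proof -
    have s: "0 \<notin> set s" "sum_list s = ?n"
      using that by (auto simp: strip_shapes_def is_partition_def)
    have "length s \<le> sum_list s" using s(1) by (induction s) auto
    then show ?thesis using s(2) member_le_sum_list[of _ s] by auto
  qed
  then have "strip_shapes r p \<subseteq> {s. set s \<subseteq> {..?n} \<and> length s \<le> ?n}" by auto
  then show ?thesis by (rule finite_subset) (intro finite_lists_length_le finite_atMost)
qed

definition add_strip :: "nat \<Rightarrow> nat \<Rightarrow> tableau \<Rightarrow> tableau set" where
  "add_strip r x T = (\<lambda>p. reading_word (fill_strip (rows T) p x)) ` strip_shapes r (shape T)"

lemma finite_add_strip: "finite (add_strip r x T)"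
  by (simp add: add_strip_def finite_strip_shapes)

definition promotion :: "nat \<Rightarrow> tableau \<Rightarrow> tableau_sum" where
  "promotion r T =
     (let m = max_letter T
      in image_mset (sigmas [1..<Suc m]) (mset_set (add_strip r (Suc m) T)))"

fun add_strips :: "nat \<Rightarrow> nat \<Rightarrow> nat \<Rightarrow> tableau \<Rightarrow> tableau set" where
  "add_strips l m 0 T = {T}"
| "add_strips l m (Suc h) T = (\<Union>U\<in>add_strips l m h T. add_strip l (m + Suc h) U)"

lemma finite_add_strips: "finite (add_strips l m h T)"
  by (induction h) (auto simp: finite_add_strip)

text \<open>The Yamanouchi condition in the letters \<open>m + 1, \<dots>, m + h\<close>.\<close>

definition yamanouchi :: "nat \<Rightarrow> nat \<Rightarrow> word \<Rightarrow> bool" where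
  "yamanouchi m h w \<longleftrightarrow>
     (\<forall>u v. w = u @ v \<longrightarrow>
        (\<forall>i j. 1 \<le> i \<longrightarrow> i < j \<longrightarrow> j \<le> h \<longrightarrow> count_list v (m + j) \<le> count_list v (m + i)))"

definition rect_sigma1 :: "nat \<Rightarrow> word \<Rightarrow> word" where
  "rect_sigma1 h w =
     (let w'' = map (\<lambda>x. x - 1) (filter (\<lambda>x. x \<noteq> 1) w);
          T' = reading_word (fill_strip (rows (P_tableau w'')) (shape (P_tableau w)) (Suc h))
      in THE w'. set w' \<subseteq> {1..Suc h} \<and> P_tableau w' = T' \<and> Q_tableau w' = Q_tableau w)"

text \<open>\<open>replace_letters I w v\<close> replaces the successive letters of \<open>w\<close> satisfying \<open>I\<close> by those of \<open>v\<close>.\<close>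

fun replace_letters :: "(nat \<Rightarrow> bool) \<Rightarrow> word \<Rightarrow> word \<Rightarrow> word" where
  "replace_letters I [] v = []"
| "replace_letters I (x # w) v =
     (if I x then hd v # replace_letters I w (tl v) else x # replace_letters I w v)"

definition rect_sigma :: "nat \<Rightarrow> nat \<Rightarrow> word \<Rightarrow> word" where
  "rect_sigma h i w =
     (let I = (\<lambda>x. i \<le> x \<and> x \<le> i + h);
          v = rect_sigma1 h (map (\<lambda>x. x - (i - 1)) (filter I w))
      in replace_letters I w (map (\<lambda>x. x + (i - 1)) v))"

definition rect_promotion :: "nat \<Rightarrow> nat \<Rightarrow> tableau \<Rightarrow> tableau_sum" where
  "rect_promotion l h T =
     (let m = max_letter T
      in image_mset (foldr (rect_sigma h) [1..<Suc m])
           (mset_set {U \<in> add_strips l m h T. yamanouchi m h U}))"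


section \<open>Katabolism and super atoms\<close>

text \<open>\<open>is_super_standard p T\<close>: the tableau \<open>T\<close> belongs to \<open>S(p)\<close>.\<close>

definition is_super_standard :: "ptn \<Rightarrow> tableau \<Rightarrow> bool" where
  "is_super_standard p T \<longleftrightarrow>
     is_tableau T \<and> shape T = p \<and> (\<exists>m. evaluation T = replicate m 0 @ p)"

definition subtableau :: "ptn \<Rightarrow> tableau \<Rightarrow> tableau" where
  "subtableau p T = reading_word (map (\<lambda>i. take (p ! i) (row_at (rows T) i)) [0..<length p])"

definition right_part :: "ptn \<Rightarrow> tableau \<Rightarrow> word" where
  "right_part p T = reading_word (map (\<lambda>i. drop (p ! i) (row_at (rows T) i)) [0..<length p])"

definition upper_part :: "ptn \<Rightarrow> tableau \<Rightarrow> word" where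
  "upper_part p T = reading_word (drop (length p) (rows T))"

text \<open>The value \<open>None\<close> stands for \<open>0\<close>, as opposed to the empty tableau \<open>[]\<close>.\<close>

definition katabolism :: "ptn \<Rightarrow> tableau \<Rightarrow> tableau option" where
  "katabolism p T =
     (if contained p (shape T) \<and> is_super_standard p (subtableau p T)
      then Some (P_tableau (right_part p T @ upper_part p T)) else None)"

fun katabolisms :: "ptn list \<Rightarrow> tableau \<Rightarrow> tableau option" where
  "katabolisms [] T = Some T"
| "katabolisms (p # S) T = Option.bind (katabolism p T) (katabolisms S)"

definition filtering :: "ptn list \<Rightarrow> tableau \<Rightarrow> tableau_sum" where
  "filtering S T = (if katabolisms S T = Some [] then {#T#} else {#})"

fun super_atom :: "nat \<Rightarrow> ptn \<Rightarrow> tableau_sum" where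
  "super_atom k [] = {#[]#}"
| "super_atom k (x # p) =
     extend_linearly (filtering (ksplit k (x # p)))
       (extend_linearly (promotion x) (super_atom k p))"


section \<open>Charge\<close>

text \<open>\<open>charge_scan x l us vs\<close> is the sum of the labels still to be given, when the letter \<open>x\<close> is
  searched with current label \<open>l\<close>, and the unlabeled letters, in the order from right to left, are
  \<open>us\<close> (already passed) followed by \<open>vs\<close> (not yet reached in the current pass).\<close>

function charge_scan :: "nat \<Rightarrow> nat \<Rightarrow> nat list \<Rightarrow> nat list \<Rightarrow> nat" where
  "charge_scan x l us vs =
     (if x \<in> set vs then
        l + charge_scan (Suc x) l (us @ takeWhile ((\<noteq>) x) vs) (tl (dropWhile ((\<noteq>) x) vs))
      else if x \<in> set us then
        Suc l + charge_scan (Suc x) (Suc l)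
          (takeWhile ((\<noteq>) x) us) (tl (dropWhile ((\<noteq>) x) us) @ vs)
      else if x \<noteq> 1 then charge_scan 1 0 [] (us @ vs)
      else 0)"
  by pat_completeness auto

lemma length_takeWhile_tl_dropWhile:
  "x \<in> set vs \<Longrightarrow>
   Suc (length (takeWhile ((\<noteq>) x) vs) + length (tl (dropWhile ((\<noteq>) x) vs))) = length vs"
  by (induction vs) auto

termination
  by (relation "measures [\<lambda>(x, l, us, vs). length us + length vs,
                          \<lambda>(x, l, us, vs). if x = 1 then 0 else 1]")
    (use length_takeWhile_tl_dropWhile in fastforce)+

declare charge_scan.simps [simp del]

definition charge :: "word \<Rightarrow> nat" where
  "charge w = charge_scan 1 0 []
     (rev (if is_partition (evaluation w) then w else sigmas (SOME is. straightens is w) w))"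


section \<open>Cyclage posets and copies of super atoms\<close>

definition cyclage :: "tableau \<Rightarrow> tableau \<Rightarrow> bool" where
  "cyclage T U \<longleftrightarrow> (\<exists>x w. T = x # w \<and> x \<noteq> Min (set T) \<and> U = P_tableau (w @ [x]))"

definition cocyclage :: "tableau \<Rightarrow> tableau \<Rightarrow> bool" where
  "cocyclage T U \<longleftrightarrow> (\<exists>x w. T = w @ [x] \<and> x \<noteq> Min (set T) \<and> U = P_tableau (x # w))"

definition linked :: "tableau \<Rightarrow> tableau \<Rightarrow> bool" where
  "linked T U \<longleftrightarrow> (\<exists>is. straightens is T \<and> straightens is U \<and>
     (let T' = sigmas is T; U' = sigmas is U
      in cyclage T' U' \<or> cyclage U' T' \<or> cocyclage T' U' \<or> cocyclage U' T'))"

definition cc_less :: "tableau set \<Rightarrow> tableau \<Rightarrow> tableau \<Rightarrow> bool" where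
  "cc_less \<T> = (\<lambda>T U. T \<in> \<T> \<and> U \<in> \<T> \<and> linked T U \<and> charge T < charge U)\<^sup>+\<^sup>+"

text \<open>The edges of the Hasse diagram, directed upwards.\<close>

definition cc_covers :: "tableau set \<Rightarrow> tableau \<Rightarrow> tableau \<Rightarrow> bool" where
  "cc_covers \<T> T U \<longleftrightarrow> cc_less \<T> T U \<and> \<not> (\<exists>V\<in>\<T>. cc_less \<T> T V \<and> cc_less \<T> V U)"

text \<open>Hasse diagrams labeled by shapes are compared up to isomorphism.\<close>

definition same_diagram :: "tableau set \<Rightarrow> tableau set \<Rightarrow> bool" where
  "same_diagram \<T> \<U> \<longleftrightarrow>
     (\<exists>f. bij_betw f \<T> \<U> \<and> (\<forall>T\<in>\<T>. shape (f T) = shape T) \<and>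
          (\<forall>T\<in>\<T>. \<forall>U\<in>\<T>. cc_covers \<T> T U \<longleftrightarrow> cc_covers \<U> (f T) (f U)))"

text \<open>\<open>is_copy k T \<T>\<close>: the set \<open>\<T>\<close> is a copy of the super atom indexed by the shape of \<open>T\<close>,
  with tableau of minimal charge \<open>T\<close>.\<close>

definition is_copy :: "nat \<Rightarrow> tableau \<Rightarrow> tableau set \<Rightarrow> bool" where
  "is_copy k T \<T> \<longleftrightarrow>
     (\<forall>U\<in>\<T>. is_tableau U) \<and>
     (\<forall>U\<in>\<T>. \<forall>V\<in>\<T>. evaluation U = evaluation V) \<and>
     T \<in> \<T> \<and> (\<forall>U\<in>\<T>. U \<noteq> T \<longrightarrow> charge T < charge U) \<and>
     same_diagram \<T> (set_mset (super_atom k (shape T)))"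


section \<open>Symmetric functions\<close>

text \<open>Over a field of characteristic 0 the ring of symmetric functions is the polynomial ring in
  the power sums.  Monomials are finitely supported exponent functions; the exponent at \<open>i > 0\<close>
  is that of the power sum with index \<open>i\<close>, and index 0 is never used.\<close>

type_synonym 'a sf = "(nat \<Rightarrow>\<^sub>0 nat) \<Rightarrow>\<^sub>0 'a"

definition sf_const :: "'a::field \<Rightarrow> 'a sf" where
  "sf_const c = Poly_Mapping.single 0 c"

definition sf_scale :: "'a::field \<Rightarrow> 'a sf \<Rightarrow> 'a sf" where
  "sf_scale c f = sf_const c * f"

interpretation sf: vector_space "sf_scale :: 'a::field \<Rightarrow> 'a sf \<Rightarrow> 'a sf"
  by unfold_locales
    (auto simp: sf_scale_def sf_const_def single_add mult_single algebra_simps simp flip: mult.assoc)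

definition sf_basis :: "('i \<Rightarrow> 'a::field sf) \<Rightarrow> 'i set \<Rightarrow> 'a sf set \<Rightarrow> bool" where
  "sf_basis b J V \<longleftrightarrow> inj_on b J \<and> sf.independent (b ` J) \<and> sf.span (b ` J) = V"

definition power_sum :: "nat \<Rightarrow> 'a::field sf" where
  "power_sum i = Poly_Mapping.single (Poly_Mapping.single i 1) 1"

text \<open>Newton's identity \<open>n h\<^sub>n = p\<^sub>1 h\<^sub>n\<^sub>-\<^sub>1 + \<dots> + p\<^sub>n h\<^sub>0\<close>.\<close>

fun complete_sf :: "nat \<Rightarrow> 'a::field sf" where
  "complete_sf 0 = 1"
| "complete_sf (Suc n) =
     sf_scale (1 / of_nat (Suc n)) (\<Sum>i\<le>n. power_sum (Suc i) * complete_sf (n - i))"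

text \<open>The Jacobi--Trudi determinant.\<close>

definition schur :: "ptn \<Rightarrow> 'a::field sf" where
  "schur p = det (mat (length p) (length p)
     (\<lambda>(i, j). if i \<le> p ! i + j then complete_sf (p ! i + j - i) else 0))"

text \<open>The substitution \<open>p\<^sub>i \<mapsto> p\<^sub>i / (1 - t\<^sup>i)\<close>.\<close>

definition plethysm :: "'a::field \<Rightarrow> 'a sf \<Rightarrow> 'a sf" where
  "plethysm t f = (\<Sum>m\<in>Poly_Mapping.keys f. sf_scale (Poly_Mapping.lookup f m)
     (\<Prod>i\<in>Poly_Mapping.keys m.
        sf_scale (1 / (1 - t ^ i)) (power_sum i) ^ Poly_Mapping.lookup m i))"

text \<open>The atom as a function of the value \<open>t\<close> of the parameter, in any field of coefficients.\<close>

definition atom_sf :: "nat \<Rightarrow> ptn \<Rightarrow> 'a::field \<Rightarrow> 'a sf" where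
  "atom_sf k p t = (\<Sum>T\<in>#super_atom k p. sf_scale (t ^ charge T) (schur (shape T)))"

text \<open>The field of rational functions in \<open>q\<close> and \<open>t\<close>; the outer polynomial variable is \<open>t\<close>.\<close>

type_synonym rat_qt = "rat poly poly fract"

definition t_var :: rat_qt where
  "t_var = Fract [:0, 1:] 1"

definition V :: "nat \<Rightarrow> rat_qt sf set" where
  "V k = sf.span {plethysm t_var (schur p) |p. bounded_partition k p}"


section \<open>The specialization at \<open>t = 1\<close>\<close>

definition sf_ring :: "rat sf ring" where
  "sf_ring = \<lparr>carrier = UNIV, monoid.mult = (*), one = 1, zero = 0, add = (+)\<rparr>"

definition V1 :: "nat \<Rightarrow> rat sf ring" where
  "V1 k = sf_ring\<lparr>carrier := generate_ring sf_ring (range sf_const \<union> complete_sf ` {1..k})\<rparr>"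

definition rect_ideal :: "nat \<Rightarrow> rat sf set" where
  "rect_ideal k = genideal (V1 k) ((\<lambda>l. schur (replicate (k + 1 - l) l)) ` {1..k})"

definition quotient_ring :: "nat \<Rightarrow> rat sf set ring" where
  "quotient_ring k = V1 k Quot rect_ideal k"

definition residue_class :: "nat \<Rightarrow> rat sf \<Rightarrow> rat sf set" where
  "residue_class k f = rect_ideal k +>\<^bsub>V1 k\<^esub> f"

text \<open>A basis, indexed by \<open>J\<close>, of a ring \<open>R\<close> over its subfield \<open>K\<close> (finite-dimensional case).\<close>

definition ring_basis :: "('a, 'c) ring_scheme \<Rightarrow> 'a set \<Rightarrow> ('i \<Rightarrow> 'a) \<Rightarrow> 'i set \<Rightarrow> bool" where
  "ring_basis R K b J \<longleftrightarrow>
     (\<exists>js. distinct js \<and> set js = J \<and>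
        ring.independent R K (map b js) \<and> ring.Span R K (map b js) = carrier R)"

end

theory Submission
  imports Defs
begin

text \<open>At \<open>t = 1\<close> the atoms are unitriangular with respect to the products \<open>h\<^sub>\<mu>\<close> of complete functions,
  and so are the rectangular Schur functions that generate the ideal.  Together these two facts
  determine the quotient ring.

  Call the sum of the squares of its parts the spread of a partition.  Passing from a partition to one
  that strictly dominates it raises the spread (\<open>sum_squares_dominance\<close>), and spread and size are
  additive for the union of partitions, that is, for the product of monomials in the \<open>h\<^sub>i\<close>.  In the
  Jacobi--Trudi determinant of \<open>S\<^sub>\<lambda>\<close> the diagonal term is \<open>h\<^sub>\<lambda>\<close>, and all other terms have a strictly
  larger spread (\<open>leads_schur\<close>).  In a super atom all shapes dominate the indexing partition \<open>\<lambda>\<close>, and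
  \<open>\<lambda>\<close> itself is the shape of exactly one tableau, the superstandard one (\<open>super_atom_shapes\<close>); for this
  one needs that the operators \<open>\<sigma>\<^sub>i\<close> preserve tableaux and their shapes (\<open>sigma_tableau\<close>) and that a
  superstandard tableau is alone in its Knuth class (\<open>P_tableau_standard\<close>).  Hence
  \<open>A\<^sub>\<lambda>[X;1] = h\<^sub>\<lambda> + \<dots>\<close> with the remaining terms of larger spread (\<open>atom_leads\<close>).

  For this to be of use, the remaining terms must lie in the ring generated by \<open>h\<^sub>1, \<dots>, h\<^sub>k\<close>.  That comes
  from \<open>A\<^sub>\<lambda>[X;t] \<in> V\<^sub>k\<close> (\<open>specialization_in_V1\<close>).  By column operations in the Jacobi--Trudi determinant,
  \<open>S\<^sub>\<lambda>[Y + u]\<close> has degree at most \<open>\<lambda>\<^sub>1\<close> in the additional variable \<open>u\<close>.  So \<open>f[X + (1-t)u]\<close> has degree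
  at most \<open>k\<close> in \<open>u\<close> for all \<open>f \<in> V\<^sub>k\<close>.  The derivative of this expression by \<open>t\<close> at \<open>t = 1\<close> is a sum over
  \<open>n\<close> of \<open>-n u\<^sup>n\<close> times the partial derivative of \<open>f\<close> by the power sum \<open>p\<^sub>n\<close>, up to terms without \<open>u\<close>.
  Therefore \<open>f\<close> at \<open>t = 1\<close> is a polynomial in \<open>p\<^sub>1, \<dots>, p\<^sub>k\<close>.

  Finally let \<open>r\<^sub>\<ell>\<close> be the Schur function of the rectangle with \<open>k+1-\<ell>\<close> rows of length \<open>\<ell>\<close>.  Its leading
  monomial is the power of \<open>h\<^sub>\<ell>\<close> with exponent \<open>k+1-\<ell>\<close>.  Division with remainder
  of the exponents writes every monomial in \<open>h\<^sub>1, \<dots>, h\<^sub>k\<close> uniquely as a product of these powers and of an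
  irreducible monomial.  So the products of powers of the \<open>r\<^sub>\<ell>\<close> with an irreducible atom are
  unitriangular, hence a basis of \<open>V\<^sub>k(1)\<close>.  Multiplication by \<open>r\<^sub>\<ell>\<close> maps this basis into itself, so
  the ideal is spanned by the products containing some \<open>r\<^sub>\<ell>\<close>, and the products without any, which are
  the irreducible atoms, form a basis of the quotient (\<open>ring_basis_irreducible\<close>).\<close>

section \<open>Tableaux and their rows\<close>

text \<open>The rows can be recovered from a reading word: they are separated by its descents.\<close>

lemma concat_runs_inj:
  fixes xs ys :: "nat list list"
  assumes "\<forall>r\<in>set xs. r \<noteq> [] \<and> sorted r" "successively (\<lambda>r s. hd s < last r) xs"
    and "\<forall>r\<in>set ys. r \<noteq> [] \<and> sorted r" "successively (\<lambda>r s. hd s < last r) ys"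
    and "concat xs = concat ys"
  shows "xs = ys"
  using assms
proof (induction xs arbitrary: ys)
  case Nil
  then show ?case by (cases ys) auto
next
  case (Cons r xs)
  obtain s zs where ys: "ys = s # zs" using Cons.prems by (cases ys) auto
  have no_ext: False
    if "a = b @ us" "us \<noteq> []" "us @ concat as = concat bs" "sorted a" "b \<noteq> []"
      "successively (\<lambda>r s. hd s < last r) (b # bs)" "\<forall>r\<in>set bs. r \<noteq> []"
    for a b us :: "nat list" and as bs
  proof -
    note prems = that
    obtain c cs where bs: "bs = c # cs" using prems(2,3) by (cases bs) auto
    then have "c \<noteq> []" using prems(7) by simp
    then have "hd us = hd c" using prems(2,3) bs by (metis concat.simps(2) hd_append2)
    moreover have "hd c < last b" using prems(6) bs by simp
    moreover have "last b \<le> hd us"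
      using prems(1,2,4,5) by (auto simp: sorted_append)
    ultimately show False by simp
  qed
  have app: "r @ concat xs = s @ concat zs" using Cons.prems(5) ys by simp
  then obtain us where us: "r = s @ us \<and> us @ concat xs = concat zs \<or> r @ us = s \<and> concat xs = us @ concat zs"
    unfolding append_eq_append_conv2 by blast
  have "us = []"
  proof (rule ccontr)
    assume "us \<noteq> []"
    with us show False
    proof (elim disjE conjE)
      assume "r = s @ us" "us @ concat xs = concat zs"
      from no_ext[OF this(1) \<open>us \<noteq> []\<close> this(2)] show False using Cons.prems ys by auto
    next
      assume "r @ us = s" "concat xs = us @ concat zs"
      from no_ext[OF this(1)[symmetric] \<open>us \<noteq> []\<close> this(2)[symmetric]] show False using Cons.prems ys by auto
    qed
  qed
  then have "r = s" "concat xs = concat zs" using us by auto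
  moreover have "xs = zs"
    using Cons.IH[of zs] Cons.prems ys \<open>concat xs = concat zs\<close> by (auto simp: successively_Cons)
  ultimately show ?case using ys by simp
qed

lemma filling_row:
  assumes "tableau_filling R" "i < length R"
  shows "R ! i \<noteq> []" "sorted (R ! i)" "0 \<notin> set (R ! i)"
proof -
  have "length (R ! i) \<in> set (map length R)" using assms(2) by simp
  then show "R ! i \<noteq> []" using assms(1) by (auto simp: tableau_filling_def is_partition_def)
  show "sorted (R ! i)" "0 \<notin> set (R ! i)" using assms by (auto simp: tableau_filling_def)
qed

lemma filling_column:
  "tableau_filling R \<Longrightarrow> Suc i < length R \<Longrightarrow> j < length (R ! Suc i) \<Longrightarrow> R ! i ! j < R ! Suc i ! j"
  by (simp add: tableau_filling_def)

lemma filling_lengths: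
  assumes "tableau_filling R" "i \<le> j" "j < length R"
  shows "length (R ! j) \<le> length (R ! i)"
proof (cases "i = j")
  case False
  have "sorted_wrt (\<ge>) (map length R)" using assms(1) by (simp add: tableau_filling_def is_partition_def)
  then show ?thesis using False assms(2,3) by (auto simp: sorted_wrt_iff_nth_less)
qed simp

lemma filling_runs:
  assumes "tableau_filling R"
  shows "\<forall>r\<in>set (rev R). r \<noteq> [] \<and> sorted r" "successively (\<lambda>r s. hd s < last r) (rev R)"
proof -
  show "\<forall>r\<in>set (rev R). r \<noteq> [] \<and> sorted r"
    using filling_row[OF assms] by (metis in_set_conv_nth set_rev)
  have "hd (R ! i) < last (R ! Suc i)" if i: "Suc i < length R" for i
  proof -
    have ne: "R ! i \<noteq> []" "R ! Suc i \<noteq> []" "sorted (R ! Suc i)" using filling_row[OF assms] i by auto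
    then have "R ! i ! 0 < R ! Suc i ! 0" using filling_column[OF assms i, of 0] by simp
    also have "\<dots> \<le> last (R ! Suc i)"
      using ne(2,3) by (simp add: last_conv_nth sorted_nth_mono)
    finally show ?thesis using ne(1) by (simp add: hd_conv_nth)
  qed
  then show "successively (\<lambda>r s. hd s < last r) (rev R)"
    by (simp add: successively_conv_nth[of _ R])
qed

lemma reading_word_inj:
  assumes "tableau_filling R" "tableau_filling R'" "reading_word R = reading_word R'"
  shows "R = R'"
proof -
  have "rev R = rev R'"
    using concat_runs_inj[OF filling_runs[OF assms(1)] filling_runs[OF assms(2)]] assms(3)
    by (simp add: reading_word_def)
  then show ?thesis by simp
qed

lemma rows_reading_word: "tableau_filling R \<Longrightarrow> rows (reading_word R) = R"
  unfolding rows_def by (rule the_equality) (auto intro: reading_word_inj)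

lemma shape_reading_word: "tableau_filling R \<Longrightarrow> shape (reading_word R) = map length R"
  by (simp add: shape_def rows_reading_word)

lemma is_tableauE:
  assumes "is_tableau T"
  obtains R where "tableau_filling R" "T = reading_word R" "rows T = R" "shape T = map length R"
  using assms rows_reading_word shape_reading_word unfolding is_tableau_def by metis

lemma is_tableau_reading_word: "tableau_filling R \<Longrightarrow> is_tableau (reading_word R)"
  by (auto simp: is_tableau_def)

lemma set_reading_word: "set (reading_word R) = (\<Union>r\<in>set R. set r)"
  by (auto simp: reading_word_def)

lemma tableau_positive: "is_tableau T \<Longrightarrow> 0 \<notin> set T"
  by (erule is_tableauE) (auto simp: set_reading_word tableau_filling_def)

lemma count_reading_word: "count_list (reading_word R) y = (\<Sum>r\<leftarrow>R. count_list r y)"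
proof -
  have "count_list (concat xs) y = (\<Sum>r\<leftarrow>xs. count_list r y)" for xs :: "nat list list"
    by (induction xs) simp_all
  then show ?thesis by (simp add: reading_word_def rev_map[symmetric] sum_list_rev)
qed


section \<open>Adding a horizontal strip\<close>

lemma part_simps: "i < length p \<Longrightarrow> part p i = p ! i" "length p \<le> i \<Longrightarrow> part p i = 0"
  by (simp_all add: part_def)

lemma part_antimono:
  assumes "is_partition p" "i \<le> j" shows "part p j \<le> part p i"
proof (cases "i = j \<or> length p \<le> j")
  case False
  then show ?thesis
    using assms by (auto simp: part_def is_partition_def sorted_wrt_iff_nth_less)
qed (auto simp: part_def)

lemma part_pos: "is_partition p \<Longrightarrow> i < length p \<Longrightarrow> 0 < part p i"
  by (auto simp: part_def is_partition_def intro!: gr0I dest: nth_mem)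

lemma part_eqI:
  assumes "is_partition p" "is_partition q" "\<And>i. part p i = part q i"
  shows "p = q"
proof (rule nth_equalityI)
  show "length p = length q"
  proof (rule linorder_cases)
    assume "length p < length q"
    then show ?thesis using part_pos[OF assms(2), of "length p"] assms(3)[of "length p"]
      by (simp add: part_simps)
  next
    assume "length q < length p"
    then show ?thesis using part_pos[OF assms(1), of "length q"] assms(3)[of "length q"]
      by (simp add: part_simps)
  qed
  then show "p ! i = q ! i" if "i < length p" for i
    using assms(3)[of i] that by (simp add: part_simps)
qed

lemma part_Cons_0 [simp]: "part (x # p) 0 = x"
  and part_Cons_Suc [simp]: "part (x # p) (Suc i) = part p i"
  by (simp_all add: part_def)

lemma sum_part: "length p \<le> n \<Longrightarrow> (\<Sum>i<n. part p i) = sum_list p"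
proof -
  assume "length p \<le> n"
  then have "(\<Sum>i<n. part p i) = (\<Sum>i<length p. part p i)"
    by (intro sum.mono_neutral_right) (auto simp: part_simps)
  also have "\<dots> = (\<Sum>i<length p. p ! i)" by (intro sum.cong) (auto simp: part_simps)
  finally show ?thesis by (simp add: sum_list_sum_nth atLeast0LessThan)
qed

lemma length_row_at: "length (row_at R i) = part (map length R) i"
  by (simp add: row_at_def part_def)

lemma fill_strip_filling:
  assumes R: "tableau_filling R" and x: "\<And>y. y \<in> set (reading_word R) \<Longrightarrow> y < x" "0 < x"
    and s: "s \<in> strip_shapes r (map length R)"
  shows "tableau_filling (fill_strip R s x)" "map length (fill_strip R s x) = s"
    "count_list (reading_word (fill_strip R s x)) y =
       count_list (reading_word R) y + (if y = x then r else 0)"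
proof -
  let ?p = "map length R" and ?F = "fill_strip R s x"
  have s': "is_partition s" "horizontal_strip ?p s" "sum_list s = sum_list ?p + r"
    using s by (auto simp: strip_shapes_def)
  have sub: "part ?p i \<le> part s i" "part s (Suc i) \<le> part ?p i" for i
    using s'(2) by (auto simp: horizontal_strip_def)
  have len: "length ?F = length s" by (simp add: fill_strip_def)
  have row: "?F ! i = row_at R i @ replicate (s ! i - part ?p i) x" if "i < length s" for i
    using that by (simp add: fill_strip_def length_row_at)
  have row_len: "length (?F ! i) = s ! i" if "i < length s" for i
    using sub(1)[of i] that by (simp add: row length_row_at part_simps(1)[of i s])
  show shape: "map length ?F = s" using len row_len by (intro nth_equalityI) auto
  have rowsx: "sorted (row_at R i) \<and> 0 \<notin> set (row_at R i) \<and> (\<forall>y\<in>set (row_at R i). y < x)" for i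
  proof (cases "i < length R")
    case True
    then have "set (R ! i) \<subseteq> set (reading_word R)"
      by (auto simp: set_reading_word intro!: bexI[of _ "R ! i"] True)
    then show ?thesis using filling_row[OF R True] x(1) True by (auto simp: row_at_def)
  qed (simp add: row_at_def)
  have nth: "?F ! i ! j = (if j < part ?p i then R ! i ! j else x)"
    if "i < length s" "j < s ! i" for i j
  proof (cases "j < part ?p i")
    case True
    then have "i < length R" by (auto simp: part_def split: if_splits)
    then show ?thesis using True that by (simp add: row nth_append row_at_def part_def)
  next
    case False
    then show ?thesis using that by (simp add: row nth_append length_row_at)
  qed
  show "tableau_filling ?F"
    unfolding tableau_filling_def shape
  proof (intro conjI s'(1) ballI allI impI)
    fix u assume "u \<in> set ?F"
    then obtain i where i: "i < length s" "u = ?F ! i" using len by (metis in_set_conv_nth)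
    show "sorted u" "0 \<notin> set u"
      using rowsx[of i] x(2) by (auto simp: i row sorted_append)
  next
    fix i j assume i: "Suc i < length ?F" and j: "j < length (?F ! Suc i)"
    then have ij: "Suc i < length s" "j < s ! Suc i" using len row_len by auto
    have jp: "j < part ?p i" using sub(2)[of i] ij by (simp add: part_simps)
    then have iR: "i < length R" by (auto simp: part_def split: if_splits)
    have "j < s ! i" using sub(1)[of i] jp ij by (simp add: part_simps)
    then have low: "?F ! i ! j = R ! i ! j" using nth[of i j] ij jp by simp
    show "?F ! i ! j < ?F ! Suc i ! j"
    proof (cases "j < part ?p (Suc i)")
      case True
      then have "Suc i < length R" "j < length (R ! Suc i)" by (auto simp: part_def split: if_splits)
      then show ?thesis using filling_column[OF R] low nth[OF ij] True by simp
    next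
      case False
      have "R ! i ! j \<in> set (reading_word R)"
        using jp iR by (auto simp: set_reading_word part_def intro!: bexI[of _ "R ! i"])
      then show ?thesis using x(1) low nth[OF ij] False by simp
    qed
  qed
  have lenp: "length ?p \<le> length s"
  proof (rule ccontr)
    assume "\<not> ?thesis"
    then have "part s (length s) = 0" "0 < part ?p (length s)"
      using part_pos[of ?p "length s"] R by (auto simp: part_simps tableau_filling_def)
    then show False using sub(1)[of "length s"] by simp
  qed
  have "count_list (reading_word ?F) y = (\<Sum>i<length s. count_list (?F ! i) y)"
    by (simp add: count_reading_word sum_list_sum_nth len atLeast0LessThan)
  also have "\<dots> = (\<Sum>i<length s. count_list (row_at R i) y + (if y = x then part s i - part ?p i else 0))"
  proof (intro sum.cong refl)
    fix i assume "i \<in> {..<length s}"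
    moreover have "count_list (replicate n x) y = (if y = x then n else 0)" for n
      by (induction n) auto
    ultimately show "count_list (?F ! i) y =
        count_list (row_at R i) y + (if y = x then part s i - part ?p i else 0)"
      by (simp add: row part_simps(1)[of i s])
  qed
  also have "\<dots> = (\<Sum>i<length s. count_list (row_at R i) y) +
      (if y = x then (\<Sum>i<length s. part s i - part ?p i) else 0)"
    by (simp add: sum.distrib)
  also have "(\<Sum>i<length s. part s i - part ?p i) = r"
  proof -
    have "(\<Sum>i<length s. part s i - part ?p i) + (\<Sum>i<length s. part ?p i) = (\<Sum>i<length s. part s i)"
      using sub(1) by (simp flip: sum.distrib)
    then show ?thesis using sum_part[OF lenp] sum_part[of s "length s"] s'(3) by simp
  qed
  also have "(\<Sum>i<length s. count_list (row_at R i) y) = count_list (reading_word R) y"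
  proof -
    have "(\<Sum>i<length s. count_list (row_at R i) y) = (\<Sum>i<length R. count_list (row_at R i) y)"
      using lenp by (intro sum.mono_neutral_right) (auto simp: row_at_def)
    then show ?thesis
      by (simp add: count_reading_word sum_list_sum_nth atLeast0LessThan row_at_def)
  qed
  finally show "count_list (reading_word ?F) y =
       count_list (reading_word R) y + (if y = x then r else 0)" .
qed

lemma add_strip_tableau:
  assumes T: "is_tableau T" "\<And>y. y \<in> set T \<Longrightarrow> y < x" "0 < x" and U: "U \<in> add_strip r x T"
  shows "is_tableau U" "shape U \<in> strip_shapes r (shape T)"
    "count_list U y = count_list T y + (if y = x then r else 0)"
proof -
  obtain R where R: "tableau_filling R" "T = reading_word R" "rows T = R" "shape T = map length R"
    using T(1) by (rule is_tableauE)
  obtain s where s: "s \<in> strip_shapes r (map length R)" "U = reading_word (fill_strip R s x)"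
    using U R by (auto simp: add_strip_def)
  note f = fill_strip_filling[OF R(1) _ T(3) s(1)]
  have x: "\<And>y. y \<in> set (reading_word R) \<Longrightarrow> y < x" using T(2) R(2) by simp
  show "is_tableau U" using f(1)[OF x] s(2) by (simp add: is_tableau_reading_word)
  show "shape U \<in> strip_shapes r (shape T)"
    using f(1,2)[OF x] s R(4) by (simp add: shape_reading_word)
  show "count_list U y = count_list T y + (if y = x then r else 0)"
    using f(3)[OF x] s(2) R(2) by simp
qed

text \<open>A strip is determined by the shape that it leads to.\<close>

lemma add_strip_unique:
  assumes T: "is_tableau T" "\<And>y. y \<in> set T \<Longrightarrow> y < x" "0 < x"
  shows "{U \<in> add_strip r x T. shape U = s} =
    (if s \<in> strip_shapes r (shape T) then {reading_word (fill_strip (rows T) s x)} else {})"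
proof -
  obtain R where R: "tableau_filling R" "T = reading_word R" "rows T = R" "shape T = map length R"
    using T(1) by (rule is_tableauE)
  have "shape (reading_word (fill_strip R u x)) = u" if "u \<in> strip_shapes r (map length R)" for u
    using fill_strip_filling(1,2)[OF R(1) _ T(3) that] T(2) R(2) by (simp add: shape_reading_word)
  then show ?thesis by (auto simp: add_strip_def R(3,4))
qed

section \<open>The symmetric group action on tableaux\<close>

text \<open>The letters \<open>i+1\<close> and \<open>i\<close> are opening and closing brackets.  The height of a position is the
  difference of their numbers in the prefix before it.\<close>

definition excess :: "nat \<Rightarrow> word \<Rightarrow> int" where
  "excess i w = int (count_list w (Suc i)) - int (count_list w i)"

abbreviation height :: "nat \<Rightarrow> word \<Rightarrow> nat \<Rightarrow> int" where
  "height i w n \<equiv> excess i (take n w)"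

lemma excess_append: "excess i (u @ v) = excess i u + excess i v"
  by (simp add: excess_def)

lemma excess_Nil [simp]: "excess i [] = 0"
  by (simp add: excess_def)

lemma height_Suc:
  "n < length w \<Longrightarrow> height i w (Suc n) = height i w n +
     (if w ! n = Suc i then 1 else if w ! n = i then -1 else 0)"
  by (simp add: take_Suc_conv_app_nth excess_append) (simp add: excess_def)

lemma cancel_pairs_append:
  "cancel_pairs i st (xs @ ys) = cancel_pairs i (rev (cancel_pairs i st xs)) ys"
  by (induction i st xs rule: cancel_pairs.induct) simp_all

lemma unpaired_snoc:
  "rev (unpaired i (w @ [x])) =
     (if x = i \<or> x = Suc i then
        (case rev (unpaired i w) of [] \<Rightarrow> [(length w, x)]
         | y # st \<Rightarrow> if snd y = Suc i \<and> x = i then st else (length w, x) # y # st)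
      else rev (unpaired i w))"
proof -
  let ?f = "\<lambda>w. filter (\<lambda>(_, x). x = i \<or> x = Suc i) (zip [0..<length w] w)"
  have "?f (w @ [x]) = ?f w @ (if x = i \<or> x = Suc i then [(length w, x)] else [])"
    by simp
  then have "unpaired i (w @ [x]) =
      cancel_pairs i (rev (unpaired i w)) (if x = i \<or> x = Suc i then [(length w, x)] else [])"
    unfolding unpaired_def by (simp only: cancel_pairs_append)
  then show ?thesis by (simp split: list.split)
qed

text \<open>The state of the bracketing after a word \<open>w\<close> has been scanned: the unpaired letters, last
  one first, are letters \<open>i+1\<close> at the positions \<open>as\<close>, then letters \<open>i\<close> at the positions \<open>bs\<close>.
  The heights at the positions \<open>as\<close> drop by one from each to the next; together with the minimum
  of the heights this is what lets the characterizations of the unpaired positions survive a step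
  of the scan.\<close>

locale unpaired_positions =
  fixes i :: nat and w :: word and as bs :: "nat list"
  assumes srt: "sorted_wrt (>) (as @ bs)"
    and la: "p \<in> set as \<Longrightarrow> p < length w \<and> w ! p = Suc i"
    and lb: "p \<in> set bs \<Longrightarrow> p < length w \<and> w ! p = i"
    and ha: "a < length as \<Longrightarrow> height i w (as ! a) = excess i w - int a - 1"
    and mn: "q \<le> length w \<Longrightarrow> excess i w - int (length as) \<le> height i w q"
    and ub: "p \<in> set bs \<Longrightarrow> q \<le> p \<Longrightarrow> height i w (Suc p) < height i w q"
    and ua: "p \<in> set as \<Longrightarrow> q \<le> length w \<Longrightarrow> p < q \<Longrightarrow> height i w p < height i w q"
    and cb: "p < length w \<Longrightarrow> w ! p = i \<Longrightarrow> p \<notin> set bs \<Longrightarrow>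
      \<exists>q\<le>p. height i w q \<le> height i w (Suc p)"
    and ca: "p < length w \<Longrightarrow> w ! p = Suc i \<Longrightarrow> p \<notin> set as \<Longrightarrow>
      \<exists>q\<le>length w. p < q \<and> height i w q \<le> height i w p"
    and tot: "excess i w = int (length as) - int (length bs)"

lemma unpaired_structure:
  "\<exists>as bs. rev (unpaired i w) = map (\<lambda>p. (p, Suc i)) as @ map (\<lambda>p. (p, i)) bs \<and>
     unpaired_positions i w as bs"
proof (induction w rule: rev_induct)
  case Nil
  then show ?case
    by (intro exI[of _ "[]"] conjI unpaired_positions.intro) (simp_all add: unpaired_def)
next
  case (snoc x w)
  then obtain as bs where st: "rev (unpaired i w) = map (\<lambda>p. (p, Suc i)) as @ map (\<lambda>p. (p, i)) bs"
    and up: "unpaired_positions i w as bs" by blast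
  let ?n = "length w" and ?w = "w @ [x]"
  interpret unpaired_positions i w as bs by (rule up)
  define E where "E = excess i w"
  define h where "h q = height i w q" for q
  define \<delta> where "\<delta> = (if x = Suc i then 1 else if x = i then -1 else 0 :: int)"
  have new: "excess i ?w = E + \<delta>"
    by (simp add: excess_append E_def \<delta>_def) (simp add: excess_def)
  have height: "height i ?w q = (if q \<le> ?n then h q else E + \<delta>)" for q
    using new by (simp add: h_def)
  have hn: "h ?n = E" by (simp add: h_def E_def)
  have nth: "?w ! p = (if p < ?n then w ! p else x)" if "p \<le> ?n" for p
    using that by (simp add: nth_append)
  have len: "length ?w = Suc ?n" by simp
  have la': "p < ?n" "w ! p = Suc i" "h p < E" if "p \<in> set as" for p
    using la[OF that] ua[OF that, of ?n] hn by (simp_all add: h_def E_def)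
  have lb': "p < ?n" "w ! p = i" if "p \<in> set bs" for p using lb[OF that] by simp_all
  have ha': "h (as ! a) = E - int a - 1" if "a < length as" for a
    using ha[OF that] by (simp add: h_def E_def)
  have mn': "E - int (length as) \<le> h q" if "q \<le> ?n" for q using mn[OF that] by (simp add: h_def E_def)
  have ub': "h (Suc p) < h q" if "p \<in> set bs" "q \<le> p" for p q using ub[OF that] by (simp add: h_def)
  have ua': "h p < h q" if "p \<in> set as" "q \<le> ?n" "p < q" for p q using ua[OF that] by (simp add: h_def)
  have cb': "\<exists>q\<le>p. (if q \<le> ?n then h q else e) \<le> (if Suc p \<le> ?n then h (Suc p) else e)"
    if "p < ?n" "w ! p = i" "p \<notin> set bs" for p and e :: int
  proof -
    note prems = that
    obtain q where "q \<le> p" "h q \<le> h (Suc p)" using cb[OF prems] unfolding h_def by blast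
    then show ?thesis using prems(1) by (intro exI[of _ q]) simp
  qed
  have ca': "\<exists>q\<le>Suc ?n. p < q \<and> (if q \<le> ?n then h q else e) \<le> (if p \<le> ?n then h p else e)"
    if "p < ?n" "w ! p = Suc i" "p \<notin> set as" for p and e :: int
  proof -
    note prems = that
    obtain q where "q \<le> ?n" "p < q" "h q \<le> h p" using ca[OF prems] unfolding h_def by blast
    then show ?thesis using prems(1) by (intro exI[of _ q]) simp
  qed
  have pos: "p < ?n \<and> w ! p = y" if "p < Suc ?n" "?w ! p = y" "x \<noteq> y" for p y
    using that by (cases "p = ?n") (auto simp: nth_append)
  consider (other) "x \<noteq> i" "x \<noteq> Suc i" | (open') "x = Suc i" | (close') a as' where "x = i" "as = a # as'"
    | (unmatched) "x = i" "as = []"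
    by (cases as) auto
  then show ?case
  proof cases
    case other
    then have \<delta>: "\<delta> = 0" by (simp add: \<delta>_def)
    have "unpaired_positions i ?w as bs"
    proof (rule unpaired_positions.intro, unfold len new height \<delta>)
      show "sorted_wrt (>) (as @ bs)" by (rule srt)
      show "p < Suc ?n \<and> ?w ! p = Suc i" if "p \<in> set as" for p using la'[OF that] by (simp add: nth)
      show "p < Suc ?n \<and> ?w ! p = i" if "p \<in> set bs" for p using lb'[OF that] by (simp add: nth)
      show "(if as ! a \<le> ?n then h (as ! a) else E + 0) = E + 0 - int a - 1" if "a < length as" for a
        using la'(1)[of "as ! a"] ha'[OF that] that by simp
      show "E + 0 - int (length as) \<le> (if q \<le> ?n then h q else E + 0)" for q
        using mn'[of q] by simp
      show "(if Suc p \<le> ?n then h (Suc p) else E + 0) < (if q \<le> ?n then h q else E + 0)"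
        if "p \<in> set bs" "q \<le> p" for p q using lb'[OF that(1)] ub'[OF that] that(2) by simp
      show "(if p \<le> ?n then h p else E + 0) < (if q \<le> ?n then h q else E + 0)"
        if "p \<in> set as" "p < q" for p q using la'[OF that(1)] ua'[OF that(1) _ that(2)] by simp
      show "\<exists>q\<le>p. (if q \<le> ?n then h q else E + 0) \<le> (if Suc p \<le> ?n then h (Suc p) else E + 0)"
        if "p < Suc ?n" "?w ! p = i" "p \<notin> set bs" for p
        using pos[OF that(1,2)] other that(3) by (intro cb') auto
      show "\<exists>q\<le>Suc ?n. p < q \<and> (if q \<le> ?n then h q else E + 0) \<le> (if p \<le> ?n then h p else E + 0)"
        if "p < Suc ?n" "?w ! p = Suc i" "p \<notin> set as" for p
        using pos[OF that(1,2)] other that(3) by (intro ca') auto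
      show "E + 0 = int (length as) - int (length bs)" using tot by (simp add: E_def)
    qed
    then show ?thesis using st other unpaired_snoc[of i w x] by auto
  next
    case open'
    then have \<delta>: "\<delta> = 1" by (simp add: \<delta>_def)
    have "unpaired_positions i ?w (?n # as) bs"
    proof (rule unpaired_positions.intro, unfold len new height \<delta>)
      show "sorted_wrt (>) ((?n # as) @ bs)" using srt la' lb' by auto
      show "p < Suc ?n \<and> ?w ! p = Suc i" if "p \<in> set (?n # as)" for p
        using la'[of p] that open' by (auto simp: nth_append)
      show "p < Suc ?n \<and> ?w ! p = i" if "p \<in> set bs" for p using lb'[OF that] by (simp add: nth)
      show "(if (?n # as) ! a \<le> ?n then h ((?n # as) ! a) else E + 1) = E + 1 - int a - 1"
        if "a < length (?n # as)" for a
      proof (cases a)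
        case 0
        then show ?thesis using hn by simp
      next
        case (Suc b)
        then show ?thesis using la'(1)[of "as ! b"] ha'[of b] that by simp
      qed
      show "E + 1 - int (length (?n # as)) \<le> (if q \<le> ?n then h q else E + 1)" for q
        using mn'[of q] by simp
      show "(if Suc p \<le> ?n then h (Suc p) else E + 1) < (if q \<le> ?n then h q else E + 1)"
        if "p \<in> set bs" "q \<le> p" for p q using lb'[OF that(1)] ub'[OF that] that(2) by simp
      show "(if p \<le> ?n then h p else E + 1) < (if q \<le> ?n then h q else E + 1)"
        if "p \<in> set (?n # as)" "p < q" "q \<le> Suc ?n" for p q
      proof (cases "p = ?n")
        case True
        then show ?thesis using that(2) hn by simp
      next
        case False
        then have "p \<in> set as" using that(1) by simp
        then show ?thesis using la'[of p] ua'[of p q] that(2) by simp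
      qed
      show "\<exists>q\<le>p. (if q \<le> ?n then h q else E + 1) \<le> (if Suc p \<le> ?n then h (Suc p) else E + 1)"
        if "p < Suc ?n" "?w ! p = i" "p \<notin> set bs" for p
        using pos[OF that(1,2)] open' that(3) by (intro cb') auto
      show "\<exists>q\<le>Suc ?n. p < q \<and> (if q \<le> ?n then h q else E + 1) \<le> (if p \<le> ?n then h p else E + 1)"
        if "p < Suc ?n" "?w ! p = Suc i" "p \<notin> set (?n # as)" for p
        using that by (intro ca') (auto simp: nth_append less_Suc_eq)
      show "E + 1 = int (length (?n # as)) - int (length bs)" using tot by (simp add: E_def)
    qed
    moreover have "rev (unpaired i ?w) = map (\<lambda>p. (p, Suc i)) (?n # as) @ map (\<lambda>p. (p, i)) bs"
      using st open' unpaired_snoc[of i w x] by (auto split: list.split)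
    ultimately show ?thesis by blast
  next
    case close'
    then have \<delta>: "\<delta> = -1" by (simp add: \<delta>_def)
    have a: "a < ?n" "h a = E - 1" "w ! a = Suc i"
      using la'[of a] ha'[of 0] close' by auto
    have as': "p \<in> set as" "h p < E - 1" if "p \<in> set as'" for p
    proof -
      show "p \<in> set as" using that close' by simp
      then have "p < a" using srt that close' by auto
      then show "h p < E - 1" using ua'[of p a] a \<open>p \<in> set as\<close> by simp
    qed
    have "unpaired_positions i ?w as' bs"
    proof (rule unpaired_positions.intro, unfold len new height \<delta>)
      show "sorted_wrt (>) (as' @ bs)" using srt close' by simp
      show "p < Suc ?n \<and> ?w ! p = Suc i" if "p \<in> set as'" for p
        using la'[OF as'(1)[OF that]] by (simp add: nth)
      show "p < Suc ?n \<and> ?w ! p = i" if "p \<in> set bs" for p using lb'[OF that] by (simp add: nth)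
      show "(if as' ! j \<le> ?n then h (as' ! j) else E + -1) = E + -1 - int j - 1"
        if "j < length as'" for j
        using la'(1)[OF as'(1), of "as' ! j"] ha'[of "Suc j"] that close' by simp
      show "E + -1 - int (length as') \<le> (if q \<le> ?n then h q else E + -1)" for q
        using mn'[of q] close' by (cases "q \<le> ?n") auto
      show "(if Suc p \<le> ?n then h (Suc p) else E + -1) < (if q \<le> ?n then h q else E + -1)"
        if "p \<in> set bs" "q \<le> p" for p q using lb'[OF that(1)] ub'[OF that] that(2) by simp
      show "(if p \<le> ?n then h p else E + -1) < (if q \<le> ?n then h q else E + -1)"
        if "p \<in> set as'" "p < q" for p q
        using la'[OF as'(1)[OF that(1)]] ua'[OF as'(1)[OF that(1)] _ that(2)] as'(2)[OF that(1)] by simp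
      show "\<exists>q\<le>p. (if q \<le> ?n then h q else E + -1) \<le> (if Suc p \<le> ?n then h (Suc p) else E + -1)"
        if "p < Suc ?n" "?w ! p = i" "p \<notin> set bs" for p
      proof (cases "p < ?n")
        case True
        then show ?thesis using that by (intro cb') (auto simp: nth_append)
      next
        case False
        then show ?thesis using a that(1) by (intro exI[of _ a]) simp
      qed
      show "\<exists>q\<le>Suc ?n. p < q \<and> (if q \<le> ?n then h q else E + -1) \<le> (if p \<le> ?n then h p else E + -1)"
        if "p < Suc ?n" "?w ! p = Suc i" "p \<notin> set as'" for p
      proof -
        have "p < ?n" using that(1,2) close' nth[of p] by (cases "p < ?n") auto
        show ?thesis
        proof (cases "p = a")
          case True
          then show ?thesis using a by (intro exI[of _ "Suc ?n"]) simp
        next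
          case False
          then show ?thesis
            using that \<open>p < ?n\<close> close' by (intro ca') (auto simp: nth_append)
        qed
      qed
      show "E + -1 = int (length as') - int (length bs)" using tot close' by (simp add: E_def)
    qed
    moreover have "rev (unpaired i ?w) = map (\<lambda>p. (p, Suc i)) as' @ map (\<lambda>p. (p, i)) bs"
      using st close' unpaired_snoc[of i w x] by auto
    ultimately show ?thesis by blast
  next
    case unmatched
    then have \<delta>: "\<delta> = -1" by (simp add: \<delta>_def)
    have "unpaired_positions i ?w [] (?n # bs)"
    proof (rule unpaired_positions.intro, unfold len new height \<delta>)
      show "sorted_wrt (>) ([] @ ?n # bs)" using srt lb' unmatched by auto
      show "p < Suc ?n \<and> ?w ! p = i" if "p \<in> set (?n # bs)" for p
        using lb'[of p] that unmatched by (auto simp: nth_append)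
      show "E + -1 - int (length []) \<le> (if q \<le> ?n then h q else E + -1)" for q
        using mn'[of q] unmatched by (cases "q \<le> ?n") auto
      show "(if Suc p \<le> ?n then h (Suc p) else E + -1) < (if q \<le> ?n then h q else E + -1)"
        if "p \<in> set (?n # bs)" "q \<le> p" for p q
      proof (cases "p = ?n")
        case True
        then show ?thesis using mn'[of q] that(2) unmatched by simp
      next
        case False
        then have "p \<in> set bs" using that(1) by simp
        then show ?thesis using lb'[of p] ub'[of p q] that(2) by simp
      qed
      show "\<exists>q\<le>p. (if q \<le> ?n then h q else E + -1) \<le> (if Suc p \<le> ?n then h (Suc p) else E + -1)"
        if "p < Suc ?n" "?w ! p = i" "p \<notin> set (?n # bs)" for p
        using that by (intro cb') (auto simp: nth_append less_Suc_eq)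
      show "\<exists>q\<le>Suc ?n. p < q \<and> (if q \<le> ?n then h q else E + -1) \<le> (if p \<le> ?n then h p else E + -1)"
        if "p < Suc ?n" "?w ! p = Suc i" "p \<notin> set []" for p
        using pos[OF that(1,2)] unmatched that(3) by (intro ca') auto
      show "E + -1 = int (length []) - int (length (?n # bs))" using tot unmatched by (simp add: E_def)
    qed simp_all
    moreover have "rev (unpaired i ?w) = map (\<lambda>p. (p, Suc i)) [] @ map (\<lambda>p. (p, i)) (?n # bs)"
      using st unmatched unpaired_snoc[of i w x] by (auto split: list.split)
    ultimately show ?thesis by blast
  qed
qed

lemma fold_list_update:
  assumes "distinct ps" "length xs = length ps" "\<forall>p\<in>set ps. p < length v"
  defines "v' \<equiv> fold (\<lambda>(n, x) v. v[n := x]) (zip ps xs) v"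
  shows "length v' = length v" "\<And>j. j \<notin> set ps \<Longrightarrow> v' ! j = v ! j"
    "\<And>a. a < length ps \<Longrightarrow> v' ! (ps ! a) = xs ! a"
proof -
  have "length (fold (\<lambda>(n, x) v. v[n := x]) (zip ps xs) v) = length v \<and>
      (\<forall>j. j \<notin> set ps \<longrightarrow> fold (\<lambda>(n, x) v. v[n := x]) (zip ps xs) v ! j = v ! j) \<and>
      (\<forall>a<length ps. fold (\<lambda>(n, x) v. v[n := x]) (zip ps xs) v ! (ps ! a) = xs ! a)"
    using assms(1,2,3)
  proof (induction ps arbitrary: xs v)
    case (Cons p ps)
    obtain x ys where xs: "xs = x # ys" using Cons.prems(2) by (cases xs) auto
    have IH: "length (fold (\<lambda>(n, x) v. v[n := x]) (zip ps ys) (v[p := x])) = length (v[p := x]) \<and>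
      (\<forall>j. j \<notin> set ps \<longrightarrow> fold (\<lambda>(n, x) v. v[n := x]) (zip ps ys) (v[p := x]) ! j = v[p := x] ! j) \<and>
      (\<forall>a<length ps. fold (\<lambda>(n, x) v. v[n := x]) (zip ps ys) (v[p := x]) ! (ps ! a) = ys ! a)"
      using Cons.prems xs by (intro Cons.IH) auto
    then show ?case using Cons.prems xs
      by (auto simp: nth_Cons split: nat.split)
  qed simp
  then show "length v' = length v" "\<And>j. j \<notin> set ps \<Longrightarrow> v' ! j = v ! j"
    "\<And>a. a < length ps \<Longrightarrow> v' ! (ps ! a) = xs ! a"
    unfolding v'_def by blast+
qed

lemma count_list_card: "count_list w y = card {j. j < length w \<and> w ! j = y}"
proof -
  have "count_list w y = length (filter (\<lambda>x. x = y) w)" by (induction w) auto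
  then show ?thesis by (simp add: length_filter_conv_card)
qed

text \<open>Only the positions \<open>P\<close> of the unpaired letters matter for \<open>sigma i\<close>.  Their new letters increase
  along the word, and whether a position belongs to \<open>P\<close> can be read off the heights.\<close>

lemma sigma_effect:
  obtains P where
    "length (sigma i w) = length w"
    "\<And>j. j \<in> P \<Longrightarrow> j < length w"
    "\<And>j. j \<notin> P \<Longrightarrow> sigma i w ! j = w ! j"
    "\<And>j. j \<in> P \<Longrightarrow> w ! j = i \<or> w ! j = Suc i"
    "\<And>j. j \<in> P \<Longrightarrow> sigma i w ! j = i \<or> sigma i w ! j = Suc i"
    "\<And>j l. j \<in> P \<Longrightarrow> l \<in> P \<Longrightarrow> j < l \<Longrightarrow> sigma i w ! j \<le> sigma i w ! l"
    "\<And>j q. j \<in> P \<Longrightarrow> w ! j = i \<Longrightarrow> q \<le> j \<Longrightarrow> height i w (Suc j) < height i w q"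
    "\<And>j q. j \<in> P \<Longrightarrow> w ! j = Suc i \<Longrightarrow> q \<le> length w \<Longrightarrow> j < q \<Longrightarrow> height i w j < height i w q"
    "\<And>j. j < length w \<Longrightarrow> w ! j = i \<Longrightarrow> j \<notin> P \<Longrightarrow> \<exists>q\<le>j. height i w q \<le> height i w (Suc j)"
    "\<And>j. j < length w \<Longrightarrow> w ! j = Suc i \<Longrightarrow> j \<notin> P \<Longrightarrow>
      \<exists>q\<le>length w. j < q \<and> height i w q \<le> height i w j"
    "\<And>y. count_list (sigma i w) y =
      count_list w (if y = i then Suc i else if y = Suc i then i else y)"
proof -
  obtain as bs where st: "rev (unpaired i w) = map (\<lambda>p. (p, Suc i)) as @ map (\<lambda>p. (p, i)) bs"
    and up: "unpaired_positions i w as bs"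
    using unpaired_structure by blast
  interpret unpaired_positions i w as bs by (rule up)
  define ps where "ps = rev bs @ rev as"
  define xs where "xs = replicate (length as) i @ replicate (length bs) (Suc i)"
  have U: "unpaired i w = map (\<lambda>p. (p, i)) (rev bs) @ map (\<lambda>p. (p, Suc i)) (rev as)"
    using arg_cong[OF st, of rev] by (simp add: rev_map)
  have sps: "sorted_wrt (<) ps"
    using srt by (simp add: ps_def sorted_wrt_rev flip: rev_append)
  then have dps: "distinct ps" by (simp add: strict_sorted_iff)
  have set_ps: "set ps = set as \<union> set bs" by (auto simp: ps_def)
  have cl: "count_list (map (\<lambda>p. c) zs) i = (if c = i then length zs else 0)" for c and zs :: "nat list"
    by (induction zs) auto
  have "map fst (unpaired i w) = ps" by (simp add: U ps_def o_def)
  moreover have "count_list (map snd (unpaired i w)) i = length bs"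
    by (simp add: U o_def cl)
  ultimately have sig: "sigma i w = fold (\<lambda>(n, x) v. v[n := x]) (zip ps xs) w"
    by (simp add: sigma_def Let_def xs_def) (simp add: ps_def)
  have lxs: "length xs = length ps" by (simp add: xs_def ps_def)
  have bnd: "\<forall>p\<in>set ps. p < length w" using la lb by (auto simp: set_ps)
  note f = fold_list_update[OF dps lxs bnd, folded sig]
  have val: "sigma i w ! (ps ! a) = (if a < length as then i else Suc i)" if "a < length ps" for a
    using f(3)[OF that] that by (simp add: xs_def nth_append ps_def)
  have val_set: "sigma i w ! j = i \<or> sigma i w ! j = Suc i" if j: "j \<in> set ps" for j
  proof -
    obtain a where "a < length ps" "j = ps ! a" using j by (metis in_set_conv_nth)
    then show ?thesis using val by simp
  qed
  have mono: "sigma i w ! j \<le> sigma i w ! l" if jl: "j \<in> set ps" "l \<in> set ps" "j < l" for j l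
  proof -
    obtain a b where ab: "a < length ps" "j = ps ! a" "b < length ps" "l = ps ! b"
      using jl(1,2) by (metis in_set_conv_nth)
    have "a < b"
    proof (rule ccontr)
      assume "\<not> a < b"
      then have "b < a \<or> a = b" by auto
      then have "ps ! b \<le> ps ! a"
        using sps[unfolded sorted_wrt_iff_nth_less, rule_format, of b a] ab(1) by auto
      then show False using jl(3) ab by simp
    qed
    then show ?thesis using val ab by auto
  qed
  have "distinct as" "distinct bs" using dps by (simp_all add: ps_def)
  have cnt: "count_list (sigma i w) y =
      count_list w (if y = i then Suc i else if y = Suc i then i else y)" for y
  proof -
    let ?C = "\<lambda>v y. {j. j < length w \<and> v ! j = y}"
    have new_set: "?C (sigma i w) y = (?C w y - set ps) \<union> ((!) ps) ` {a. a < length ps \<and> xs ! a = y}"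
    proof (intro equalityI subsetI)
      fix j assume j: "j \<in> ?C (sigma i w) y"
      show "j \<in> (?C w y - set ps) \<union> ((!) ps) ` {a. a < length ps \<and> xs ! a = y}"
      proof (cases "j \<in> set ps")
        case True
        then obtain a where "a < length ps" "j = ps ! a" by (metis in_set_conv_nth)
        then show ?thesis using f(3) j by auto
      qed (use j f(2) in auto)
    next
      fix j assume "j \<in> (?C w y - set ps) \<union> ((!) ps) ` {a. a < length ps \<and> xs ! a = y}"
      then show "j \<in> ?C (sigma i w) y" using f(2,3) bnd by auto
    qed
    have inj: "inj_on ((!) ps) {a. a < length ps \<and> xs ! a = y}"
      using dps by (auto simp: inj_on_def nth_eq_iff_index_eq)
    have "count_list xs y = (if y = i then length as else if y = Suc i then length bs else 0)"
    proof -
      have "count_list (replicate n c) y = (if y = c then n else 0)" for n c :: nat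
        by (induction n) auto
      then show ?thesis by (simp add: xs_def)
    qed
    moreover have "card (((!) ps) ` {a. a < length ps \<and> xs ! a = y}) = count_list xs y"
      by (simp add: card_image[OF inj] count_list_card lxs)
    moreover have "((!) ps) ` {a. a < length ps \<and> xs ! a = y} \<subseteq> set ps" by auto
    moreover have "card (?C (sigma i w) y) = card (?C w y - set ps) +
        card (((!) ps) ` {a. a < length ps \<and> xs ! a = y})"
      unfolding new_set by (intro card_Un_disjoint) auto
    ultimately have card_new: "count_list (sigma i w) y = card (?C w y - set ps) +
        (if y = i then length as else if y = Suc i then length bs else 0)"
      by (simp add: count_list_card[of "sigma i w"] f(1))
    have minus: "card (?C w y - set ps) = count_list w y - card (?C w y \<inter> set ps)"
      by (simp add: card_Diff_subset_Int count_list_card)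
    have "?C w y \<inter> set ps = (if y = i then set bs else if y = Suc i then set as else {})"
      using la lb by (auto simp: set_ps)
    then have inter: "card (?C w y \<inter> set ps) = (if y = i then length bs else if y = Suc i then length as else 0)"
      using \<open>distinct as\<close> \<open>distinct bs\<close> by (simp add: distinct_card)
    have le: "card (?C w y \<inter> set ps) \<le> count_list w y"
      unfolding count_list_card by (intro card_mono) auto
    have "int (count_list w (Suc i)) - int (count_list w i) = int (length as) - int (length bs)"
      using tot by (simp add: excess_def)
    then show ?thesis using card_new minus inter le by (auto split: if_splits)
  qed
  show ?thesis
  proof (rule that[of "set ps"])
    show "length (sigma i w) = length w" by (rule f(1))
    show "j < length w" if "j \<in> set ps" for j using bnd that by blast
    show "sigma i w ! j = w ! j" if "j \<notin> set ps" for j using f(2)[OF that] .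
    show "w ! j = i \<or> w ! j = Suc i" if "j \<in> set ps" for j using that la lb by (auto simp: set_ps)
    show "sigma i w ! j = i \<or> sigma i w ! j = Suc i" if "j \<in> set ps" for j using val_set[OF that] .
    show "sigma i w ! j \<le> sigma i w ! l" if "j \<in> set ps" "l \<in> set ps" "j < l" for j l
      using mono[OF that] .
    show "height i w (Suc j) < height i w q" if "j \<in> set ps" "w ! j = i" "q \<le> j" for j q
    proof (rule ub[OF _ that(3)])
      show "j \<in> set bs" using that(1,2) la[of j] by (auto simp: set_ps)
    qed
    show "height i w j < height i w q" if "j \<in> set ps" "w ! j = Suc i" "q \<le> length w" "j < q" for j q
    proof (rule ua[OF _ that(3,4)])
      show "j \<in> set as" using that(1,2) lb[of j] by (auto simp: set_ps)
    qed
    show "\<exists>q\<le>j. height i w q \<le> height i w (Suc j)" if "j < length w" "w ! j = i" "j \<notin> set ps" for j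
      using cb[OF that(1,2)] that(3) unfolding set_ps by blast
    show "\<exists>q\<le>length w. j < q \<and> height i w q \<le> height i w j"
      if "j < length w" "w ! j = Suc i" "j \<notin> set ps" for j
      using ca[OF that(1,2)] that(3) unfolding set_ps by blast
    show "count_list (sigma i w) y =
      count_list w (if y = i then Suc i else if y = Suc i then i else y)" for y by (rule cnt)
  qed
qed

lemma unconcat: "length w = length (concat xss) \<Longrightarrow> \<exists>yss. concat yss = w \<and> map length yss = map length xss"
proof (induction xss arbitrary: w)
  case Nil
  then show ?case by (intro exI[of _ "[]"]) simp
next
  case (Cons xs xss)
  have "length (drop (length xs) w) = length (concat xss)" using Cons.prems by simp
  from Cons.IH[OF this]
  obtain yss where "concat yss = drop (length xs) w" "map length yss = map length xss" by blast
  then show ?case using Cons.prems by (intro exI[of _ "take (length xs) w # yss"]) simp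
qed

text \<open>The reading word starts with the top row, whence row \<open>r\<close> starts after all higher rows.\<close>

definition row_start :: "ptn \<Rightarrow> nat \<Rightarrow> nat" where
  "row_start p r = sum_list (drop (Suc r) p)"

lemma row_start_Suc: "Suc r < length p \<Longrightarrow> row_start p r = row_start p (Suc r) + p ! Suc r"
  by (simp add: row_start_def flip: Cons_nth_drop_Suc)

lemma reading_word_split:
  assumes "r < length R"
  shows "reading_word R = concat (rev (drop (Suc r) R)) @ R ! r @ concat (rev (take r R))"
    "length (concat (rev (drop (Suc r) R))) = row_start (map length R) r"
proof -
  have "rev R = rev (drop (Suc r) R) @ [R ! r] @ rev (take r R)"
    using id_take_nth_drop[OF assms] by (metis append.assoc append_Cons append_Nil rev.simps(2) rev_append)
  then show "reading_word R = concat (rev (drop (Suc r) R)) @ R ! r @ concat (rev (take r R))"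
    by (simp add: reading_word_def)
  show "length (concat (rev (drop (Suc r) R))) = row_start (map length R) r"
    by (simp add: row_start_def length_concat drop_map rev_map[symmetric] sum_list_rev)
qed

lemma reading_word_nth:
  assumes "r < length R" "j < length (R ! r)"
  shows "reading_word R ! (row_start (map length R) r + j) = R ! r ! j"
    "row_start (map length R) r + j < length (reading_word R)"
proof -
  note s = reading_word_split[OF assms(1)]
  show "reading_word R ! (row_start (map length R) r + j) = R ! r ! j"
    using assms(2) by (simp add: s(1) nth_append flip: s(2))
  show "row_start (map length R) r + j < length (reading_word R)"
    using assms(2) by (simp add: s(1) flip: s(2))
qed

lemma height_in_row:
  assumes "r < length R" "j \<le> length (R ! r)"
  shows "height i (reading_word R) (row_start (map length R) r + j) =
    excess i (concat (rev (drop (Suc r) R))) + excess i (take j (R ! r))"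
  using assms(2) by (simp add: reading_word_split(1)[OF assms(1)] excess_append
      flip: reading_word_split(2)[OF assms(1)])

lemma height_adjacent_rows:
  assumes r: "Suc r < length R" and a: "a \<le> length (R ! Suc r)" and b: "b \<le> length (R ! r)"
  shows "height i (reading_word R) (row_start (map length R) r + b) -
      height i (reading_word R) (row_start (map length R) (Suc r) + a) =
    excess i (drop a (R ! Suc r)) + excess i (take b (R ! r))"
proof -
  have "drop (Suc r) R = R ! Suc r # drop (Suc (Suc r)) R" using r by (simp add: Cons_nth_drop_Suc)
  then have "excess i (concat (rev (drop (Suc r) R))) =
      excess i (concat (rev (drop (Suc (Suc r)) R))) + excess i (R ! Suc r)"
    by (simp add: excess_append)
  moreover have "excess i (R ! Suc r) = excess i (take a (R ! Suc r)) + excess i (drop a (R ! Suc r))"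
    by (simp flip: excess_append)
  ultimately show ?thesis
    using height_in_row[of r R b i] height_in_row[of "Suc r" R a i] r a b by simp
qed

lemma count_list_drop_ge:
  assumes "b \<le> length xs" "\<And>c. a \<le> c \<Longrightarrow> c < b \<Longrightarrow> xs ! c = x"
  shows "b - a \<le> count_list (drop a xs) x"
proof -
  have "take (b - a) (drop a xs) = replicate (b - a) x"
    using assms by (intro nth_equalityI) auto
  moreover have "count_list (replicate n x) x = n" for n by (induction n) auto
  ultimately have "count_list (take (b - a) (drop a xs)) x = b - a" by simp
  moreover have "count_list (drop a xs) x =
      count_list (take (b - a) (drop a xs)) x + count_list (drop (b - a) (drop a xs)) x"
    by (metis append_take_drop_id count_list_append)
  ultimately show ?thesis by simp
qed

lemma count_list_take_le:
  assumes "a \<le> length xs" "\<And>c. c < a \<Longrightarrow> xs ! c \<noteq> x"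
  shows "count_list (take b xs) x \<le> b - a"
proof -
  have "take b xs = take a (take b xs) @ drop a (take b xs)" by (rule append_take_drop_id[symmetric])
  then have "count_list (take b xs) x = count_list (take a (take b xs)) x + count_list (drop a (take b xs)) x"
    by (metis count_list_append)
  moreover have "x \<notin> set (take a (take b xs))"
    using assms by (auto simp: in_set_conv_nth)
  moreover have "count_list (drop a (take b xs)) x \<le> b - a"
    using count_le_length[of "drop a (take b xs)" x] by simp
  ultimately show ?thesis by (simp add: count_list_0_iff)
qed

lemma count_list_drop_le:
  assumes "\<And>c. b \<le> c \<Longrightarrow> c < length xs \<Longrightarrow> xs ! c \<noteq> x"
  shows "count_list (drop a xs) x \<le> b - a"
proof -
  have "count_list (drop a xs) x =
      count_list (take (b - a) (drop a xs)) x + count_list (drop (b - a) (drop a xs)) x"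
    by (metis append_take_drop_id count_list_append)
  moreover have "x \<notin> set (drop (b - a) (drop a xs))"
  proof
    assume "x \<in> set (drop (b - a) (drop a xs))"
    then obtain c where "c < length xs - (b - a + a)" "xs ! (b - a + a + c) = x"
      by (auto simp: in_set_conv_nth add.commute)
    then show False using assms[of "b - a + a + c"] by simp
  qed
  moreover have "count_list (take (b - a) (drop a xs)) x \<le> b - a"
    using count_le_length[of "take (b - a) (drop a xs)" x] by simp
  ultimately show ?thesis by (simp add: count_list_0_iff)
qed

lemma count_list_take_ge:
  assumes "b \<le> length xs" "\<And>c. a \<le> c \<Longrightarrow> c < b \<Longrightarrow> xs ! c = x"
  shows "b - a \<le> count_list (take b xs) x"
proof -
  have "count_list (take b xs) x = count_list (take a (take b xs)) x + count_list (drop a (take b xs)) x"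
    by (metis append_take_drop_id count_list_append)
  moreover have "b - a \<le> count_list (drop a (take b xs)) x"
    using assms by (intro count_list_drop_ge) auto
  ultimately show ?thesis by simp
qed

text \<open>Rows stay sorted since in each row the unpaired letters lie between the paired letters \<open>i\<close> and the
  paired letters \<open>i+1\<close>.  Columns stay strict since a letter \<open>i\<close> below a letter \<open>i+1\<close> is paired, and so is
  that letter \<open>i+1\<close>.  Indeed, where the lower row has a letter \<open>i\<close> to the left of this column, the upper
  one has a letter \<open>i+1\<close>, and where the upper row has a letter \<open>i+1\<close> to the right of it, the lower one has a
  letter \<open>i\<close>.\<close>

theorem sigma_tableau:
  assumes R: "tableau_filling R" and i: "1 \<le> i"
  obtains R' where "tableau_filling R'" "reading_word R' = sigma i (reading_word R)"
    "map length R' = map length R"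
proof -
  let ?w = "reading_word R" and ?p = "map length R"
  obtain P where len: "length (sigma i ?w) = length ?w"
    and P_len: "\<And>j. j \<in> P \<Longrightarrow> j < length ?w"
    and off: "\<And>j. j \<notin> P \<Longrightarrow> sigma i ?w ! j = ?w ! j"
    and P_old: "\<And>j. j \<in> P \<Longrightarrow> ?w ! j = i \<or> ?w ! j = Suc i"
    and P_new: "\<And>j. j \<in> P \<Longrightarrow> sigma i ?w ! j = i \<or> sigma i ?w ! j = Suc i"
    and P_mono: "\<And>j l. j \<in> P \<Longrightarrow> l \<in> P \<Longrightarrow> j < l \<Longrightarrow> sigma i ?w ! j \<le> sigma i ?w ! l"
    and P_i: "\<And>j q. j \<in> P \<Longrightarrow> ?w ! j = i \<Longrightarrow> q \<le> j \<Longrightarrow> height i ?w (Suc j) < height i ?w q"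
    and P_Suc: "\<And>j q. j \<in> P \<Longrightarrow> ?w ! j = Suc i \<Longrightarrow> q \<le> length ?w \<Longrightarrow> j < q \<Longrightarrow>
      height i ?w j < height i ?w q"
    and nP_i: "\<And>j. j < length ?w \<Longrightarrow> ?w ! j = i \<Longrightarrow> j \<notin> P \<Longrightarrow>
      \<exists>q\<le>j. height i ?w q \<le> height i ?w (Suc j)"
    and nP_Suc: "\<And>j. j < length ?w \<Longrightarrow> ?w ! j = Suc i \<Longrightarrow> j \<notin> P \<Longrightarrow>
      \<exists>q\<le>length ?w. j < q \<and> height i ?w q \<le> height i ?w j"
    by (rule sigma_effect[of i ?w], rule that)
  have ascent: "sigma i ?w ! j \<le> sigma i ?w ! Suc j"
    if j: "Suc j < length ?w" and le: "?w ! j \<le> ?w ! Suc j" for j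
  proof -
    have right: "Suc j \<in> P" if "j \<in> P" "?w ! j = i" "?w ! Suc j = i"
    proof (rule ccontr)
      note prems = that
      assume "Suc j \<notin> P"
      from nP_i[OF j prems(3) this]
      obtain q where q: "q \<le> Suc j" "height i ?w q \<le> height i ?w (Suc (Suc j))" by blast
      have "height i ?w (Suc (Suc j)) = height i ?w (Suc j) - 1"
        using height_Suc[OF j, of i] that by simp
      then show False using q P_i[OF that(1,2), of q] by (cases "q = Suc j") auto
    qed
    have left: "j \<in> P" if "Suc j \<in> P" "?w ! j = Suc i" "?w ! Suc j = Suc i"
    proof (rule ccontr)
      note prems = that
      assume "j \<notin> P"
      from nP_Suc[OF Suc_lessD[OF j] prems(2) this]
      obtain q where q: "q \<le> length ?w" "j < q" "height i ?w q \<le> height i ?w j" by blast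
      have "height i ?w (Suc j) = height i ?w j + 1"
        using height_Suc[of j ?w i] j that by simp
      then show False using q P_Suc[OF that(1,3), of q] by (cases "q = Suc j") auto
    qed
    consider "j \<in> P" "Suc j \<in> P" | "j \<in> P" "Suc j \<notin> P" | "j \<notin> P" "Suc j \<in> P" | "j \<notin> P" "Suc j \<notin> P"
      by blast
    then show ?thesis
    proof cases
      case 1
      then show ?thesis by (intro P_mono) auto
    next
      case 2
      then have "?w ! Suc j \<noteq> i \<or> ?w ! j \<noteq> i" using right by blast
      then have "Suc i \<le> ?w ! Suc j" using P_old[OF 2(1)] le by auto
      then show ?thesis using P_new[OF 2(1)] off[OF 2(2)] by auto
    next
      case 3
      then have "?w ! Suc j \<noteq> Suc i \<or> ?w ! j \<noteq> Suc i" using left by blast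
      then have "?w ! j \<le> i" using P_old[OF 3(2)] le by auto
      then show ?thesis using P_new[OF 3(2)] off[OF 3(1)] by auto
    next
      case 4
      then show ?thesis using le off by simp
    qed
  qed
  obtain R0 where R0: "concat R0 = sigma i ?w" "map length R0 = map length (rev R)"
    using unconcat[of "sigma i ?w" "rev R"] len by (auto simp: reading_word_def)
  define R' where "R' = rev R0"
  have rw: "reading_word R' = sigma i ?w" by (simp add: reading_word_def R'_def R0)
  have shape: "map length R' = ?p" by (simp add: R'_def R0(2) flip: rev_map)
  have lenR: "length R' = length R" using arg_cong[OF shape, of length] by simp
  have row_len: "length (R' ! r) = length (R ! r)" if "r < length R" for r
    using arg_cong[OF shape, of "\<lambda>l. l ! r"] that lenR by simp
  let ?s = "row_start ?p"
  have new: "R' ! r ! j = sigma i ?w ! (?s r + j)" if "r < length R" "j < length (R ! r)" for r j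
    using reading_word_nth(1)[of r R' j] that lenR row_len[of r] rw shape by simp
  have old: "R ! r ! j = ?w ! (?s r + j)" "?s r + j < length ?w"
    if "r < length R" "j < length (R ! r)" for r j
    using reading_word_nth[OF that] by simp_all
  have "tableau_filling R'"
    unfolding tableau_filling_def shape
  proof (intro conjI ballI allI impI)
    show "is_partition ?p" using R by (simp add: tableau_filling_def)
  next
    fix u assume "u \<in> set R'"
    then obtain r where r: "r < length R" "u = R' ! r" using lenR by (metis in_set_conv_nth)
    show "sorted u"
      unfolding sorted_iff_nth_Suc
    proof (intro allI impI)
      fix j assume j: "Suc j < length u"
      then have j': "Suc j < length (R ! r)" using r row_len by simp
      have "R ! r ! j \<le> R ! r ! Suc j"
        using filling_row(2)[OF R r(1)] j' by (simp add: sorted_nth_mono)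
      then show "u ! j \<le> u ! Suc j"
        using ascent[of "?s r + j"] old[OF r(1), of j] old[OF r(1), of "Suc j"] j'
          new[OF r(1), of j] new[OF r(1), of "Suc j"] r(2) by simp
    qed
    show "0 \<notin> set u"
    proof
      assume "0 \<in> set u"
      then obtain j where j: "j < length (R ! r)" "u ! j = 0" using r row_len by (metis in_set_conv_nth)
      have "R ! r ! j \<noteq> 0" using filling_row(3)[OF R r(1)] j(1) by (metis nth_mem)
      then show False
        using j new[OF r(1) j(1)] old[OF r(1) j(1)] off[of "?s r + j"] P_new[of "?s r + j"] i r(2)
        by (cases "?s r + j \<in> P") auto
    qed
  next
    fix r j assume r: "Suc r < length R'" and j: "j < length (R' ! Suc r)"
    then have r': "Suc r < length R" "r < length R" and j': "j < length (R ! Suc r)" "j < length (R ! r)"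
      using lenR row_len filling_lengths[OF R, of r "Suc r"] by auto
    let ?U = "R ! Suc r" and ?L = "R ! r"
    let ?a = "?s r + j" and ?b = "?s (Suc r) + j"
    have col: "?L ! c < ?U ! c" if "c < length ?U" for c using filling_column[OF R r'(1) that] .
    have sU: "sorted ?U" and sL: "sorted ?L" using filling_row(2)[OF R] r' by auto
    have UL: "length ?U \<le> length ?L" using filling_lengths[OF R, of r "Suc r"] r' by simp
    have paired: "?a \<notin> P \<and> ?b \<notin> P" if ab: "?L ! j = i" "?U ! j = Suc i"
    proof
      show "?a \<notin> P"
      proof
        assume a: "?a \<in> P"
        (* from column c of the upper row to column j of the lower one, the brackets do not lose height *)
        define c where "c = (LEAST c. ?L ! c = i)"
        have c: "?L ! c = i" "c \<le> j" unfolding c_def using ab(1) by (rule LeastI) (rule Least_le, rule ab(1))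
        have below: "?L ! d \<noteq> i" if "d < c" for d using that not_less_Least unfolding c_def by blast
        have between: "?L ! d = i" if "c \<le> d" "d \<le> j" for d
        proof -
          have "?L ! c \<le> ?L ! d" "?L ! d \<le> ?L ! j"
            using sorted_nth_mono[OF sL, of c d] sorted_nth_mono[OF sL, of d j] that j' by auto
          then show ?thesis using c(1) ab(1) by simp
        qed
        have Ubetween: "?U ! d = Suc i" if "c \<le> d" "d < Suc j" for d
        proof -
          have "?U ! d \<le> ?U ! j" using sorted_nth_mono[OF sU, of d j] that j' by auto
          moreover have "?L ! d < ?U ! d" using col[of d] that j' by simp
          ultimately show ?thesis using between[of d] that ab(2) by simp
        qed
        have "Suc j - c \<le> count_list (drop c ?U) (Suc i)"
          using j' Ubetween by (intro count_list_drop_ge) auto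
        moreover have "count_list (drop c ?U) i = 0"
        proof -
          have "?U ! d \<noteq> i" if "c \<le> d" "d < length ?U" for d
            using col[OF that(2)] sorted_nth_mono[OF sL that(1)] that(2) UL c(1) by simp
          then have "count_list (drop c ?U) i \<le> c - c" by (intro count_list_drop_le) auto
          then show ?thesis by simp
        qed
        moreover have "count_list (take (Suc j) ?L) i \<le> Suc j - c"
          using below c(2) j' by (intro count_list_take_le) auto
        ultimately have "0 \<le> excess i (drop c ?U) + excess i (take (Suc j) ?L)"
          by (simp add: excess_def)
        then have "height i ?w (?s (Suc r) + c) \<le> height i ?w (Suc ?a)"
          using height_adjacent_rows[OF r'(1), of c "Suc j" i] c(2) j' by simp
        moreover have "?s (Suc r) + c \<le> ?a"
          using row_start_Suc[of r ?p] r' c(2) j' by simp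
        ultimately show False
          using P_i[OF a, of "?s (Suc r) + c"] old(1)[OF r'(2) j'(2)] ab(1) by simp
      qed
      show "?b \<notin> P"
      proof
        assume b: "?b \<in> P"
        (* from column j of the upper row up to column c of the lower one, they do not gain height *)
        define c where "c = (LEAST c. j < c \<and> (length ?U \<le> c \<or> Suc i < ?U ! c))"
        have ex: "j < length ?U \<and> (length ?U \<le> length ?U \<or> Suc i < ?U ! length ?U)" using j' by simp
        have c: "j < c" "length ?U \<le> c \<or> Suc i < ?U ! c"
          using LeastI[of "\<lambda>c. j < c \<and> (length ?U \<le> c \<or> Suc i < ?U ! c)", OF ex] unfolding c_def by blast+
        have c_le: "c \<le> length ?U" unfolding c_def 
          by (rule Least_le[of "\<lambda>c. j < c \<and> (length ?U \<le> c \<or> Suc i < ?U ! c)", OF ex])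
        have Uless: "?U ! d \<le> Suc i" if "d < c" for d
        proof (cases "j < d")
          case True
          then show ?thesis using not_less_Least[of d "\<lambda>c. j < c \<and> (length ?U \<le> c \<or> Suc i < ?U ! c)"] that
            unfolding c_def by auto
        next
          case False
          then show ?thesis using sorted_nth_mono[OF sU, of d j] j' ab(2) by simp
        qed
        have "count_list (drop j ?U) (Suc i) \<le> c - j"
        proof (rule count_list_drop_le)
          fix d assume "c \<le> d" "d < length ?U"
          then show "?U ! d \<noteq> Suc i" using c(2) sorted_nth_mono[OF sU, of c d] by auto
        qed
        moreover have "c - j \<le> count_list (take c ?L) i"
        proof (rule count_list_take_ge)
          show "c \<le> length ?L" using c_le UL by simp
          fix d assume d: "j \<le> d" "d < c"
          then have "?L ! d < ?U ! d" using col[of d] c_le by simp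
          moreover have "i \<le> ?L ! d" using sorted_nth_mono[OF sL d(1)] d c_le UL ab(1) by simp
          ultimately show "?L ! d = i" using Uless[OF d(2)] by simp
        qed
        moreover have "count_list (take c ?L) (Suc i) = 0"
        proof -
          have "?L ! d \<noteq> Suc i" if "d < c" for d
            using col[of d] Uless[OF that] that c_le by simp
          then have "count_list (take c ?L) (Suc i) \<le> c - c"
            using c_le UL by (intro count_list_take_le) auto
          then show ?thesis by simp
        qed
        ultimately have "excess i (drop j ?U) + excess i (take c ?L) \<le> 0"
          by (simp add: excess_def)
        then have "height i ?w (?s r + c) \<le> height i ?w ?b"
          using height_adjacent_rows[OF r'(1), of j c i] c_le UL j' by simp
        moreover have "?b < ?s r + c"
          using row_start_Suc[of r ?p] r' j' c(1) by simp
        moreover have "?s r + c \<le> length ?w"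
          using old(2)[OF r'(2), of "c - 1"] c(1) c_le UL by (cases c) auto
        ultimately show False
          using P_Suc[OF b, of "?s r + c"] old(1)[OF r'(1) j'(1)] ab(2) by simp
      qed
    qed
    have lt: "?L ! j < ?U ! j" using col[OF j'(1)] .
    have "sigma i ?w ! ?a < sigma i ?w ! ?b"
    proof (cases "?L ! j = i \<and> ?U ! j = Suc i")
      case True
      then show ?thesis using paired off[of ?a] off[of ?b] old(1)[OF r'(2) j'(2)] old(1)[OF r'(1) j'(1)] lt by simp
    next
      case False
      then show ?thesis
        using lt old(1)[OF r'(2) j'(2)] old(1)[OF r'(1) j'(1)] off[of ?a] off[of ?b]
          P_old[of ?a] P_old[of ?b] P_new[of ?a] P_new[of ?b]
        by (cases "?a \<in> P"; cases "?b \<in> P") auto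
    qed
    then show "R' ! r ! j < R' ! Suc r ! j" using new[OF r'(2) j'(2)] new[OF r'(1) j'(1)] by simp
  qed
  then show ?thesis using that rw shape by blast
qed

lemma count_sigma:
  "count_list (sigma i w) y = count_list w (if y = i then Suc i else if y = Suc i then i else y)"
proof (rule sigma_effect[of i w])
  assume "\<And>y. count_list (sigma i w) y =
    count_list w (if y = i then Suc i else if y = Suc i then i else y)"
  then show ?thesis .
qed

lemma sigma_is_tableau:
  assumes "is_tableau T" "1 \<le> i"
  shows "is_tableau (sigma i T)" "shape (sigma i T) = shape T"
proof -
  obtain R where R: "tableau_filling R" "T = reading_word R" "shape T = map length R"
    using assms(1) by (rule is_tableauE)
  obtain R' where R': "tableau_filling R'" "reading_word R' = sigma i T" "map length R' = map length R"
    using sigma_tableau[OF R(1) assms(2)] R(2) by metis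
  show "is_tableau (sigma i T)" using is_tableau_reading_word[OF R'(1)] R'(2) by simp
  show "shape (sigma i T) = shape T" using shape_reading_word[OF R'(1)] R'(2,3) R(3) by simp
qed

lemma sigmas_is_tableau:
  assumes "is_tableau T" "0 \<notin> set is"
  shows "is_tableau (sigmas is T) \<and> shape (sigmas is T) = shape T"
  using assms(2)
proof (induction "is")
  case (Cons i "is")
  then have "is_tableau (sigmas is T)" "shape (sigmas is T) = shape T" "1 \<le> i" by auto
  then show ?case using sigma_is_tableau[of "sigmas is T" i] by (simp add: sigmas_def)
qed (use assms(1) in \<open>simp add: sigmas_def\<close>)

lemma count_sigmas_upt:
  "count_list (sigmas [1..<Suc m] w) y =
     count_list w (if y = 1 then Suc m else if 1 < y \<and> y \<le> Suc m then y - 1 else y)"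
proof (induction m arbitrary: w y)
  case (Suc m)
  have split: "sigmas [1..<Suc (Suc m)] w = sigmas [1..<Suc m] (sigma (Suc m) w)"
    by (simp add: sigmas_def)
  show ?case unfolding split Suc.IH count_sigma by (cases "y = Suc (Suc m)") auto
qed (auto simp: sigmas_def)

section \<open>Superstandard tableaux and katabolism\<close>

text \<open>The superstandard filling.  The offset \<open>m\<close> is needed since katabolism removes the bottom rows
  and leaves the letters of the others as they are.\<close>

definition standard_filling :: "nat \<Rightarrow> ptn \<Rightarrow> filling" where
  "standard_filling m p = map (\<lambda>i. replicate (p ! i) (Suc (m + i))) [0..<length p]"

lemma standard_filling_filling:
  assumes "is_partition p"
  shows "tableau_filling (standard_filling m p)" "map length (standard_filling m p) = p"
proof -
  show shape: "map length (standard_filling m p) = p"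
    by (intro nth_equalityI) (simp_all add: standard_filling_def)
  have anti: "p ! Suc i \<le> p ! i" if "Suc i < length p" for i
    using assms that by (auto simp: is_partition_def sorted_wrt_iff_nth_less)
  show "tableau_filling (standard_filling m p)"
    unfolding tableau_filling_def shape
  proof (intro conjI assms ballI allI impI)
    fix r assume "r \<in> set (standard_filling m p)"
    then obtain i where "r = replicate (p ! i) (Suc (m + i))" by (auto simp: standard_filling_def)
    then show "sorted r" "0 \<notin> set r" by auto
  next
    fix i j assume i: "Suc i < length (standard_filling m p)" and j: "j < length (standard_filling m p ! Suc i)"
    then have "Suc i < length p" "j < p ! Suc i" by (simp_all add: standard_filling_def)
    then show "standard_filling m p ! i ! j < standard_filling m p ! Suc i ! j"
      using anti[of i] by (simp add: standard_filling_def)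
  qed
qed

lemma count_standard_filling:
  "count_list (reading_word (standard_filling m p)) y = (if m < y then part p (y - Suc m) else 0)"
proof -
  have rep: "count_list (replicate n c) y = (if y = c then n else 0)" for n c :: nat
    by (induction n) auto
  have "count_list (reading_word (standard_filling m p)) y =
      (\<Sum>i<length p. if y = Suc (m + i) then p ! i else 0)"
    by (simp add: count_reading_word standard_filling_def sum_list_sum_nth atLeast0LessThan rep)
  also have "\<dots> = (\<Sum>i<length p. if i = y - Suc m then (if m < y then p ! i else 0) else 0)"
    by (intro sum.cong) auto
  also have "\<dots> = (if m < y then part p (y - Suc m) else 0)"
    by (simp add: part_def)
  finally show ?thesis .
qed

text \<open>Columns increase strictly.\<close>

lemma filling_row_lower_bound:
  assumes R: "tableau_filling R" and m: "\<And>y. y \<in> set (reading_word R) \<Longrightarrow> m < y"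
    and "i < length R" "j < length (R ! i)"
  shows "Suc (m + i) \<le> R ! i ! j"
  using assms(3,4)
proof (induction i)
  case 0
  then have "R ! 0 ! j \<in> set (reading_word R)" by (auto simp: set_reading_word intro!: bexI[of _ "R ! 0"])
  then show ?case using m by fastforce
next
  case (Suc i)
  then have "j < length (R ! i)" using filling_lengths[OF R, of i "Suc i"] by simp
  then have "Suc (m + i) \<le> R ! i ! j" using Suc by simp
  also have "\<dots> < R ! Suc i ! j" using Suc.prems filling_column[OF R] by simp
  finally show ?case by simp
qed

lemma row_letters_lower_bound:
  assumes R: "tableau_filling R" and m: "\<And>y. y \<in> set (reading_word R) \<Longrightarrow> m < y"
    and "i < length R" "y \<in> set (R ! i)"
  shows "Suc (m + i) \<le> y"
  using assms(4) filling_row_lower_bound[OF R m assms(3)] by (auto simp: in_set_conv_nth)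

text \<open>The letters \<open>m + i + 1\<close> can only lie in the rows up to the \<open>i\<close>-th; counting them from the
  bottom row on, each row must be filled by its own letter.\<close>

lemma filling_standard:
  assumes R: "tableau_filling R" and p: "map length R = p"
    and cnt: "\<And>i. count_list (reading_word R) (Suc (m + i)) = part p i"
    and m: "\<And>y. y \<in> set (reading_word R) \<Longrightarrow> m < y"
  shows "R = standard_filling m p"
proof (rule nth_equalityI)
  show len: "length R = length (standard_filling m p)" using p by (auto simp: standard_filling_def)
  have rows: "R ! i = replicate (p ! i) (Suc (m + i))" if "i < length R" for i
    using that
  proof (induction i rule: less_induct)
    case (less i)
    have li: "length (R ! i) = p ! i" using p less.prems by auto
    have "count_list (reading_word R) (Suc (m + i)) = (\<Sum>r<length R. count_list (R ! r) (Suc (m + i)))"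
      by (simp add: count_reading_word sum_list_sum_nth atLeast0LessThan)
    also have "\<dots> = (\<Sum>r<length R. if r = i then count_list (R ! i) (Suc (m + i)) else 0)"
    proof (intro sum.cong refl)
      fix r assume r: "r \<in> {..<length R}"
      consider "r < i" | "r = i" | "i < r" by linarith
      then show "count_list (R ! r) (Suc (m + i)) = (if r = i then count_list (R ! i) (Suc (m + i)) else 0)"
      proof cases
        case 1
        then have "R ! r = replicate (p ! r) (Suc (m + r))" using less r by simp
        then show ?thesis using 1 by (simp add: count_list_0_iff)
      next
        case 3
        have "Suc (m + i) \<notin> set (R ! r)"
          using row_letters_lower_bound[OF R m, of r "Suc (m + i)"] 3 r by auto
        then show ?thesis using 3 by (simp add: count_list_0_iff)
      qed simp
    qed
    also have "\<dots> = count_list (R ! i) (Suc (m + i))" using less.prems by simp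
    finally have "count_list (R ! i) (Suc (m + i)) = length (R ! i)"
      using cnt[of i] less.prems li len by (simp add: part_def standard_filling_def)
    moreover have "xs = replicate (length xs) y" if "count_list xs y = length xs" for xs and y :: nat
      using that
    proof (induction xs)
      case (Cons x xs)
      then show ?case using count_le_length[of xs y] by (auto split: if_splits)
    qed simp
    ultimately show ?case using li by metis
  qed
  show "R ! i = standard_filling m p ! i" if "i < length R" for i
    using rows[OF that] that len by (simp add: standard_filling_def)
qed


text \<open>In a lattice word, the suffixes have at least as many letters \<open>y\<close> as letters \<open>y + 1\<close>.  Knuth
  equivalence preserves this, and the only tableau of a given evaluation with this property is the
  superstandard one, so that a superstandard tableau is alone in its Knuth class.\<close>

fun lattice_word :: "nat \<Rightarrow> word \<Rightarrow> bool" where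
  "lattice_word y [] = True"
| "lattice_word y (x # w) \<longleftrightarrow>
     lattice_word y w \<and> count_list (x # w) (Suc y) \<le> count_list (x # w) y"

lemma lattice_word_suffix:
  "lattice_word y (u @ v) \<Longrightarrow> lattice_word y v \<and> count_list v (Suc y) \<le> count_list v y"
proof (induction u)
  case Nil
  then show ?case by (cases v) auto
qed simp

lemma lattice_wordI:
  "(\<And>u v. w = u @ v \<Longrightarrow> count_list v (Suc y) \<le> count_list v y) \<Longrightarrow> lattice_word y w"
proof (induction w)
  case (Cons x w)
  have "lattice_word y w"
  proof (rule Cons.IH)
    fix u v assume "w = u @ v"
    then show "count_list v (Suc y) \<le> count_list v y" using Cons.prems[of "x # u" v] by simp
  qed
  moreover have "count_list (x # w) (Suc y) \<le> count_list (x # w) y"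
    using Cons.prems[of "[]" "x # w"] by simp
  ultimately show ?case by simp
qed simp

lemma lattice_word_append:
  "(\<And>y. count_list w y = count_list w' y) \<Longrightarrow> lattice_word y w = lattice_word y w' \<Longrightarrow>
   lattice_word y (u @ w) = lattice_word y (u @ w')"
  by (induction u) simp_all

lemma knuth_step_count: "knuth_step w w' \<Longrightarrow> count_list w y = count_list w' y"
  by (induction rule: knuth_step.induct) auto

text \<open>A Knuth step moves two adjacent letters past each other.  This concerns the pair \<open>y, y + 1\<close> only if
  they are these letters.  Then the third letter is a \<open>y\<close> to the right of both or a \<open>y + 1\<close> to the left of
  both, and either makes the order of the two immaterial.\<close>

lemma knuth_step_lattice: "knuth_step w w' \<Longrightarrow> lattice_word y w = lattice_word y w'"
proof (induction rule: knuth_step.induct)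
  case (1 a b c u v)
  show ?case
  proof (rule lattice_word_append)
    show "lattice_word y ([a, c, b] @ v) = lattice_word y ([c, a, b] @ v)"
      using 1 lattice_word_suffix[of y "[]" v]
      by (cases "lattice_word y v"; cases "a = y"; cases "c = Suc y") auto
  qed auto
next
  case (2 a b c u v)
  show ?case
  proof (rule lattice_word_append)
    show "lattice_word y ([b, a, c] @ v) = lattice_word y ([b, c, a] @ v)"
      using 2 lattice_word_suffix[of y "[]" v]
      by (cases "lattice_word y v"; cases "a = y"; cases "c = Suc y") auto
  qed auto
qed

lemma knuth_equiv_invariant:
  assumes "knuth_equiv w w'"
  shows "lattice_word y w = lattice_word y w'" "count_list w y = count_list w' y"
proof -
  have "lattice_word y w = lattice_word y w' \<and> count_list w y = count_list w' y"
    using assms unfolding knuth_equiv_def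
  proof (induction rule: equivclp_induct)
    case (step u v)
    then have "lattice_word y u = lattice_word y v \<and> count_list u y = count_list v y"
      using knuth_step_lattice[of u v y] knuth_step_lattice[of v u y]
        knuth_step_count[of u v y] knuth_step_count[of v u y] by (cases "knuth_step u v") simp_all
    then show ?case using step.IH by simp
  qed simp
  then show "lattice_word y w = lattice_word y w'" "count_list w y = count_list w' y" by blast+
qed

text \<open>A suffix containing a letter \<open>y + 1\<close> contains all of the next lower row, the row of the letters \<open>y\<close>.\<close>

lemma lattice_standard:
  assumes p: "is_partition p" and y: "m < y"
  shows "lattice_word y (reading_word (standard_filling m p))"
proof (rule lattice_wordI)
  fix u v
  assume uv: "reading_word (standard_filling m p) = u @ v"
  let ?R = "standard_filling m p" and ?w = "reading_word (standard_filling m p)"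
  note R = standard_filling_filling[OF p, of m]
  show "count_list v (Suc y) \<le> count_list v y"
  proof (cases "count_list v (Suc y) = 0")
    case False
    let ?i = "y - Suc m"
    have "Suc y \<in> set v" using False by (simp add: count_list_0_iff)
    then have "Suc y \<in> set ?w" using uv by simp
    then have len: "Suc ?i < length p" using y by (auto simp: set_reading_word standard_filling_def)
    have yi: "y = Suc (m + ?i)" using y by simp
    (* w is split into A and B in front of the row of the letters y *)
    define A where "A = concat (rev (drop (Suc (Suc ?i)) ?R)) @ ?R ! Suc ?i"
    define B where "B = ?R ! ?i @ concat (rev (take ?i ?R))"
    have lR: "length ?R = length p" by (simp add: standard_filling_def)
    have "drop (Suc ?i) ?R = ?R ! Suc ?i # drop (Suc (Suc ?i)) ?R"
      using len lR by (simp add: Cons_nth_drop_Suc)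
    then have w: "?w = A @ B"
      using reading_word_split(1)[of ?i ?R] len lR by (simp add: A_def B_def)
    have "Suc y \<notin> set B"
    proof
      assume "Suc y \<in> set B"
      then consider "Suc y \<in> set (?R ! ?i)" | "Suc y \<in> set (concat (rev (take ?i ?R)))"
        unfolding B_def by auto
      then obtain r where "r \<le> ?i" "Suc y \<in> set (?R ! r)"
      proof cases
        case 1
        then show ?thesis using that[of ?i] by simp
      next
        case 2
        then obtain x where "x \<in> set (take ?i ?R)" "Suc y \<in> set x" by auto
        then obtain r where "r < ?i" "x = ?R ! r" by (auto simp: in_set_conv_nth)
        then show ?thesis using that[of r] \<open>Suc y \<in> set x\<close> by simp
      qed
      then show False using yi len by (simp add: standard_filling_def)
    qed
    moreover have "A @ B = u @ v" using w uv by simp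
    ultimately obtain us where us: "v = us @ B"
      unfolding append_eq_append_conv2 using \<open>Suc y \<in> set v\<close> by auto
    have cB: "count_list B y \<ge> p ! ?i"
    proof -
      have "count_list (replicate n c) c = n" for n c :: nat by (induction n) auto
      then have "count_list (?R ! ?i) y = p ! ?i" using len yi by (simp add: standard_filling_def)
      then show ?thesis by (simp add: B_def)
    qed
    have "count_list v (Suc y) \<le> count_list ?w (Suc y)" using uv by simp
    also have "\<dots> = p ! Suc ?i"
      using len y by (simp add: count_standard_filling part_def Suc_diff_Suc)
    also have "\<dots> \<le> p ! ?i"
      using p len by (auto simp: is_partition_def sorted_wrt_iff_nth_less)
    also have "\<dots> \<le> count_list v y" using cB us by simp
    finally show ?thesis .
  qed simp
qed

text \<open>The last letter of the \<open>i\<close>-th row of a lattice tableau cannot exceed \<open>m + i + 1\<close>, since the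
  rows below do not contain the preceding letter.\<close>

lemma lattice_tableau_rows:
  assumes R: "tableau_filling R" and m: "\<And>y. y \<in> set (reading_word R) \<Longrightarrow> m < y"
    and L: "\<And>y. m < y \<Longrightarrow> lattice_word y (reading_word R)"
    and i: "i < length R"
  shows "R ! i = replicate (length (R ! i)) (Suc (m + i))"
  using i
proof (induction i rule: less_induct)
  case (less i)
  have ne: "R ! i \<noteq> []" and srt: "sorted (R ! i)" using filling_row[OF R less.prems] by auto
  have low: "Suc (m + i) \<le> x" if "x \<in> set (R ! i)" for x
    using row_letters_lower_bound[OF R m less.prems that] .
  have "last (R ! i) \<le> Suc (m + i)"
  proof (rule ccontr)
    assume big: "\<not> ?thesis"
    obtain y where y: "last (R ! i) = Suc y" using big by (cases "last (R ! i)") auto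
    let ?B = "concat (rev (take i R))"
    have split: "reading_word R = (concat (rev (drop (Suc i) R)) @ butlast (R ! i)) @ [Suc y] @ ?B"
      using reading_word_split(1)[OF less.prems] append_butlast_last_id[OF ne] y by (metis append.assoc)
    have "y \<notin> set ?B"
    proof
      assume "y \<in> set ?B"
      then obtain r where r: "r < i" "y \<in> set (R ! r)"
        using less.prems by (auto simp: in_set_conv_nth[of _ "take i R"])
      then have "y = Suc (m + r)" using less.IH[of r] less.prems by (metis in_set_replicate less_trans)
      then show False using r(1) big y by simp
    qed
    moreover have "m < y" using big y by simp
    then have "count_list ([Suc y] @ ?B) (Suc y) \<le> count_list ([Suc y] @ ?B) y"
      using lattice_word_suffix L split by metis
    ultimately show False by (simp add: count_list_0_iff)
  qed
  then have "x = Suc (m + i)" if x: "x \<in> set (R ! i)" for x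
  proof -
    obtain j where j: "j < length (R ! i)" "x = R ! i ! j" using x by (metis in_set_conv_nth)
    have "x \<le> last (R ! i)"
      using sorted_nth_mono[OF srt, of j "length (R ! i) - 1"] j ne by (simp add: last_conv_nth)
    then show ?thesis using low[OF that] \<open>last (R ! i) \<le> _\<close> by simp
  qed
  then show ?case by (intro replicate_eqI) auto
qed

lemma P_tableau_standard:
  assumes p: "is_partition p"
  shows "P_tableau (reading_word (standard_filling m p)) = reading_word (standard_filling m p)"
  unfolding P_tableau_def
proof (rule the_equality)
  let ?w = "reading_word (standard_filling m p)"
  show "is_tableau ?w \<and> knuth_equiv ?w ?w"
    using is_tableau_reading_word[OF standard_filling_filling(1)[OF p]] by (simp add: knuth_equiv_def)
  fix T assume T: "is_tableau T \<and> knuth_equiv T ?w"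
  then obtain R where R: "tableau_filling R" "T = reading_word R" using is_tableauE by metis
  have cnt: "count_list T y = count_list ?w y" for y
    using knuth_equiv_invariant(2) T by blast
  have L: "lattice_word y (reading_word R)" if "m < y" for y
    using knuth_equiv_invariant(1) T R(2) lattice_standard[OF p that] by metis
  have m: "m < y" if "y \<in> set (reading_word R)" for y
  proof (rule ccontr)
    assume "\<not> m < y"
    then have "count_list T y = 0" by (simp add: cnt count_standard_filling)
    then show False using that R(2) by (simp add: count_list_0_iff)
  qed
  note rows = lattice_tableau_rows[OF R(1) m L]
  have "R = standard_filling m (map length R)"
    using rows by (intro nth_equalityI) (simp_all add: standard_filling_def)
  moreover have "map length R = p"
  proof (rule part_eqI)
    show "is_partition (map length R)" using R(1) by (simp add: tableau_filling_def)
    show "part (map length R) i = part p i" for i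
      using cnt[of "Suc (m + i)"] count_standard_filling[of m "map length R" "Suc (m + i)"]
        count_standard_filling[of m p "Suc (m + i)"] R(2) calculation by simp
  qed (rule p)
  ultimately show "T = ?w" using R(2) by simp
qed

lemma evaluation_standard:
  assumes p: "is_partition p" "p \<noteq> []"
  shows "evaluation (reading_word (standard_filling m p)) = replicate m 0 @ p"
proof -
  let ?w = "reading_word (standard_filling m p)"
  have set: "set ?w = {m<..m + length p}"
  proof -
    have "y \<in> set ?w \<longleftrightarrow> m < y \<and> y \<le> m + length p" for y
    proof -
      have "y \<in> set ?w \<longleftrightarrow> count_list ?w y \<noteq> 0" by (simp add: count_list_0_iff)
      also have "\<dots> \<longleftrightarrow> m < y \<and> part p (y - Suc m) \<noteq> 0" by (simp add: count_standard_filling)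
      also have "\<dots> \<longleftrightarrow> m < y \<and> y - Suc m < length p"
        using part_pos[OF p(1), of "y - Suc m"] by (cases "y - Suc m < length p") (auto simp: part_def)
      also have "\<dots> \<longleftrightarrow> m < y \<and> y \<le> m + length p" by auto
      finally show ?thesis .
    qed
    then show ?thesis unfolding set_eq_iff greaterThanAtMost_iff by blast
  qed
  have "max_letter ?w = m + length p"
    unfolding max_letter_def set using p(2) by (intro Max_eqI) (auto simp: Suc_le_eq)
  then have "evaluation ?w = map (count_list ?w) [1..<Suc (m + length p)]" by (simp add: evaluation_def)
  also have "\<dots> = replicate m 0 @ p"
  proof (rule nth_equalityI)
    fix i assume "i < length (map (count_list ?w) [1..<Suc (m + length p)])"
    then have i: "i < m + length p" by (simp del: upt_Suc)
    then have "map (count_list ?w) [1..<Suc (m + length p)] ! i = count_list ?w (Suc i)"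
      by (simp add: nth_map del: upt_Suc)
    then show "map (count_list ?w) [1..<Suc (m + length p)] ! i = (replicate m 0 @ p) ! i"
      using i by (auto simp: count_standard_filling nth_append part_def)
  qed (simp del: upt_Suc)
  finally show ?thesis .
qed

lemma is_partition_append: "is_partition (p @ q) \<Longrightarrow> is_partition p \<and> is_partition q"
  by (auto simp: is_partition_def sorted_wrt_append)

text \<open>The first rows of a superstandard tableau are superstandard, nothing is to the right of them, and the
  rest needs no straightening.\<close>

lemma katabolism_standard:
  assumes pq: "is_partition (p @ q)" and ne: "p \<noteq> []"
  shows "katabolism p (reading_word (standard_filling m (p @ q))) =
    Some (reading_word (standard_filling (m + length p) q))"
proof -
  let ?R = "standard_filling m (p @ q)"
  let ?T = "reading_word ?R"
  have p: "is_partition p" and q: "is_partition q" using is_partition_append[OF pq] by auto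
  note R = standard_filling_filling[OF pq, of m]
  have rows: "rows ?T = ?R" by (rule rows_reading_word[OF R(1)])
  have shape: "shape ?T = p @ q" using shape_reading_word[OF R(1)] R(2) by simp
  have row: "row_at ?R i = replicate (p ! i) (Suc (m + i))" if "i < length p" for i
    using that by (simp add: row_at_def standard_filling_def nth_append)
  have sub: "subtableau p ?T = reading_word (standard_filling m p)"
    unfolding subtableau_def rows standard_filling_def[of m p]
    by (intro arg_cong[of _ _ reading_word] map_cong refl) (simp add: row)
  have right: "right_part p ?T = []"
    unfolding right_part_def rows by (auto simp: reading_word_def row)
  have "drop (length p) ?R = standard_filling (m + length p) q"
    by (intro nth_equalityI) (simp_all add: standard_filling_def nth_append add.assoc)
  then have upper: "upper_part p ?T = reading_word (standard_filling (m + length p) q)"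
    by (simp add: upper_part_def rows)
  have "is_super_standard p (subtableau p ?T)"
    unfolding is_super_standard_def sub
    using standard_filling_filling[OF p, of m] evaluation_standard[OF p ne, of m]
    by (auto simp: is_tableau_reading_word shape_reading_word)
  moreover have "contained p (shape ?T)" by (auto simp: shape contained_def part_def nth_append)
  ultimately show ?thesis
    by (simp add: katabolism_def right upper P_tableau_standard[OF q])
qed

lemma katabolisms_standard:
  assumes "is_partition (concat S)" "\<forall>s\<in>set S. s \<noteq> []"
  shows "katabolisms S (reading_word (standard_filling m (concat S))) = Some []"
  using assms
proof (induction S arbitrary: m)
  case Nil
  then show ?case by (simp add: standard_filling_def reading_word_def)
next
  case (Cons p S)
  then have "katabolism p (reading_word (standard_filling m (p @ concat S))) =
      Some (reading_word (standard_filling (m + length p) (concat S)))"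
    by (intro katabolism_standard) auto
  moreover have "is_partition (concat S)" using Cons.prems(1) is_partition_append[of p] by simp
  ultimately show ?case using Cons.IH[of "m + length p"] Cons.prems(2) by simp
qed

lemma ksplit_nonempty: "s \<in> set (ksplit k p) \<Longrightarrow> s \<noteq> []"
  by (induction k p rule: ksplit.induct) auto

section \<open>The shapes in a super atom\<close>

text \<open>The dominance order on partitions of equal size.\<close>

definition dominates :: "ptn \<Rightarrow> ptn \<Rightarrow> bool" where
  "dominates s p \<longleftrightarrow> is_partition s \<and> sum_list s = sum_list p \<and>
     (\<forall>n. (\<Sum>i<n. part p i) \<le> (\<Sum>i<n. part s i))"

definition standard_evaluation :: "ptn \<Rightarrow> tableau \<Rightarrow> bool" where
  "standard_evaluation p T \<longleftrightarrow> (\<forall>i. count_list T (Suc i) = part p i)"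

lemma standard_evaluation_set:
  assumes "is_tableau T" "standard_evaluation p T" "is_partition p"
  shows "set T = {0<..length p}"
proof -
  have "y \<in> set T \<longleftrightarrow> 0 < y \<and> y \<le> length p" for y
  proof (cases y)
    case 0
    then show ?thesis using tableau_positive[OF assms(1)] by simp
  next
    case (Suc i)
    have "y \<in> set T \<longleftrightarrow> part p i \<noteq> 0"
      using assms(2) Suc by (metis count_list_0_iff standard_evaluation_def)
    then show ?thesis
      using part_pos[OF assms(3), of i] Suc by (cases "i < length p") (auto simp: part_def)
  qed
  then show ?thesis unfolding set_eq_iff greaterThanAtMost_iff by blast
qed

lemma standard_evaluation_max_letter:
  assumes "is_tableau T" "standard_evaluation p T" "is_partition p"
  shows "max_letter T = length p"
  unfolding max_letter_def standard_evaluation_set[OF assms] by (intro Max_eqI) auto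

lemma standard_tableau_unique:
  assumes T: "is_tableau T" "standard_evaluation p T" "shape T = p"
  shows "T = reading_word (standard_filling 0 p)"
proof -
  obtain R where R: "tableau_filling R" "T = reading_word R" "shape T = map length R"
    using T(1) by (rule is_tableauE)
  have "R = standard_filling 0 p"
  proof (rule filling_standard[OF R(1)])
    show "map length R = p" using R(3) T(3) by simp
    show "count_list (reading_word R) (Suc (0 + i)) = part p i" for i
      using T(2) R(2) by (simp add: standard_evaluation_def)
    show "0 < y" if "y \<in> set (reading_word R)" for y
      using tableau_positive[OF T(1)] that R(2) by (cases y) auto
  qed
  then show ?thesis using R(2) by simp
qed

text \<open>All but the first \<open>n + 1\<close> rows of the larger shape fit into all but the first \<open>n\<close> rows of the smaller
  one.\<close>

lemma dominates_strip:
  assumes d: "dominates s p" and s': "s' \<in> strip_shapes x s"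
  shows "dominates s' (x # p)"
proof -
  have st: "is_partition s'" "sum_list s' = sum_list s + x" "\<And>i. part s' (Suc i) \<le> part s i"
    using s' by (auto simp: strip_shapes_def horizontal_strip_def)
  have d': "sum_list s = sum_list p" "\<And>n. (\<Sum>i<n. part p i) \<le> (\<Sum>i<n. part s i)"
    using d by (auto simp: dominates_def)
  have "(\<Sum>i<n. part (x # p) i) \<le> (\<Sum>i<n. part s' i)" for n
  proof (cases n)
    case (Suc m)
    define N where "N = m + length s + length s'"
    have split: "(\<Sum>i<N. f i) = (\<Sum>i<m. f i) + (\<Sum>i\<in>{m..<N}. f i)" for f :: "nat \<Rightarrow> nat"
      using sum.atLeastLessThan_concat[of 0 m N f] by (simp add: N_def atLeast0LessThan)
    have "sum_list s' = (\<Sum>i<Suc N. part s' i)" by (rule sum_part[symmetric]) (simp add: N_def)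
    also have "\<dots> = part s' 0 + (\<Sum>i<N. part s' (Suc i))" by (rule sum.lessThan_Suc_shift)
    also have "\<dots> = part s' 0 + (\<Sum>i<m. part s' (Suc i)) + (\<Sum>i\<in>{m..<N}. part s' (Suc i))"
      by (simp add: split)
    also have "\<dots> = (\<Sum>i<Suc m. part s' i) + (\<Sum>i\<in>{m..<N}. part s' (Suc i))"
      by (simp add: sum.lessThan_Suc_shift del: sum.lessThan_Suc)
    finally have s'_split: "sum_list s' = (\<Sum>i<Suc m. part s' i) + (\<Sum>i\<in>{m..<N}. part s' (Suc i))" .
    have "sum_list s = (\<Sum>i<N. part s i)" by (rule sum_part[symmetric]) (simp add: N_def)
    then have s_split: "sum_list s = (\<Sum>i<m. part s i) + (\<Sum>i\<in>{m..<N}. part s i)" by (simp add: split)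
    have "(\<Sum>i\<in>{m..<N}. part s' (Suc i)) \<le> (\<Sum>i\<in>{m..<N}. part s i)" by (intro sum_mono st(3))
    moreover have "(\<Sum>i<Suc m. part (x # p) i) = x + (\<Sum>i<m. part p i)"
      by (subst sum.lessThan_Suc_shift) simp
    ultimately show ?thesis using s'_split s_split st(2) d'(2)[of m] Suc by simp
  qed simp
  then show ?thesis using st d'(1) by (simp add: dominates_def)
qed

text \<open>A shape that gives \<open>x # p\<close> by adding a horizontal strip contains \<open>p\<close>, and has the same size.\<close>

lemma strip_shape_tail:
  assumes p: "is_partition p" and d: "dominates s p" and s': "x # p \<in> strip_shapes x s"
  shows "s = p"
proof (rule part_eqI)
  have le: "part p i \<le> part s i" for i
    using s' by (auto simp: strip_shapes_def horizontal_strip_def dest: spec[of _ i])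
  let ?N = "length s + length p"
  have "(\<Sum>i<?N. part s i) = (\<Sum>i<?N. part p i)"
    using d sum_part[of s ?N] sum_part[of p ?N] by (simp add: dominates_def)
  then have eq: "part s i = part p i" if "i < ?N" for i
    using sum_mono_inv[of "part p" "{..<?N}" "part s" i] le that by simp
  show "part s i = part p i" for i
    using eq[of i] by (cases "i < ?N") (auto simp: part_def)
qed (use p d in \<open>simp_all add: dominates_def\<close>)

lemma strip_shape_Cons:
  assumes "is_partition (x # p)" shows "x # p \<in> strip_shapes x p"
proof -
  have "part p i \<le> part (x # p) i" for i
    using part_antimono[OF assms, of i "Suc i"] by simp
  then show ?thesis using assms by (auto simp: strip_shapes_def horizontal_strip_def)
qed

lemma filter_mset_sum: "filter_mset P (\<Sum>x\<in>#A. f x) = (\<Sum>x\<in>#A. filter_mset P (f x))"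
  by (induction A) simp_all

lemma size_sum_mset: "size (\<Sum>x\<in>#A. f x :: 'b multiset) = (\<Sum>x\<in>#A. size (f x))"
  by (induction A) simp_all

lemma extend_filtering:
  "extend_linearly (filtering S) A = filter_mset (\<lambda>T. katabolisms S T = Some []) A"
  by (induction A) (simp_all add: extend_linearly_def filtering_def)

text \<open>The strip of letters \<open>m + 1\<close> becomes, by the cyclic permutation of the letters, the strip of the letters
  \<open>1\<close>, while the other letters move up by one.\<close>

lemma promotion_tableaux:
  assumes T: "is_tableau T" "standard_evaluation p T" and xp: "is_partition (x # p)"
  shows "\<forall>U\<in>#promotion x T. is_tableau U \<and> standard_evaluation (x # p) U \<and> shape U \<in> strip_shapes x (shape T)"
    and "size (filter_mset (\<lambda>U. shape U = s) (promotion x T)) =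
      (if s \<in> strip_shapes x (shape T) then 1 else 0)"
proof -
  have p: "is_partition p" using is_partition_append[of "[x]" p] xp by simp
  let ?m = "length p"
  have m: "max_letter T = ?m" by (rule standard_evaluation_max_letter[OF T p])
  have less: "y < Suc ?m" if "y \<in> set T" for y
    using that standard_evaluation_set[OF T p] by auto
  have prom: "promotion x T = image_mset (sigmas [1..<Suc ?m]) (mset_set (add_strip x (Suc ?m) T))"
    by (simp add: promotion_def m Let_def)
  have strip: "is_tableau U" "shape U \<in> strip_shapes x (shape T)"
    "count_list U y = count_list T y + (if y = Suc ?m then x else 0)"
    if "U \<in> add_strip x (Suc ?m) T" for U y
    using add_strip_tableau[OF T(1) less _ that] by auto
  have sig: "is_tableau (sigmas [1..<Suc ?m] U)" "shape (sigmas [1..<Suc ?m] U) = shape U"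
    if "U \<in> add_strip x (Suc ?m) T" for U
    using sigmas_is_tableau[OF strip(1)[OF that], of "[1..<Suc ?m]"] by (auto simp del: upt_Suc)
  have eval: "standard_evaluation (x # p) (sigmas [1..<Suc ?m] U)"
    if U: "U \<in> add_strip x (Suc ?m) T" for U
    unfolding standard_evaluation_def
  proof
    fix i
    have cT: "count_list T (Suc j) = part p j" for j
      using T(2) by (simp add: standard_evaluation_def)
    consider "i = 0" | j where "i = Suc j" "j < ?m" | j where "i = Suc j" "?m \<le> j"
      by (cases i) (auto simp: not_less[symmetric])
    then show "count_list (sigmas [1..<Suc ?m] U) (Suc i) = part (x # p) i"
    proof cases
      case 1
      then show ?thesis unfolding count_sigmas_upt strip(3)[OF U] by (simp add: cT part_def)
    next
      case 2
      then show ?thesis unfolding count_sigmas_upt strip(3)[OF U] by (simp add: cT)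
    next
      case 3
      then show ?thesis unfolding count_sigmas_upt strip(3)[OF U] by (simp add: cT part_def)
    qed
  qed
  show "\<forall>U\<in>#promotion x T. is_tableau U \<and> standard_evaluation (x # p) U \<and> shape U \<in> strip_shapes x (shape T)"
    unfolding prom using sig eval strip(2) finite_add_strip by (auto simp del: upt_Suc)
  have "filter_mset (\<lambda>U. shape U = s) (promotion x T) =
      image_mset (sigmas [1..<Suc ?m]) (filter_mset (\<lambda>U. shape (sigmas [1..<Suc ?m] U) = s)
        (mset_set (add_strip x (Suc ?m) T)))"
    unfolding prom by (simp add: filter_mset_image_mset del: upt_Suc)
  also have "filter_mset (\<lambda>U. shape (sigmas [1..<Suc ?m] U) = s) (mset_set (add_strip x (Suc ?m) T)) =
      mset_set {U \<in> add_strip x (Suc ?m) T. shape (sigmas [1..<Suc ?m] U) = s}"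
    by (rule filter_mset_mset_set[OF finite_add_strip])
  also have "{U \<in> add_strip x (Suc ?m) T. shape (sigmas [1..<Suc ?m] U) = s} =
      {U \<in> add_strip x (Suc ?m) T. shape U = s}"
    using sig(2) by (intro Collect_cong) (auto simp del: upt_Suc)
  finally show "size (filter_mset (\<lambda>U. shape U = s) (promotion x T)) =
      (if s \<in> strip_shapes x (shape T) then 1 else 0)"
    using add_strip_unique[OF T(1) less, of x s] by simp
qed

text \<open>The tableaux of shape \<open>p\<close> are counted through the promotion: their shapes arise from that of
  \<open>tl p\<close> only, in one way, and the katabolism keeps the superstandard tableau.\<close>

theorem super_atom_shapes:
  assumes "is_partition p"
  shows "(\<forall>T\<in>#super_atom k p. is_tableau T \<and> standard_evaluation p T \<and> dominates (shape T) p) \<and>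
    size (filter_mset (\<lambda>T. shape T = p) (super_atom k p)) = 1"
  using assms
proof (induction p)
  case Nil
  have "tableau_filling []" by (simp add: tableau_filling_def is_partition_def)
  then have "is_tableau []" "shape [] = []"
    using is_tableau_reading_word[of "[]"] shape_reading_word[of "[]"] by (simp_all add: reading_word_def)
  then show ?case by (simp add: standard_evaluation_def dominates_def part_def is_partition_def)
next
  case (Cons x p)
  have p: "is_partition p" using is_partition_append[of "[x]" p] Cons.prems by simp
  let ?A = "super_atom k p" and ?S = "ksplit k (x # p)"
  let ?B = "extend_linearly (promotion x) ?A"
  have A: "is_tableau T" "standard_evaluation p T" "dominates (shape T) p" if "T \<in># ?A" for T
    using Cons.IH[OF p] that by blast+
  have B: "is_tableau U \<and> standard_evaluation (x # p) U \<and> dominates (shape U) (x # p)" if "U \<in># ?B" for U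
  proof -
    note prems = that
    obtain T where T: "T \<in># ?A" "U \<in># promotion x T"
      using prems by (auto simp: extend_linearly_def)
    then show ?thesis
      using promotion_tableaux(1)[OF A(1,2)[OF T(1)] Cons.prems] dominates_strip[OF A(3)[OF T(1)]] by blast
  qed
  have "size (filter_mset (\<lambda>U. shape U = x # p) ?B) =
      (\<Sum>T\<in>#?A. size (filter_mset (\<lambda>U. shape U = x # p) (promotion x T)))"
    unfolding extend_linearly_def filter_mset_sum by (rule size_sum_mset)
  also have "\<dots> = (\<Sum>T\<in>#?A. if shape T = p then 1 else 0)"
  proof (intro arg_cong[of _ _ sum_mset] image_mset_cong)
    fix T assume T: "T \<in># ?A"
    have "x # p \<in> strip_shapes x (shape T) \<longleftrightarrow> shape T = p"
      using strip_shape_tail[OF p A(3)[OF T]] strip_shape_Cons[OF Cons.prems] by blast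
    then show "size (filter_mset (\<lambda>U. shape U = x # p) (promotion x T)) = (if shape T = p then 1 else 0)"
      using promotion_tableaux(2)[OF A(1,2)[OF T] Cons.prems, of "x # p"] by simp
  qed
  also have "\<dots> = size (filter_mset (\<lambda>T. shape T = p) ?A)"
  proof -
    have "(\<Sum>T\<in>#M. if shape T = p then 1 else 0) = size (filter_mset (\<lambda>T. shape T = p) M)" for M
      by (induction M) auto
    then show ?thesis .
  qed
  also have "\<dots> = 1" using Cons.IH[OF p] by blast
  finally have one: "size (filter_mset (\<lambda>U. shape U = x # p) ?B) = 1" .
  have keep: "katabolisms ?S U = Some []" if "U \<in># ?B" "shape U = x # p" for U
  proof -
    have "U = reading_word (standard_filling 0 (x # p))"
      using standard_tableau_unique[of U "x # p"] B[OF that(1)] that(2) by blast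
    then show ?thesis
      using katabolisms_standard[of ?S 0] Cons.prems ksplit_nonempty[of _ k "x # p"]
      by (simp only: concat_ksplit) blast
  qed
  have "filter_mset (\<lambda>T. shape T = x # p) (filter_mset (\<lambda>T. katabolisms ?S T = Some []) ?B) =
      filter_mset (\<lambda>U. shape U = x # p) ?B"
    unfolding filter_filter_mset using keep by (intro filter_mset_cong refl) blast
  then show ?case using one B by (auto simp: extend_filtering simp del: ksplit.simps)
qed

section \<open>Polynomials in the power sums\<close>

definition mono_eval :: "(nat \<Rightarrow> 'b::comm_ring_1) \<Rightarrow> (nat \<Rightarrow>\<^sub>0 nat) \<Rightarrow> 'b" where
  "mono_eval g m = (\<Prod>i\<in>Poly_Mapping.keys m. g i ^ Poly_Mapping.lookup m i)"

lemma mono_eval_superset: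
  assumes "finite S" "Poly_Mapping.keys m \<subseteq> S"
  shows "mono_eval g m = (\<Prod>i\<in>S. g i ^ Poly_Mapping.lookup m i)"
  unfolding mono_eval_def using assms
  by (intro prod.mono_neutral_left) (auto simp: in_keys_iff)

lemma mono_eval_zero [simp]: "mono_eval g 0 = 1"
  by (simp add: mono_eval_def)

lemma mono_eval_single [simp]: "mono_eval g (Poly_Mapping.single i n) = g i ^ n"
  by (cases "n = 0") (auto simp: mono_eval_def)

lemma mono_eval_add: "mono_eval g (m + m') = mono_eval g m * mono_eval g m'"
proof -
  let ?S = "Poly_Mapping.keys m \<union> Poly_Mapping.keys m'"
  have "Poly_Mapping.keys (m + m') \<subseteq> ?S" by (rule keys_add)
  then show ?thesis
    by (simp add: mono_eval_superset[of ?S] lookup_add power_add prod.distrib)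
qed

text \<open>The value of a polynomial in the power sums, after \<open>c\<close> has been applied to its coefficients and \<open>g\<close> has
  been substituted for the power sums.  All substitutions below are instances of this one.\<close>

definition poly_eval :: "('a::field \<Rightarrow> 'b::comm_ring_1) \<Rightarrow> (nat \<Rightarrow> 'b) \<Rightarrow> 'a sf \<Rightarrow> 'b" where
  "poly_eval c g f =
     (\<Sum>m\<in>Poly_Mapping.keys f. c (Poly_Mapping.lookup f m) * mono_eval g m)"

lemma sf_induct [case_names zero monomial add]:
  fixes f :: "'a::comm_monoid_add sf"
  assumes "P 0" "\<And>m a. P (Poly_Mapping.single m a)" "\<And>f g. P f \<Longrightarrow> P g \<Longrightarrow> P (f + g)"
  shows "P f"
proof (induction f rule: update_induct)
  case (update f a b)
  have "Poly_Mapping.update a b f = Poly_Mapping.single a b + f"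
    using update(1) by (intro poly_mapping_eqI)
      (auto simp: lookup_update lookup_add lookup_single in_keys_iff when_def)
  then show ?case using assms(2,3) update(3) by simp
qed (rule assms(1))

context
  fixes c :: "'a::field \<Rightarrow> 'b::comm_ring_1" and g :: "nat \<Rightarrow> 'b"
  assumes c: "comm_ring_hom c"
begin

interpretation c: comm_ring_hom c by (rule c)

lemma poly_eval_superset:
  assumes "finite S" "Poly_Mapping.keys f \<subseteq> S"
  shows "poly_eval c g f = (\<Sum>m\<in>S. c (Poly_Mapping.lookup f m) * mono_eval g m)"
  unfolding poly_eval_def using assms
  by (intro sum.mono_neutral_left) (auto simp: in_keys_iff)

lemma poly_eval_single: "poly_eval c g (Poly_Mapping.single m a) = c a * mono_eval g m"
  by (subst poly_eval_superset[of "{m}"]) auto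

lemma poly_eval_add: "poly_eval c g (f + h) = poly_eval c g f + poly_eval c g h"
proof -
  let ?S = "Poly_Mapping.keys f \<union> Poly_Mapping.keys h"
  have "Poly_Mapping.keys (f + h) \<subseteq> ?S" by (rule keys_add)
  then show ?thesis
    by (simp add: poly_eval_superset[of ?S] lookup_add c.hom_add algebra_simps sum.distrib)
qed

lemma poly_eval_mult: "poly_eval c g (f * h) = poly_eval c g f * poly_eval c g h"
proof (induction f rule: sf_induct)
  case (monomial m a)
  show ?case
    by (induction h rule: sf_induct)
      (simp_all add: poly_eval_def[of c g 0] mult_single poly_eval_single poly_eval_add
        mono_eval_add c.hom_mult algebra_simps)
qed (simp_all add: poly_eval_def[of c g 0] poly_eval_add algebra_simps)

lemma poly_eval_hom: "comm_ring_hom (poly_eval c g)"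
  by unfold_locales
    (simp_all add: poly_eval_add poly_eval_mult poly_eval_def[of c g 0] poly_eval_single
      flip: single_one)

lemma poly_eval_const: "poly_eval c g (sf_const a) = c a"
  by (simp add: sf_const_def poly_eval_single)

lemma poly_eval_power_sum: "poly_eval c g (power_sum i) = g i"
  by (simp add: power_sum_def poly_eval_single)

end

lemma sf_const_hom: "comm_ring_hom sf_const"
  by unfold_locales (simp_all add: sf_const_def single_add mult_single)

interpretation sf_const: comm_ring_hom "sf_const :: 'a::field \<Rightarrow> 'a sf"
  by (rule sf_const_hom)

lemma single_eq_mono_eval:
  "Poly_Mapping.single m (a :: 'a::field) = sf_const a * mono_eval power_sum m"
proof -
  have "Poly_Mapping.single m (1::'a) = mono_eval power_sum m"
  proof (induction m rule: update_induct)
    case (update m i n)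
    have u: "Poly_Mapping.update i n m = Poly_Mapping.single i n + m"
      using update(1) by (intro poly_mapping_eqI)
        (auto simp: lookup_update lookup_add lookup_single in_keys_iff when_def)
    have "power_sum i ^ n = (Poly_Mapping.single (Poly_Mapping.single i n) 1 :: 'a sf)"
      by (induction n) (simp_all add: power_sum_def mult_single flip: single_add)
    then show ?case
      using update(3) mult_single[of "Poly_Mapping.single i n" "1::'a" m 1]
      by (simp add: u mono_eval_add)
  qed simp
  then show ?thesis by (simp add: sf_const_def mult_single flip: \<open>_ = mono_eval power_sum m\<close>)
qed

lemma hom_mono_eval:
  assumes "comm_ring_hom F"
  shows "F (mono_eval g m) = mono_eval (\<lambda>i. F (g i)) m"
proof -
  interpret F: comm_ring_hom F by fact
  show ?thesis by (simp add: mono_eval_def F.hom_prod F.hom_power)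
qed

text \<open>The universal property of the ring of symmetric functions.\<close>

lemma sf_hom_eqI:
  fixes F G :: "'a::field sf \<Rightarrow> 'b::comm_ring_1"
  assumes F: "comm_ring_hom F" and G: "comm_ring_hom G"
    and "\<And>a. F (sf_const a) = G (sf_const a)" "\<And>i. F (power_sum i) = G (power_sum i)"
  shows "F f = G f"
proof -
  interpret F: comm_ring_hom F by fact
  interpret G: comm_ring_hom G by fact
  show ?thesis
    by (induction f rule: sf_induct)
      (simp_all add: single_eq_mono_eval F.hom_mult G.hom_mult F.hom_add G.hom_add assms(3,4)
        hom_mono_eval[OF F] hom_mono_eval[OF G])
qed

lemma hom_compose:
  assumes "comm_ring_hom F" "comm_ring_hom G"
  shows "comm_ring_hom (\<lambda>x. F (G x))"
proof -
  interpret F: comm_ring_hom F by fact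
  interpret G: comm_ring_hom G by fact
  show ?thesis by unfold_locales (simp_all add: F.hom_add F.hom_mult G.hom_add G.hom_mult)
qed

lemma complete_sf_Suc:
  fixes n :: nat
  assumes "(of_nat (Suc n) :: 'a::field) \<noteq> 0"
  shows "sf_const (of_nat (Suc n)) * complete_sf (Suc n) =
    (\<Sum>i\<le>n. power_sum (Suc i) * complete_sf (n - i) :: 'a sf)"
  using assms by (simp add: sf_scale_def mult.assoc[symmetric] del: of_nat_Suc flip: sf_const.hom_mult)

lemma hom_schur:
  assumes "comm_ring_hom F"
  shows "F (schur p) = det (mat (length p) (length p)
     (\<lambda>(i, j). if i \<le> p ! i + j then F (complete_sf (p ! i + j - i)) else 0))"
proof -
  interpret F: comm_ring_hom F by fact
  show ?thesis unfolding schur_def F.hom_det[symmetric]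
    by (intro arg_cong[where f=det] eq_matI) auto
qed

declare complete_sf.simps(2) [simp del]

section \<open>Functions of finitely many generators\<close>

definition supported :: "nat set \<Rightarrow> 'a::field sf set" where
  "supported S = {f. \<forall>m\<in>Poly_Mapping.keys f. Poly_Mapping.keys m \<subseteq> S}"

lemma supported_0 [simp]: "0 \<in> supported S"
  by (simp add: supported_def)

lemma supported_const [simp]: "sf_const a \<in> supported S"
  by (simp add: supported_def sf_const_def)

lemma supported_1 [simp]: "1 \<in> supported S"
  by (simp add: supported_def)

lemma supported_power_sum: "i \<in> S \<Longrightarrow> power_sum i \<in> supported S"
  by (simp add: supported_def power_sum_def)

lemma supported_add: "f \<in> supported S \<Longrightarrow> g \<in> supported S \<Longrightarrow> f + g \<in> supported S"
  using keys_add[of f g] by (auto simp: supported_def)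

lemma supported_mult:
  assumes "f \<in> supported S" "g \<in> supported S" shows "f * g \<in> supported S"
  unfolding supported_def
proof (intro CollectI ballI)
  fix m assume "m \<in> Poly_Mapping.keys (f * g)"
  then obtain a b where "a \<in> Poly_Mapping.keys f" "b \<in> Poly_Mapping.keys g" "m = a + b"
    using keys_mult[of f g] by auto
  then show "Poly_Mapping.keys m \<subseteq> S"
    using assms keys_add[of a b] unfolding supported_def by blast
qed

lemma supported_scale: "f \<in> supported S \<Longrightarrow> sf_scale a f \<in> supported S"
  by (simp add: sf_scale_def supported_mult)

lemma supported_sum: "(\<And>x. x \<in> A \<Longrightarrow> f x \<in> supported S) \<Longrightarrow> sum f A \<in> supported S"
  by (induction A rule: infinite_finite_induct) (simp_all add: supported_add)

lemma supported_prod: "(\<And>x. x \<in> A \<Longrightarrow> f x \<in> supported S) \<Longrightarrow> prod f A \<in> supported S"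
  by (induction A rule: infinite_finite_induct) (simp_all add: supported_mult)

lemma supported_uminus: "f \<in> supported S \<Longrightarrow> - f \<in> supported S"
  by (simp add: supported_def)

lemma supported_diff: "f \<in> supported S \<Longrightarrow> g \<in> supported S \<Longrightarrow> f - g \<in> supported S"
  using supported_add[OF _ supported_uminus, of f S g] by simp

lemma supported_signof: "of_int (sign p) \<in> supported S" 
  by (simp add: sign_def supported_uminus)

lemma supported_complete_sf: "complete_sf n \<in> supported {0<..}"
proof (induction n rule: less_induct)
  case (less n)
  show ?case
    by (cases n) (simp_all add: complete_sf.simps(2) supported_scale supported_sum supported_mult supported_power_sum less)
qed

lemma supported_schur: "schur p \<in> supported {0<..}"
proof -
  let ?A = "mat (length p) (length p)
     (\<lambda>(i, j). if i \<le> p ! i + j then complete_sf (p ! i + j - i) else 0)"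
  have "signof \<pi> * (\<Prod>i = 0..<length p. ?A $$ (i, \<pi> i)) \<in> supported {0<..}"
    if "\<pi> permutes {0..<length p}" for \<pi>
    using permutes_in_image[OF that]
    by (intro supported_mult supported_prod supported_signof)
      (simp add: supported_complete_sf)
  then show ?thesis
    unfolding schur_def by (subst det_def') (auto intro!: supported_sum)
qed


section \<open>The complete functions as coordinates\<close>

text \<open>Newton's identity, solved for the power sums: the power sum of index \<open>n\<close> as a
  polynomial in the complete functions, the variable of index \<open>i\<close> standing for the \<open>i\<close>-th one.\<close>

fun newton :: "nat \<Rightarrow> rat sf" where
  "newton 0 = power_sum 0"
| "newton (Suc n) = sf_const (of_nat (Suc n)) * power_sum (Suc n)
     - (\<Sum>i<n. newton (Suc i) * power_sum (n - i))"

declare newton.simps(2) [simp del]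

text \<open>The coordinates of a symmetric function with respect to the complete functions: the result is to be
  read as a polynomial in variables \<open>x\<^sub>i\<close> (which the type calls power sums) that stand for the \<open>h\<^sub>i\<close>.
  On the rings at \<open>t = 1\<close> it is undone by \<open>h_subst\<close>.\<close>

definition h_coords :: "rat sf \<Rightarrow> rat sf" where
  "h_coords = poly_eval sf_const newton"

definition h_subst :: "rat sf \<Rightarrow> rat sf" where
  "h_subst = poly_eval sf_const complete_sf"

lemma h_coords_hom: "comm_ring_hom h_coords"
  unfolding h_coords_def by (rule poly_eval_hom[OF sf_const_hom])

lemma h_subst_hom: "comm_ring_hom h_subst"
  unfolding h_subst_def by (rule poly_eval_hom[OF sf_const_hom])

interpretation h_coords: comm_ring_hom h_coords by (rule h_coords_hom)
interpretation h_subst: comm_ring_hom h_subst by (rule h_subst_hom)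

lemma h_coords_const [simp]: "h_coords (sf_const a) = sf_const a"
  by (simp add: h_coords_def poly_eval_const[OF sf_const_hom])

lemma h_subst_const [simp]: "h_subst (sf_const a) = sf_const a"
  by (simp add: h_subst_def poly_eval_const[OF sf_const_hom])

lemma h_coords_power_sum: "h_coords (power_sum i) = newton i"
  by (simp add: h_coords_def poly_eval_power_sum[OF sf_const_hom])

lemma h_subst_power_sum: "h_subst (power_sum i) = complete_sf i"
  by (simp add: h_subst_def poly_eval_power_sum[OF sf_const_hom])

text \<open>Both \<open>newton\<close> and \<open>complete_sf\<close> solve Newton's identity, the former for the power sums, the latter for
  the complete functions.\<close>

lemma h_coords_complete_sf:
  "h_coords (complete_sf n) = (if n = 0 then 1 else power_sum n)"
proof (induction n rule: less_induct)
  case (less n)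
  show ?case
  proof (cases n)
    case (Suc m)
    have nz: "(of_nat (Suc m) :: rat) \<noteq> 0" by simp
    let ?c = "sf_const (of_nat (Suc m)) :: rat sf"
    have "?c * h_coords (complete_sf (Suc m)) = h_coords (?c * complete_sf (Suc m))"
      by (simp only: h_coords.hom_mult h_coords_const)
    also have "\<dots> = (\<Sum>i\<le>m. newton (Suc i) * h_coords (complete_sf (m - i)))"
      unfolding complete_sf_Suc[OF nz]
      by (simp only: h_coords.hom_sum h_coords.hom_mult h_coords_power_sum)
    also have "\<dots> = (\<Sum>i<m. newton (Suc i) * h_coords (complete_sf (m - i))) + newton (Suc m)"
      by (simp add: lessThan_Suc_atMost[symmetric])
    also have "(\<Sum>i<m. newton (Suc i) * h_coords (complete_sf (m - i))) + newton (Suc m) =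
        (\<Sum>i<m. newton (Suc i) * power_sum (m - i)) + newton (Suc m)"
    proof (rule arg_cong2[OF sum.cong[OF refl] refl, of _ _ _ "(+)"])
      fix i assume "i \<in> {..<m}"
      then show "newton (Suc i) * h_coords (complete_sf (m - i)) = newton (Suc i) * power_sum (m - i)"
        using less.IH[of "m - i"] Suc by simp
    qed
    also have "\<dots> = ?c * power_sum (Suc m)"
      unfolding newton.simps(2)[of m] by (subst add.commute) (rule diff_add_cancel)
    finally have eq: "?c * h_coords (complete_sf (Suc m)) = ?c * power_sum (Suc m)" .
    have "sf_const (1 / of_nat (Suc m)) * ?c = 1"
      unfolding sf_const.hom_mult[symmetric] by (simp add: nz del: of_nat_Suc)
    then have "h_coords (complete_sf (Suc m)) = power_sum (Suc m)"
      using arg_cong[OF eq, of "(*) (sf_const (1 / of_nat (Suc m)))"]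
      unfolding mult.assoc[symmetric] by (simp only: mult_1_left)
    then show ?thesis using Suc by simp
  qed simp
qed

section \<open>The ring at \<open>t = 1\<close>\<close>

lemma cring_sf_ring: "cring sf_ring"
proof (rule cringI)
  show "abelian_group sf_ring"
  proof (rule abelian_groupI)
    fix x assume "x \<in> carrier sf_ring"
    show "\<exists>y\<in>carrier sf_ring. y \<oplus>\<^bsub>sf_ring\<^esub> x = \<zero>\<^bsub>sf_ring\<^esub>"
      by (rule bexI[of _ "- x"]) (simp_all add: sf_ring_def)
  qed (simp_all add: sf_ring_def add_ac)
  show "Group.comm_monoid sf_ring"
    by (rule comm_monoidI) (simp_all add: sf_ring_def mult_ac)
qed (simp_all add: sf_ring_def distrib_right)

lemma sf_ring_simps [simp]:
  "carrier sf_ring = UNIV" "x \<otimes>\<^bsub>sf_ring\<^esub> y = x * y" "\<one>\<^bsub>sf_ring\<^esub> = 1"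
  "\<zero>\<^bsub>sf_ring\<^esub> = 0" "x \<oplus>\<^bsub>sf_ring\<^esub> y = x + y"
  by (simp_all add: sf_ring_def)

lemma sf_ring_update_simps:
  "x \<otimes>\<^bsub>sf_ring\<lparr>carrier := C\<rparr>\<^esub> y = x * y" "\<one>\<^bsub>sf_ring\<lparr>carrier := C\<rparr>\<^esub> = 1"
  "\<zero>\<^bsub>sf_ring\<lparr>carrier := C\<rparr>\<^esub> = 0" "x \<oplus>\<^bsub>sf_ring\<lparr>carrier := C\<rparr>\<^esub> y = x + y"
  "carrier (sf_ring\<lparr>carrier := C\<rparr>) = C"
  by simp_all

lemma V1_simps [simp]:
  "x \<otimes>\<^bsub>V1 k\<^esub> y = x * y" "\<one>\<^bsub>V1 k\<^esub> = 1" "\<zero>\<^bsub>V1 k\<^esub> = 0" "x \<oplus>\<^bsub>V1 k\<^esub> y = x + y"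
  unfolding V1_def by (rule sf_ring_update_simps)+

lemma sf_ring_uminus [simp]: "\<ominus>\<^bsub>sf_ring\<^esub> x = - x"
proof -
  interpret sf_ring: cring sf_ring by (rule cring_sf_ring)
  show ?thesis using sf_ring.minus_equality[of "- x" x] by simp
qed

lemma V1_carrier:
  "carrier (V1 k) = generate_ring sf_ring (range sf_const \<union> complete_sf ` {0<..k})"
proof -
  have "{1..k} = {0<..k}" by auto
  then show ?thesis unfolding V1_def sf_ring_update_simps by (rule arg_cong)
qed

lemma V1_1: "1 \<in> carrier (V1 k)"
  using generate_ring.one[of sf_ring] by (simp add: V1_carrier)

lemma V1_const: "sf_const a \<in> carrier (V1 k)"
  by (auto simp: V1_carrier intro: generate_ring.incl)

lemma V1_0: "0 \<in> carrier (V1 k)"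
  using V1_const[of 0] by simp

lemma V1_complete_sf: "n \<le> k \<Longrightarrow> complete_sf n \<in> carrier (V1 k)"
  using V1_1 by (cases "n = 0") (auto simp: V1_carrier intro: generate_ring.incl)

lemma V1_add: "f \<in> carrier (V1 k) \<Longrightarrow> g \<in> carrier (V1 k) \<Longrightarrow> f + g \<in> carrier (V1 k)"
  using generate_ring.eng_add[of _ sf_ring] by (simp add: V1_carrier)

lemma V1_mult: "f \<in> carrier (V1 k) \<Longrightarrow> g \<in> carrier (V1 k) \<Longrightarrow> f * g \<in> carrier (V1 k)"
  using generate_ring.eng_mult[of _ sf_ring] by (simp add: V1_carrier)

lemma V1_uminus: "f \<in> carrier (V1 k) \<Longrightarrow> - f \<in> carrier (V1 k)"
  using generate_ring.a_inv[of _ sf_ring] by (simp add: V1_carrier)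

lemma V1_minus: "f \<in> carrier (V1 k) \<Longrightarrow> g \<in> carrier (V1 k) \<Longrightarrow> f - g \<in> carrier (V1 k)"
  using V1_add[of f k "- g"] V1_uminus by simp

lemma V1_scale: "f \<in> carrier (V1 k) \<Longrightarrow> sf_scale a f \<in> carrier (V1 k)"
  by (simp add: sf_scale_def V1_mult V1_const)

lemma V1_sum: "(\<And>x. x \<in> A \<Longrightarrow> f x \<in> carrier (V1 k)) \<Longrightarrow> sum f A \<in> carrier (V1 k)"
  by (induction A rule: infinite_finite_induct) (simp_all add: V1_add V1_0)

lemma V1_prod: "(\<And>x. x \<in> A \<Longrightarrow> f x \<in> carrier (V1 k)) \<Longrightarrow> prod f A \<in> carrier (V1 k)"
  by (induction A rule: infinite_finite_induct) (simp_all add: V1_mult V1_1)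

lemma V1_power: "f \<in> carrier (V1 k) \<Longrightarrow> f ^ n \<in> carrier (V1 k)"
  by (induction n) (simp_all add: V1_mult V1_1)

lemma V1_mono_eval:
  "(\<And>i. i \<in> Poly_Mapping.keys m \<Longrightarrow> g i \<in> carrier (V1 k)) \<Longrightarrow> mono_eval g m \<in> carrier (V1 k)"
  by (simp add: mono_eval_def V1_prod V1_power)

text \<open>The first \<open>k\<close> power sums are polynomials in the first \<open>k\<close> complete functions, by Newton's identity.\<close>

lemma V1_power_sum: "1 \<le> n \<Longrightarrow> n \<le> k \<Longrightarrow> power_sum n \<in> carrier (V1 k)"
proof (induction n rule: less_induct)
  case (less n)
  then obtain m where m: "n = Suc m" by (cases n) auto
  have "(of_nat (Suc m) :: rat) \<noteq> 0" by simp
  from complete_sf_Suc[OF this] have "(power_sum (Suc m) :: rat sf) =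
      sf_const (of_nat (Suc m)) * complete_sf (Suc m) -
      (\<Sum>i<m. power_sum (Suc i) * complete_sf (m - i))"
    by (simp add: lessThan_Suc_atMost[symmetric] eq_diff_eq add.commute del: of_nat_Suc)
  moreover have "\<dots> \<in> carrier (V1 k)"
    using less.prems m
    by (intro V1_minus V1_mult V1_const V1_complete_sf V1_sum) (auto intro: less.IH)
  ultimately show ?case using m by simp
qed

lemma supported_subset_V1: "f \<in> supported {0<..k} \<Longrightarrow> f \<in> carrier (V1 k)"
proof -
  assume f: "f \<in> supported {0<..k}"
  have "f = poly_eval sf_const power_sum f"
    by (rule sf_hom_eqI[OF _ poly_eval_hom[OF sf_const_hom], where F="\<lambda>x. x"])
      (unfold_locales, simp_all add: poly_eval_const[OF sf_const_hom] poly_eval_power_sum[OF sf_const_hom])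
  also have "\<dots> \<in> carrier (V1 k)"
    unfolding poly_eval_def using f
    by (intro V1_sum V1_mult V1_const V1_mono_eval V1_power_sum) (fastforce simp: supported_def)+
  finally show ?thesis .
qed

lemma V1_induct [consumes 1, case_names const complete uminus add mult]:
  assumes "f \<in> carrier (V1 k)"
    and "\<And>a. P (sf_const a)" "\<And>n. 1 \<le> n \<Longrightarrow> n \<le> k \<Longrightarrow> P (complete_sf n)"
    and "\<And>f. f \<in> carrier (V1 k) \<Longrightarrow> P f \<Longrightarrow> P (- f)"
    and "\<And>f g. P f \<Longrightarrow> P g \<Longrightarrow> P (f + g)" "\<And>f g. P f \<Longrightarrow> P g \<Longrightarrow> P (f * g)"
  shows "P f"
  using assms(1) unfolding V1_carrier
proof (induction rule: generate_ring.induct)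
  case one
  show ?case using assms(2)[of 1] by simp
next
  case (a_inv h)
  then show ?case using assms(4)[of h] unfolding V1_carrier sf_ring_uminus by blast
next
  case (incl h)
  then show ?case using assms(2,3) by force
next
  case (eng_add f g)
  then show ?case using assms(5)[of f g] by simp
next
  case (eng_mult f g)
  then show ?case using assms(6)[of f g] by simp
qed

lemma V1_h_coords: "f \<in> carrier (V1 k) \<Longrightarrow> h_coords f \<in> supported {0<..k}"
proof (induction rule: V1_induct)
  case (complete n)
  then have "h_coords (complete_sf n) = power_sum n" by (simp add: h_coords_complete_sf)
  then show ?case using complete supported_power_sum[of n "{0<..k}"] by simp
next
  case (uminus f)
  then show ?case using supported_uminus[of "h_coords f"] h_coords.hom_uminus[of f] by metis
next
  case (add f g)
  then show ?case using supported_add[of "h_coords f" _ "h_coords g"] h_coords.hom_add[of f g] by metis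
next
  case (mult f g)
  then show ?case  using supported_mult[of "h_coords f" _ "h_coords g"] h_coords.hom_mult[of f g] by metis
next
  case (const a) show ?case by (simp)
qed

lemma h_subst_h_coords: "f \<in> carrier (V1 k) \<Longrightarrow> h_subst (h_coords f) = f"
proof (induction rule: V1_induct)
  case (complete n)
  then have "h_coords (complete_sf n) = power_sum n" by (simp add: h_coords_complete_sf)
  then show ?case by (simp add: h_subst_power_sum)
next
  case (uminus f)
  then show ?case using h_coords.hom_uminus[of f] h_subst.hom_uminus[of "h_coords f"] by metis
next
  case (add f g)
  then show ?case using h_coords.hom_add[of f g] h_subst.hom_add[of "h_coords f"] by metis
next
  case (mult f g)
  then show ?case using h_coords.hom_mult[of f g] h_subst.hom_mult[of "h_coords f"] by metis
qed simp

section \<open>Leading monomials\<close>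

definition linear_weight :: "(nat \<Rightarrow> nat) \<Rightarrow> (nat \<Rightarrow>\<^sub>0 nat) \<Rightarrow> nat" where
  "linear_weight c m = (\<Sum>i\<in>Poly_Mapping.keys m. c i * Poly_Mapping.lookup m i)"

lemma linear_weight_superset:
  assumes "finite S" "Poly_Mapping.keys m \<subseteq> S"
  shows "linear_weight c m = (\<Sum>i\<in>S. c i * Poly_Mapping.lookup m i)"
  unfolding linear_weight_def using assms
  by (intro sum.mono_neutral_left) (auto simp: in_keys_iff)

lemma linear_weight_0 [simp]: "linear_weight c 0 = 0"
  by (simp add: linear_weight_def)

lemma linear_weight_add: "linear_weight c (m + n) = linear_weight c m + linear_weight c n"
proof -
  let ?S = "Poly_Mapping.keys m \<union> Poly_Mapping.keys n"
  have "Poly_Mapping.keys (m + n) \<subseteq> ?S" by (rule keys_add)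
  then show ?thesis
    by (simp add: linear_weight_superset[of ?S] lookup_add algebra_simps sum.distrib)
qed

lemma linear_weight_single [simp]: "linear_weight c (Poly_Mapping.single i n) = c i * n"
  by (cases "n = 0") (auto simp: linear_weight_def)

lemma linear_weight_sum: "linear_weight c (sum f S) = (\<Sum>i\<in>S. linear_weight c (f i))"
  by (induction S rule: infinite_finite_induct) (simp_all add: linear_weight_add)

abbreviation degree_of :: "(nat \<Rightarrow>\<^sub>0 nat) \<Rightarrow> nat" where
  "degree_of \<equiv> linear_weight (\<lambda>i. i)"

abbreviation spread :: "(nat \<Rightarrow>\<^sub>0 nat) \<Rightarrow> nat" where
  "spread \<equiv> linear_weight (\<lambda>i. i * i)"

text \<open>The terms that may be neglected against the monomial \<open>m\<close>.  Restricting the degree as well keeps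
  the spread bounded, so that replacing leading monomials terminates.\<close>

definition higher :: "(nat \<Rightarrow>\<^sub>0 nat) \<Rightarrow> rat sf \<Rightarrow> bool" where
  "higher m F \<longleftrightarrow>
     (\<forall>n\<in>Poly_Mapping.keys F. degree_of n = degree_of m \<and> spread m < spread n)"

definition leads :: "(nat \<Rightarrow>\<^sub>0 nat) \<Rightarrow> rat sf \<Rightarrow> bool" where
  "leads m F \<longleftrightarrow> higher m (F - Poly_Mapping.single m 1)"

lemma higher_add: "higher m F \<Longrightarrow> higher m G \<Longrightarrow> higher m (F + G)"
  using keys_add[of F G] unfolding higher_def by blast

lemma higher_sum: "(\<And>x. x \<in> A \<Longrightarrow> higher m (f x)) \<Longrightarrow> higher m (sum f A)"
  by (induction A rule: infinite_finite_induct) (simp_all add: higher_add, simp_all add: higher_def)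

lemma higher_mult_single:
  assumes "higher m F" shows "higher (m + n) (F * Poly_Mapping.single n 1)"
  unfolding higher_def
proof
  fix a assume "a \<in> Poly_Mapping.keys (F * Poly_Mapping.single n 1)"
  then obtain b where "b \<in> Poly_Mapping.keys F" "a = b + n"
    using keys_mult[of F "Poly_Mapping.single n 1"] by auto
  then show "degree_of a = degree_of (m + n) \<and> spread (m + n) < spread a"
    using assms by (simp add: higher_def linear_weight_add)
qed

lemma higher_mult:
  assumes "higher m F" "higher n G" shows "higher (m + n) (F * G)"
  unfolding higher_def
proof
  fix a assume "a \<in> Poly_Mapping.keys (F * G)"
  then obtain b c where "b \<in> Poly_Mapping.keys F" "c \<in> Poly_Mapping.keys G" "a = b + c"
    using keys_mult[of F G] by auto
  then show "degree_of a = degree_of (m + n) \<and> spread (m + n) < spread a"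
    using assms by (fastforce simp: higher_def linear_weight_add)
qed

lemma leads_one: "leads 0 1"
  by (simp add: leads_def higher_def)

lemma leads_mult:
  assumes "leads m F" "leads n G" shows "leads (m + n) (F * G)"
proof -
  define F' G' where "F' = F - Poly_Mapping.single m 1" and "G' = G - Poly_Mapping.single n 1"
  have FG: "F = Poly_Mapping.single m 1 + F'" "G = Poly_Mapping.single n 1 + G'"
    by (simp_all add: F'_def G'_def)
  have "higher m F'" "higher n G'"
    using assms by (simp_all add: leads_def F'_def G'_def)
  moreover have "F * G - Poly_Mapping.single (m + n) 1 =
      F' * Poly_Mapping.single n 1 + (G' * Poly_Mapping.single m 1 + F' * G')"
    by (simp add: FG algebra_simps mult_single)
  ultimately show ?thesis
    unfolding leads_def
    using higher_mult_single[of n G' m]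
    by (simp add: higher_add higher_mult higher_mult_single add.commute)
qed

lemma leads_power: "leads (Poly_Mapping.single l a) F \<Longrightarrow> leads (Poly_Mapping.single l (a * n)) (F ^ n)"
proof (induction n)
  case (Suc n)
  then show ?case using leads_mult[of "Poly_Mapping.single l a" F "Poly_Mapping.single l (a * n)"]
    by (simp flip: single_add)
qed (simp add: leads_one)

lemma leads_prod: "(\<And>x. x \<in> S \<Longrightarrow> leads (m x) (F x)) \<Longrightarrow> leads (sum m S) (prod F S)"
  by (induction S rule: infinite_finite_induct) (simp_all add: leads_one leads_mult)

lemma leads_add_higher: "leads m F \<Longrightarrow> higher m G \<Longrightarrow> leads m (F + G)"
  using higher_add[of m "F - Poly_Mapping.single m 1" G] by (simp add: leads_def algebra_simps)

lemma leads_lookup: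
  assumes "leads m F" "spread n \<le> spread m"
  shows "Poly_Mapping.lookup F n = (if n = m then 1 else 0)"
proof -
  have "n \<notin> Poly_Mapping.keys (F - Poly_Mapping.single m 1)"
    using assms by (auto simp: leads_def higher_def)
  then show ?thesis by (auto simp: in_keys_iff lookup_minus lookup_single when_def split: if_splits)
qed

definition part_monomial :: "ptn \<Rightarrow> (nat \<Rightarrow>\<^sub>0 nat)" where
  "part_monomial p = (\<Sum>x\<leftarrow>p. Poly_Mapping.single x 1)"

lemma part_monomial_Cons [simp]:
  "part_monomial (x # p) = Poly_Mapping.single x 1 + part_monomial p"
  by (simp add: part_monomial_def)

lemma part_monomial_Nil [simp]: "part_monomial [] = 0"
  by (simp add: part_monomial_def)

lemma lookup_part_monomial: "Poly_Mapping.lookup (part_monomial p) x = count_list p x"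
  by (induction p) (auto simp: lookup_add lookup_single when_def)

lemma keys_part_monomial: "Poly_Mapping.keys (part_monomial p) = set p"
  by (auto simp: in_keys_iff lookup_part_monomial count_list_0_iff)

lemma linear_weight_part_monomial:
  "linear_weight c (part_monomial p) = (\<Sum>x\<leftarrow>p. c x)"
  by (induction p) (simp_all add: linear_weight_add)


section \<open>Sums of squares and dominance\<close>

lemma abel_summation_ge:
  fixes a d :: "nat \<Rightarrow> int"
  assumes "\<And>i. Suc i < n \<Longrightarrow> a (Suc i) \<le> a i" "\<And>j. j \<le> n \<Longrightarrow> 0 \<le> (\<Sum>i<j. d i)"
    and "0 < n"
  shows "a (n - 1) * (\<Sum>i<n. d i) \<le> (\<Sum>i<n. a i * d i)"
  using assms
proof (induction n)
  case (Suc n)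
  show ?case
  proof (cases "n = 0")
    case False
    have "a (n - 1) * (\<Sum>i<n. d i) \<le> (\<Sum>i<n. a i * d i)"
      using Suc False by simp
    moreover have "a n * (\<Sum>i<n. d i) \<le> a (n - 1) * (\<Sum>i<n. d i)"
      using Suc.prems(1)[of "n - 1"] Suc.prems(2)[of n] False by (intro mult_right_mono) auto
    ultimately show ?thesis by (simp add: distrib_left)
  qed simp
qed simp

text \<open>Since \<open>(a + d)\<^sup>2 = a\<^sup>2 + 2 a d + d\<^sup>2\<close>, it suffices that the sum of the products \<open>a d\<close> is nonnegative, and
  this follows by summation by parts.\<close>

lemma sum_squares_dominance:
  fixes a d :: "nat \<Rightarrow> int"
  assumes "\<And>i. Suc i < n \<Longrightarrow> a (Suc i) \<le> a i" "\<And>j. j \<le> n \<Longrightarrow> 0 \<le> (\<Sum>i<j. d i)"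
    and "(\<Sum>i<n. d i) = 0" and "i < n" "d i \<noteq> 0"
  shows "(\<Sum>i<n. a i * a i) < (\<Sum>i<n. (a i + d i) * (a i + d i))"
proof -
  have "0 \<le> (\<Sum>i<n. a i * d i)"
    using abel_summation_ge[of n a d] assms by simp
  moreover have "0 < (\<Sum>i<n. d i * d i)"
    using assms(4,5) by (intro sum_pos2[of _ i]) (auto simp: zero_less_mult_iff)
  moreover have "(\<Sum>i<n. (a i + d i) * (a i + d i)) =
      (\<Sum>i<n. a i * a i) + 2 * (\<Sum>i<n. a i * d i) + (\<Sum>i<n. d i * d i)"
    by (simp add: algebra_simps sum.distrib sum_distrib_left)
  ultimately show ?thesis by linarith
qed

lemma sum_ge_initial:
  fixes S :: "nat set"
  assumes "finite S" shows "\<Sum>{..<card S} \<le> \<Sum>S"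
  using assms
proof (induction S rule: finite_linorder_max_induct)
  case (insert b A)
  have "A \<subseteq> {..<b}" using insert by auto
  then have "card A \<le> b" using card_mono[of "{..<b}" A] by simp
  moreover have "b \<notin> A" using insert by auto
  ultimately show ?case using insert by (simp add: lessThan_Suc)
qed simp


section \<open>Jacobi--Trudi determinants\<close>

text \<open>The term of a permutation \<open>\<pi>\<close> is the product of the complete functions with the indices
  \<open>\<lambda>\<^sub>i + \<pi>(i) - i\<close>.  The partial sums of \<open>\<pi>(i) - i\<close> are nonnegative, since the \<open>\<pi>(i)\<close> are distinct natural
  numbers, and thus \<open>sum_squares_dominance\<close> applies unless \<open>\<pi>\<close> is the identity.\<close>

lemma leads_schur:
  assumes p: "is_partition p"
  shows "leads (part_monomial p) (h_coords (schur p))"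
proof -
  let ?n = "length p"
  define X :: "nat \<Rightarrow> nat \<Rightarrow>\<^sub>0 nat" where "X j = (if j = 0 then 0 else Poly_Mapping.single j 1)" for j
  define t :: "(nat \<Rightarrow> nat) \<Rightarrow> rat sf" where
    "t \<pi> = signof \<pi> * (\<Prod>i = 0..<?n. if i \<le> p ! i + \<pi> i
       then Poly_Mapping.single (X (p ! i + \<pi> i - i)) 1 else 0)" for \<pi>
  have h: "h_coords (complete_sf j) = Poly_Mapping.single (X j) 1" for j
    by (simp add: h_coords_complete_sf X_def power_sum_def)
  have "h_coords (schur p) = (\<Sum>\<pi> | \<pi> permutes {0..<?n}. t \<pi>)"
  proof -
    have "signof \<pi> * (\<Prod>i = 0..<?n. mat ?n ?n (\<lambda>(i, j). if i \<le> p ! i + j then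
        Poly_Mapping.single (X (p ! i + j - i)) 1 else 0) $$ (i, \<pi> i)) = t \<pi>"
      if "\<pi> permutes {0..<?n}" for \<pi>
      unfolding t_def using permutes_in_image[OF that]
      by (intro arg_cong2[of _ _ _ _ "(*)"] prod.cong refl) simp
    then show ?thesis
      unfolding hom_schur[OF h_coords_hom] h by (subst det_def'[OF mat_carrier]) simp
  qed
  moreover have "id permutes {0..<?n}" by (rule permutes_id)
  moreover have "finite {\<pi>. \<pi> permutes {0..<?n}}" by (simp add: finite_permutations)
  ultimately have split: "h_coords (schur p) = t id + (\<Sum>\<pi>\<in>{\<pi>. \<pi> permutes {0..<?n}} - {id}. t \<pi>)"
    by (subst (asm) sum.remove[of _ id]) auto
  have prod_single: "(\<Prod>i\<in>S. Poly_Mapping.single (f i) (1::rat)) = Poly_Mapping.single (sum f S) 1"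
    for S :: "nat set" and f :: "nat \<Rightarrow> nat \<Rightarrow>\<^sub>0 nat"
    by (induction S rule: infinite_finite_induct) (simp_all add: mult_single)
  have lw_X: "c 0 = 0 \<Longrightarrow> linear_weight c (X j) = c j" for c j by (simp add: X_def)
  have pm: "(\<Sum>i = 0..<?n. X (p ! i)) = part_monomial p"
  proof -
    have "(\<Sum>i = 0..<?n. X (p ! i)) = (\<Sum>i = 0..<?n. Poly_Mapping.single (p ! i) 1)"
      using p by (intro sum.cong) (auto simp: X_def is_partition_def in_set_conv_nth)
    then show ?thesis by (simp add: part_monomial_def sum_list_sum_nth)
  qed
  have t_id: "t id = Poly_Mapping.single (part_monomial p) 1"
    by (simp add: t_def prod_single pm)
  have "higher (part_monomial p) (t \<pi>)" if \<pi>: "\<pi> permutes {0..<?n}" "\<pi> \<noteq> id" for \<pi>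
  proof (cases "\<forall>i<?n. i \<le> p ! i + \<pi> i")
    case False
    then have "t \<pi> = 0" unfolding t_def by (subst prod_zero) auto
    then show ?thesis by (simp add: higher_def)
  next
    case True
    define m where "m = (\<Sum>i = 0..<?n. X (p ! i + \<pi> i - i))"
    have "t \<pi> = signof \<pi> * Poly_Mapping.single m 1"
      using True by (simp add: t_def m_def flip: prod_single)
    then have keys: "Poly_Mapping.keys (t \<pi>) \<subseteq> {m}"
      by (auto simp: sign_def split: if_splits)
    define a where "a i = int (p ! i)" for i
    define d where "d i = int (\<pi> i) - int i" for i
    have ad: "int (p ! i + \<pi> i - i) = a i + d i" if "i < ?n" for i
      using True that by (simp add: a_def d_def of_nat_diff)
    have total: "(\<Sum>i<?n. d i) = 0"
      using sum.permute[OF \<pi>(1), of int] by (simp add: d_def sum_subtractf atLeast0LessThan)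
    have partial: "0 \<le> (\<Sum>i<j. d i)" for j
    proof -
      have "\<Sum>{..<card (\<pi> ` {..<j})} \<le> \<Sum>(\<pi> ` {..<j})" by (rule sum_ge_initial) simp
      moreover have "inj_on \<pi> {..<j}" using permutes_inj[OF \<pi>(1)] by (rule inj_on_subset) simp
      ultimately have "(\<Sum>i<j. i) \<le> (\<Sum>i<j. \<pi> i)"
        by (simp add: card_image sum.reindex)
      then have "int (\<Sum>i<j. i) \<le> int (\<Sum>i<j. \<pi> i)" by (simp only: of_nat_le_iff)
      then show ?thesis by (simp add: d_def sum_subtractf)
    qed
    obtain i where i: "\<pi> i \<noteq> i" using \<pi>(2) by (auto simp: fun_eq_iff)
    then have "i < ?n" using \<pi>(1) by (auto simp: permutes_def)
    have anti: "a (Suc i) \<le> a i" if "Suc i < ?n" for i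
      using p that by (auto simp: a_def is_partition_def sorted_wrt_iff_nth_less)
    have "(\<Sum>i<?n. a i * a i) < (\<Sum>i<?n. (a i + d i) * (a i + d i))"
      by (rule sum_squares_dominance[of ?n a d i]) (use anti partial total \<open>i < ?n\<close> i in \<open>auto simp: d_def\<close>)
    also have "(\<Sum>i<?n. (a i + d i) * (a i + d i)) =
        (\<Sum>i<?n. int ((p ! i + \<pi> i - i) * (p ! i + \<pi> i - i)))"
      by (intro sum.cong) (auto simp only: of_nat_mult ad)
    also have "\<dots> = int (spread m)"
      by (simp add: m_def linear_weight_sum lw_X atLeast0LessThan)
    also have "(\<Sum>i<?n. a i * a i) = int (spread (part_monomial p))"
      by (simp add: a_def linear_weight_sum lw_X atLeast0LessThan flip: pm)
    finally have "spread (part_monomial p) < spread m" by simp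
    have "int (degree_of m) = (\<Sum>i<?n. int (p ! i + \<pi> i - i))"
      by (simp add: m_def linear_weight_sum lw_X atLeast0LessThan)
    also have "\<dots> = (\<Sum>i<?n. a i + d i)" by (intro sum.cong) (simp_all add: ad)
    also have "\<dots> = int (degree_of (part_monomial p))"
      using total by (simp add: sum.distrib a_def linear_weight_sum lw_X atLeast0LessThan flip: pm)
    finally show ?thesis using keys \<open>spread _ < spread _\<close> by (auto simp: higher_def)
  qed
  then have "higher (part_monomial p) (\<Sum>\<pi>\<in>{\<pi>. \<pi> permutes {0..<?n}} - {id}. t \<pi>)"
    by (intro higher_sum) auto
  then show ?thesis by (simp add: leads_def split t_id)
qed

section \<open>A unitriangular basis\<close>

lemma sf_scale_mult_right: "f * sf_scale c g = sf_scale c (f * g)"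
  by (simp add: sf_scale_def mult_ac)

lemma span_mult_right:
  assumes "\<And>b. b \<in> B \<Longrightarrow> f * b \<in> sf.span C" and "g \<in> sf.span B"
  shows "f * g \<in> sf.span C"
  using assms(2)
proof (induction rule: sf.span_induct_alt)
  case (step c x y)
  then show ?case
    using assms(1) by (simp add: distrib_left sf_scale_mult_right sf.span_add sf.span_scale)
qed (simp add: sf.span_zero)

lemma h_coords_scale: "h_coords (sf_scale c f) = sf_scale c (h_coords f)"
  by (simp only: sf_scale_def h_coords.hom_mult h_coords_const)

lemma lookup_sf_scale: "Poly_Mapping.lookup (sf_scale c f) m = c * Poly_Mapping.lookup f m"
  by (simp add: sf_scale_def sf_const_def flip: mult_map_scale_conv_mult)
    (simp add: Poly_Mapping.map.rep_eq when_def)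

text \<open>A linear relation is refuted at an index of minimal spread among those with a nonzero
  coefficient: no other term of the relation contains the monomial of that index.\<close>

lemma unitriangular_independent:
  assumes G: "\<And>m. m \<in> M \<Longrightarrow> leads m (h_coords (G m))"
  shows "sf.independent (G ` M)" and "inj_on G M"
proof -
  show "inj_on G M"
  proof (rule inj_onI, rule ccontr)
    fix m n assume mn: "m \<in> M" "n \<in> M" "G m = G n" "m \<noteq> n"
    then have "leads m (h_coords (G m))" "leads n (h_coords (G m))" using G[of m] G[of n] by simp_all
    then have "Poly_Mapping.lookup (h_coords (G m)) m = 1" "Poly_Mapping.lookup (h_coords (G m)) n = 1"
      by (simp_all add: leads_lookup)
    moreover have "Poly_Mapping.lookup (h_coords (G m)) n = 0 \<or> Poly_Mapping.lookup (h_coords (G m)) m = 0"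
    proof (cases "spread n \<le> spread m")
      case True
      show ?thesis
        using leads_lookup[OF \<open>leads m _\<close> True] mn(4) by simp
    next
      case False
      show ?thesis
        using leads_lookup[OF \<open>leads n _\<close>, of m] False mn(4) by simp
    qed
    ultimately show False by simp
  qed
  show "sf.independent (G ` M)"
  proof
    assume "sf.dependent (G ` M)"
    then obtain S u where S: "finite S" "S \<subseteq> G ` M" and sum0: "(\<Sum>v\<in>S. sf_scale (u v) v) = 0"
      and ex: "\<exists>v\<in>S. u v \<noteq> 0"
      unfolding sf.dependent_explicit by blast
    define idx where "idx = inv_into M G"
    have idx: "idx v \<in> M" "G (idx v) = v" if "v \<in> S" for v
      using that S(2) by (auto simp: idx_def inv_into_into f_inv_into_f)
    let ?S = "{v \<in> S. u v \<noteq> 0}"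
    obtain v0 where v0: "v0 \<in> ?S" and min: "\<And>v. v \<in> ?S \<Longrightarrow> spread (idx v0) \<le> spread (idx v)"
    proof -
      have "finite ?S" "?S \<noteq> {}" using S(1) ex by auto
      from ex_is_arg_min_if_finite[OF this, of "\<lambda>v. spread (idx v)"]
      show ?thesis using that unfolding is_arg_min_linorder by (elim exE conjE) simp
    qed
    have "0 = Poly_Mapping.lookup (h_coords (\<Sum>v\<in>S. sf_scale (u v) v)) (idx v0)"
      by (simp add: sum0)
    also have "\<dots> = (\<Sum>v\<in>S. u v * Poly_Mapping.lookup (h_coords v) (idx v0))"
      by (simp add: h_coords.hom_sum h_coords_scale lookup_sum lookup_sf_scale)
    also have "\<dots> = (\<Sum>v\<in>S. if v = v0 then u v0 else 0)"
    proof (intro sum.cong refl)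
      fix v assume v: "v \<in> S"
      show "u v * Poly_Mapping.lookup (h_coords v) (idx v0) = (if v = v0 then u v0 else 0)"
      proof (cases "u v = 0")
        case False
        then have "spread (idx v0) \<le> spread (idx v)" using v min by blast
        moreover have "leads (idx v) (h_coords v)" using G[OF idx(1)[OF v]] idx(2)[OF v] by simp
        moreover have "idx v0 = idx v \<longleftrightarrow> v = v0"
    
        proof
          assume "idx v0 = idx v"
          then have "G (idx v0) = G (idx v)" by (rule arg_cong)
          then show "v = v0" using idx(2)[OF v] idx(2)[of v0] v0 by simp
        qed simp
        ultimately show ?thesis by (simp add: leads_lookup)
      qed (use v0 in auto)
    qed
    also have "\<dots> = u v0" using S(1) v0 by simp
    finally show False using v0 by simp
  qed
qed

lemma spread_le: "Poly_Mapping.keys m \<subseteq> {0<..k} \<Longrightarrow> spread m \<le> k * degree_of m"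
  unfolding linear_weight_def sum_distrib_left
  by (intro sum_mono) (auto simp: mult.assoc[symmetric])

text \<open>A monomial is the member of the family that it leads, up to monomials of the same degree and of larger
  spread.  As the spread is bounded in terms of the degree, this can be iterated.\<close>

lemma unitriangular_span:
  assumes G: "\<And>m. Poly_Mapping.keys m \<subseteq> {0<..k} \<Longrightarrow> leads m (h_coords (G m))"
    and V1: "\<And>m. Poly_Mapping.keys m \<subseteq> {0<..k} \<Longrightarrow> G m \<in> carrier (V1 k)"
  shows "sf.span (G ` {m. Poly_Mapping.keys m \<subseteq> {0<..k}}) = carrier (V1 k)"
proof
  let ?M = "{m. Poly_Mapping.keys m \<subseteq> {0<..k}}"
  have sub: "sf.subspace (carrier (V1 k))"
    by (intro sf.subspaceI V1_0 V1_add V1_scale)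
  show "sf.span (G ` ?M) \<subseteq> carrier (V1 k)"
    by (rule sf.span_minimal[OF _ sub]) (use V1 in auto)
  have subst: "h_subst F = (\<Sum>m\<in>Poly_Mapping.keys F.
      sf_scale (Poly_Mapping.lookup F m) (mono_eval complete_sf m))" for F
    by (simp add: h_subst_def poly_eval_def sf_scale_def)
  have mono: "mono_eval complete_sf m \<in> sf.span (G ` ?M)" if "Poly_Mapping.keys m \<subseteq> {0<..k}" for m
    using that
  proof (induction m rule: measure_induct_rule[where f="\<lambda>m. k * degree_of m - spread m"])
    case (less m)
    define F where "F = h_coords (G m) - Poly_Mapping.single m 1"
    have "h_coords (G m) \<in> supported {0<..k}" using V1_h_coords V1[OF less.prems] .
    moreover have "Poly_Mapping.single m (1::rat) \<in> supported {0<..k}"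
      using less.prems by (simp add: supported_def)
    ultimately have "F \<in> supported {0<..k}"
      unfolding F_def by (rule supported_diff)
    moreover have hi: "higher m F" using G[OF less.prems] by (simp add: leads_def F_def)
    ultimately have "h_subst F \<in> sf.span (G ` ?M)"
      unfolding subst
    proof (intro sf.span_sum sf.span_scale less.IH)
      fix n assume n: "n \<in> Poly_Mapping.keys F"
      have nk: "Poly_Mapping.keys n \<subseteq> {0<..k}"
        using n \<open>F \<in> supported _\<close> by (simp add: supported_def)
      then show "Poly_Mapping.keys n \<subseteq> {0<..k}" .
      show "k * degree_of n - spread n < k * degree_of m - spread m"
        using n hi spread_le[OF nk] by (auto simp: higher_def)
    qed
    moreover have eqF: "h_subst F = G m - mono_eval complete_sf m"
    proof -
      have "h_subst (Poly_Mapping.single m 1) = mono_eval complete_sf m"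
        by (simp add: h_subst_def poly_eval_single[OF sf_const_hom])
      then show ?thesis
        using h_subst_h_coords[OF V1[OF less.prems]] by (simp add: F_def h_subst.hom_minus)
    qed
    moreover have "G m \<in> sf.span (G ` ?M)" using less.prems by (intro sf.span_base) auto
    ultimately have "G m - h_subst F \<in> sf.span (G ` ?M)"
      by (intro sf.span_diff)
    then show ?case using eqF by simp
  qed
  show "carrier (V1 k) \<subseteq> sf.span (G ` ?M)"
  proof
    fix f assume f: "f \<in> carrier (V1 k)"
    have "h_subst (h_coords f) \<in> sf.span (G ` ?M)"
      unfolding subst using V1_h_coords[OF f]
      by (intro sf.span_sum sf.span_scale mono) (auto simp: supported_def)
    then show "f \<in> sf.span (G ` ?M)" by (simp add: h_subst_h_coords[OF f])
  qed
qed

lemma part_monomial_inj: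
  assumes "is_partition p" "is_partition q" "part_monomial p = part_monomial q"
  shows "p = q"
proof -
  have "count_list p x = count_list q x" for x
    using assms(3) by (simp flip: lookup_part_monomial)
  then have "mset p = mset q" by (intro multiset_eqI) (simp add: count_mset)
  then have "mset (rev p) = mset (rev q)" by simp
  moreover have "sorted (rev p)" "sorted (rev q)"
    using assms by (simp_all add: is_partition_def sorted_wrt_rev)
  ultimately have "rev p = rev q" by (metis properties_for_sort)
  then show ?thesis by simp
qed

text \<open>The partition whose multiplicities are the exponents of \<open>m\<close>.\<close>

definition monomial_part :: "nat \<Rightarrow> (nat \<Rightarrow>\<^sub>0 nat) \<Rightarrow> ptn" where
  "monomial_part k m = concat (map (\<lambda>l. replicate (Poly_Mapping.lookup m l) l) (rev [1..<Suc k]))"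

lemma bounded_monomial_part: "bounded_partition k (monomial_part k m)"
proof (induction k)
  case (Suc k)
  have *: "sorted_wrt (\<ge>) (replicate n x)" for n and x :: nat
    by (induction n) auto
  from Suc show ?case
    by (auto simp: bounded_partition_def is_partition_def monomial_part_def sorted_wrt_append *
        intro: le_SucI)
qed (simp add: bounded_partition_def is_partition_def monomial_part_def)

lemma part_monomial_monomial_part:
  assumes "Poly_Mapping.keys m \<subseteq> {0<..k}"
  shows "part_monomial (monomial_part k m) = m"
proof (rule poly_mapping_eqI)
  fix x
  have "count_list (replicate n l) x = (if l = x then n else 0)" for n l :: nat
    by (induction n) auto
  then have "count_list (monomial_part k m) x = (if 0 < x \<and> x \<le> k then Poly_Mapping.lookup m x else 0)"
    unfolding monomial_part_def by (induction k) (auto simp: less_Suc_eq_le le_Suc_eq)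
  then show "Poly_Mapping.lookup (part_monomial (monomial_part k m)) x = Poly_Mapping.lookup m x"
    using assms by (auto simp: lookup_part_monomial in_keys_iff)
qed

lemma monomial_part_part_monomial:
  assumes "bounded_partition k p" shows "monomial_part k (part_monomial p) = p"
proof (rule part_monomial_inj)
  have "Poly_Mapping.keys (part_monomial p) \<subseteq> {0<..k}"
    using assms by (auto simp: keys_part_monomial bounded_partition_def is_partition_def intro!: gr0I)
  then show "part_monomial (monomial_part k (part_monomial p)) = part_monomial p"
    by (rule part_monomial_monomial_part)
qed (use assms bounded_monomial_part in \<open>auto simp: bounded_partition_def\<close>)

lemma irreducible_iff:
  "irreducible_partition k p \<longleftrightarrow> bounded_partition k p \<and>
     (\<forall>l\<in>{0<..k}. Poly_Mapping.lookup (part_monomial p) l < Suc k - l)"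
proof -
  have "(\<forall>i<k. count_list p (k - i) \<le> i) \<longleftrightarrow> (\<forall>l\<in>{0<..k}. count_list p l < Suc k - l)"
  proof safe
    fix l assume "\<forall>i<k. count_list p (k - i) \<le> i" "l \<in> {0<..k}"
    from this(1)[rule_format, of "k - l"] this(2) show "count_list p l < Suc k - l" by auto
  next
    fix i assume "\<forall>l\<in>{0<..k}. count_list p l < Suc k - l" "i < k"
    from this(1)[rule_format, of "k - i"] this(2) show "count_list p (k - i) \<le> i" by auto
  qed
  then show ?thesis by (simp add: irreducible_partition_def lookup_part_monomial)
qed

lemma finite_irreducible: "finite {p. irreducible_partition k p}"
proof (rule finite_subset)
  show "finite {p :: ptn. set p \<subseteq> {0<..k} \<and> length p \<le> k * (k + 1)}"
    by (rule finite_lists_length_le) simp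
  show "{p. irreducible_partition k p} \<subseteq> {p. set p \<subseteq> {0<..k} \<and> length p \<le> k * (k + 1)}"
  proof safe
    fix p assume p: "irreducible_partition k p"
    then have set: "set p \<subseteq> {0<..k}"
      by (auto simp: irreducible_iff bounded_partition_def is_partition_def intro!: gr0I)
    then show "x \<in> {0<..k}" if "x \<in> set p" for x using that by blast
    have "length p = (\<Sum>x\<in>{0<..k}. count_list p x)" using set by (simp add: sum_count_set)
    also have "\<dots> \<le> (\<Sum>x\<in>{0<..k}. k + 1)"
    proof (rule sum_mono)
      fix x assume "x \<in> {0<..k}"
      then have "count_list p x < Suc k - x"
        using p unfolding irreducible_iff lookup_part_monomial by blast
      then show "count_list p x \<le> k + 1" by simp
    qed
    finally show "length p \<le> k * (k + 1)" by simp
  qed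
qed

section \<open>The quotient by the rectangular Schur functions\<close>

lemma is_partition_replicate: "0 < x \<Longrightarrow> is_partition (replicate n x)"
  by (induction n) (auto simp: is_partition_def)

lemma V1_schur_replicate: "l \<le> k \<Longrightarrow> schur (replicate (Suc k - l) l) \<in> carrier (V1 k)"
proof -
  assume l: "l \<le> k"
  let ?p = "replicate (Suc k - l) l" and ?n = "Suc k - l"
  have sign: "signof \<pi> \<in> carrier (V1 k)" for \<pi> :: "nat \<Rightarrow> nat"
    by (simp add: sign_def V1_1 V1_uminus)
  have "signof \<pi> * (\<Prod>i = 0..<?n. mat ?n ?n (\<lambda>(i, j). if i \<le> ?p ! i + j
        then complete_sf (?p ! i + j - i) else 0) $$ (i, \<pi> i)) \<in> carrier (V1 k)"
    if "\<pi> permutes {0..<?n}" for \<pi>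
  proof (intro V1_mult sign V1_prod)
    fix i assume "i \<in> {0..<?n}"
    moreover from this have "\<pi> i < ?n" using permutes_in_image[OF that, of i] by simp
    ultimately show "mat ?n ?n (\<lambda>(i, j). if i \<le> ?p ! i + j
        then complete_sf (?p ! i + j - i) else 0) $$ (i, \<pi> i) \<in> carrier (V1 k)"
      using l by (auto intro!: V1_complete_sf simp: V1_0)
  qed
  then show ?thesis
    unfolding schur_def length_replicate
    by (subst det_def'[OF mat_carrier]) (intro V1_sum, simp)
qed

lemma cring_V1: "cring (V1 k)"
proof (rule cringI)
  show "abelian_group (V1 k)"
  proof (rule abelian_groupI)
    fix x assume "x \<in> carrier (V1 k)"
    then show "\<exists>y\<in>carrier (V1 k). y \<oplus>\<^bsub>V1 k\<^esub> x = \<zero>\<^bsub>V1 k\<^esub>"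
      by (intro bexI[of _ "- x"]) (simp_all add: V1_uminus)
  qed (simp_all add: V1_0 V1_add add_ac)
  show "Group.comm_monoid (V1 k)"
    by (rule comm_monoidI) (simp_all add: V1_1 V1_mult mult_ac)
qed (simp add: distrib_right)

lemma V1_a_minus:
  assumes "f \<in> carrier (V1 k)" "g \<in> carrier (V1 k)"
  shows "f \<ominus>\<^bsub>V1 k\<^esub> g = f - g"
proof -
  interpret cring "V1 k" by (rule cring_V1)
  have "\<ominus>\<^bsub>V1 k\<^esub> g = - g"
    using minus_equality[of "- g" g] assms by (simp add: V1_uminus)
  then show ?thesis by (simp add: a_minus_def)
qed

text \<open>What the structure of the quotient ring depends on: membership in the ring, and unitriangularity
  with respect to the monomials in the complete functions.\<close>

locale unitriangular_family =
  fixes k :: nat and A :: "ptn \<Rightarrow> rat sf"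
  assumes A_V1: "bounded_partition k p \<Longrightarrow> A p \<in> carrier (V1 k)"
    and A_leads: "bounded_partition k p \<Longrightarrow> leads (part_monomial p) (h_coords (A p))"
begin

abbreviation rect :: "nat \<Rightarrow> rat sf" where
  "rect l \<equiv> schur (replicate (Suc k - l) l)"

definition residue :: "(nat \<Rightarrow>\<^sub>0 nat) \<Rightarrow> (nat \<Rightarrow>\<^sub>0 nat)" where
  "residue m = (\<Sum>l\<in>{0<..k}. Poly_Mapping.single l (Poly_Mapping.lookup m l mod (Suc k - l)))"

text \<open>The exponents of \<open>m\<close> are divided by those of the leading monomials of the \<open>rect l\<close>.  The remainders form
  an irreducible monomial, and the quotients are the exponents of the \<open>rect l\<close>.\<close>

definition rect_basis :: "(nat \<Rightarrow>\<^sub>0 nat) \<Rightarrow> rat sf" where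
  "rect_basis m = (\<Prod>l\<in>{0<..k}. rect l ^ (Poly_Mapping.lookup m l div (Suc k - l))) *
     A (monomial_part k (residue m))"

definition monomials :: "(nat \<Rightarrow>\<^sub>0 nat) set" where
  "monomials = {m. Poly_Mapping.keys m \<subseteq> {0<..k}}"

definition reducible :: "(nat \<Rightarrow>\<^sub>0 nat) set" where
  "reducible = {m \<in> monomials. \<exists>l\<in>{0<..k}. Suc k - l \<le> Poly_Mapping.lookup m l}"

lemma lookup_sum_singles:
  "Poly_Mapping.lookup (\<Sum>l\<in>{0<..k}. Poly_Mapping.single l (f l)) x =
     (if x \<in> {0<..k} then f x else (0::nat))"
  by (simp add: lookup_sum lookup_single when_def)

lemma lookup_residue:
  "Poly_Mapping.lookup (residue m) x =
     (if x \<in> {0<..k} then Poly_Mapping.lookup m x mod (Suc k - x) else 0)"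
  unfolding residue_def by (rule lookup_sum_singles)

lemma keys_residue: "Poly_Mapping.keys (residue m) \<subseteq> {0<..k}"
  by (auto simp: in_keys_iff lookup_residue split: if_splits)

lemma rect_V1: "l \<in> {0<..k} \<Longrightarrow> rect l \<in> carrier (V1 k)"
  by (rule V1_schur_replicate) simp

lemma rect_leads:
  assumes "l \<in> {0<..k}"
  shows "leads (Poly_Mapping.single l (Suc k - l)) (h_coords (rect l))"
proof -
  have "part_monomial (replicate n l) = Poly_Mapping.single l n" for n
    by (induction n) (simp_all flip: single_add)
  then show ?thesis
    using leads_schur[of "replicate (Suc k - l) l"] is_partition_replicate[of l "Suc k - l"] assms
    by simp
qed

lemma rect_basis_V1: "rect_basis m \<in> carrier (V1 k)"
  unfolding rect_basis_def
  by (intro V1_mult V1_prod V1_power rect_V1 A_V1 bounded_monomial_part)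

lemma rect_basis_leads:
  assumes "m \<in> monomials" shows "leads m (h_coords (rect_basis m))"
proof -
  let ?q = "\<lambda>l. Poly_Mapping.single l ((Suc k - l) * (Poly_Mapping.lookup m l div (Suc k - l)))"
  have "leads (sum ?q {0<..k}) (\<Prod>l\<in>{0<..k}. h_coords (rect l) ^ (Poly_Mapping.lookup m l div (Suc k - l)))"
    by (intro leads_prod leads_power rect_leads)
  moreover have "leads (residue m) (h_coords (A (monomial_part k (residue m))))"
    using A_leads[OF bounded_monomial_part, of "residue m"]
    by (simp add: part_monomial_monomial_part[OF keys_residue])
  ultimately have "leads (sum ?q {0<..k} + residue m) (h_coords (rect_basis m))"
    unfolding rect_basis_def h_coords.hom_mult h_coords.hom_prod h_coords.hom_power
    by (rule leads_mult)
  moreover have "sum ?q {0<..k} + residue m = m"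
  proof (rule poly_mapping_eqI)
    fix x
    show "Poly_Mapping.lookup (sum ?q {0<..k} + residue m) x = Poly_Mapping.lookup m x"
    proof (cases "x \<in> {0<..k}")
      case True
      then show ?thesis by (simp only: lookup_add lookup_sum_singles lookup_residue if_True mult_div_mod_eq)
    next
      case False
      then have "x \<notin> Poly_Mapping.keys m" using assms unfolding monomials_def by blast
      then show ?thesis using False by (simp only: lookup_add lookup_sum_singles lookup_residue in_keys_iff if_False not_not add_0_right)
    qed
  qed
  ultimately show ?thesis by simp
qed

lemma rect_mult_rect_basis:
  assumes l: "l \<in> {0<..k}"
  shows "rect l * rect_basis m = rect_basis (m + Poly_Mapping.single l (Suc k - l))"
proof -
  let ?m = "m + Poly_Mapping.single l (Suc k - l)"
  have pos: "0 < Suc k - l" using l by simp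
  have lm: "Poly_Mapping.lookup ?m x =
      (if x = l then Poly_Mapping.lookup m l + (Suc k - l) else Poly_Mapping.lookup m x)" for x
    by (simp add: lookup_add lookup_single when_def)
  have "residue ?m = residue m"
    by (intro poly_mapping_eqI) (auto simp only: lookup_residue lm mod_add_self2 split: if_splits)
  moreover have "(\<Prod>x\<in>{0<..k}. rect x ^ (Poly_Mapping.lookup ?m x div (Suc k - x))) =
      rect l * (\<Prod>x\<in>{0<..k}. rect x ^ (Poly_Mapping.lookup m x div (Suc k - x)))"
  proof -
    have "(\<Prod>x\<in>{0<..k} - {l}. rect x ^ (Poly_Mapping.lookup ?m x div (Suc k - x))) =
        (\<Prod>x\<in>{0<..k} - {l}. rect x ^ (Poly_Mapping.lookup m x div (Suc k - x)))"
      by (intro prod.cong) (simp_all add: lm)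
    moreover have "Poly_Mapping.lookup ?m l div (Suc k - l) = Suc (Poly_Mapping.lookup m l div (Suc k - l))"
    proof -
      have "(a + b) div b = Suc (a div b)" if "0 < b" for a b :: nat using that by simp
      then show ?thesis using pos by (simp only: lm simp_thms if_True)
    qed
    ultimately show ?thesis
      using l by (simp only: prod.remove[OF finite_greaterThanAtMost l] power_Suc mult.assoc)
  qed
  ultimately show ?thesis by (simp only: rect_basis_def mult.assoc)
qed

lemma rect_basis_irreducible:
  assumes "irreducible_partition k p" shows "rect_basis (part_monomial p) = A p"
proof -
  have p: "bounded_partition k p"
    "\<And>l. l \<in> {0<..k} \<Longrightarrow> Poly_Mapping.lookup (part_monomial p) l < Suc k - l"
    using assms unfolding irreducible_iff by blast+
  have keys: "Poly_Mapping.keys (part_monomial p) \<subseteq> {0<..k}"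
    using p(1) by (auto simp: keys_part_monomial bounded_partition_def is_partition_def intro!: gr0I)
  have "residue (part_monomial p) = part_monomial p"
  proof (rule poly_mapping_eqI)
    fix x
    show "Poly_Mapping.lookup (residue (part_monomial p)) x = Poly_Mapping.lookup (part_monomial p) x"
    proof (cases "x \<in> {0<..k}")
      case True
      then show ?thesis using p(2)[OF True] by (simp only: lookup_residue if_True mod_less)
    next
      case False
      then have "x \<notin> Poly_Mapping.keys (part_monomial p)" using keys by blast
      then show ?thesis using False by (simp only: lookup_residue in_keys_iff if_False not_not add_0_right)
    qed
  qed
  moreover have "(\<Prod>l\<in>{0<..k}. rect l ^ (Poly_Mapping.lookup (part_monomial p) l div (Suc k - l))) = 1"
    using p(2) by (intro prod.neutral ballI) (simp only: div_less power_0)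
  ultimately show ?thesis
    by (simp add: rect_basis_def monomial_part_part_monomial[OF p(1)])
qed

lemma monomials_split:
  "monomials = reducible \<union> part_monomial ` {p. irreducible_partition k p}"
proof (intro equalityI subsetI)
  fix m assume m: "m \<in> monomials"
  show "m \<in> reducible \<union> part_monomial ` {p. irreducible_partition k p}"
  proof (cases "m \<in> reducible")
    case False
    have eq: "part_monomial (monomial_part k m) = m"
      using m by (intro part_monomial_monomial_part) (simp add: monomials_def)
    have "irreducible_partition k (monomial_part k m)"
      unfolding irreducible_iff eq using False m bounded_monomial_part
      by (auto simp: reducible_def not_le)
    then show ?thesis using eq by (metis UnI2 imageI mem_Collect_eq)
  qed simp
next
  fix m assume "m \<in> reducible \<union> part_monomial ` {p. irreducible_partition k p}"
  then show "m \<in> monomials"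
    by (auto simp: reducible_def monomials_def irreducible_iff keys_part_monomial
        bounded_partition_def is_partition_def intro!: gr0I)
qed

lemma part_monomial_not_reducible:
  "irreducible_partition k p \<Longrightarrow> part_monomial p \<notin> reducible"
  by (auto simp: reducible_def irreducible_iff)

lemma span_monomials: "sf.span (rect_basis ` monomials) = carrier (V1 k)"
  unfolding monomials_def
  by (rule unitriangular_span) (use rect_basis_leads rect_basis_V1 in \<open>simp_all add: monomials_def\<close>)

lemma independent_monomials: "sf.independent (rect_basis ` monomials)"
  and inj_monomials: "inj_on rect_basis monomials"
  using unitriangular_independent[of monomials rect_basis] rect_basis_leads by blast+

text \<open>The ideal generated by the rectangles, as a vector space.\<close>

definition ideal_span :: "rat sf set" where
  "ideal_span = sf.span (rect_basis ` reducible)"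

text \<open>Multiplication by \<open>rect l\<close> maps the basis into itself, and into its reducible part.\<close>

lemma rect_mult_ideal_span:
  assumes l: "l \<in> {0<..k}" and f: "f \<in> carrier (V1 k)"
  shows "rect l * f \<in> ideal_span"
  unfolding ideal_span_def
proof (rule span_mult_right)
  show "f \<in> sf.span (rect_basis ` monomials)" using f by (simp only: span_monomials)
  fix b assume "b \<in> rect_basis ` monomials"
  then obtain m where m: "m \<in> monomials" "b = rect_basis m" by blast
  have "m + Poly_Mapping.single l (Suc k - l) \<in> reducible"
  proof -
    have "Poly_Mapping.keys (m + Poly_Mapping.single l (Suc k - l)) \<subseteq> {0<..k}"
      using keys_add[of m "Poly_Mapping.single l (Suc k - l)"] m(1) l
      by (auto simp: monomials_def split: if_splits)
    then show ?thesis
      using l by (auto simp: reducible_def monomials_def lookup_add intro!: bexI[of _ l])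
  qed
  then show "rect l * b \<in> sf.span (rect_basis ` reducible)"
    unfolding m(2) rect_mult_rect_basis[OF l] by (intro sf.span_base imageI)
qed

lemma reducible_factor:
  assumes "m \<in> reducible"
  obtains l n where "l \<in> {0<..k}" "n \<in> monomials" "rect_basis m = rect l * rect_basis n"
proof -
  from assms obtain l where l: "l \<in> {0<..k}" "Suc k - l \<le> Poly_Mapping.lookup m l" "m \<in> monomials"
    by (auto simp: reducible_def)
  define n where "n = m - Poly_Mapping.single l (Suc k - l)"
  have "m = n + Poly_Mapping.single l (Suc k - l)"
    using l(2) by (intro poly_mapping_eqI) (auto simp: n_def lookup_add lookup_minus lookup_single when_def)
  moreover have "n \<in> monomials"
    using l(3) keys_diff[of m] by (auto simp: n_def monomials_def in_keys_iff lookup_minus)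
  ultimately show ?thesis using that[of l n] rect_mult_rect_basis[OF l(1)] l(1) by simp
qed

lemma ideal_span_V1: "ideal_span \<subseteq> carrier (V1 k)"
  unfolding ideal_span_def span_monomials[symmetric]
  by (intro sf.span_mono image_mono) (auto simp: reducible_def)

lemma ideal_span_mult:
  assumes f: "f \<in> carrier (V1 k)" and g: "g \<in> ideal_span"
  shows "f * g \<in> ideal_span"
  unfolding ideal_span_def
proof (rule span_mult_right)
  show "g \<in> sf.span (rect_basis ` reducible)" using g by (simp add: ideal_span_def)
  fix b assume "b \<in> rect_basis ` reducible"
  then obtain m where "m \<in> reducible" "b = rect_basis m" by blast
  then obtain l n where ln: "l \<in> {0<..k}" "b = rect l * rect_basis n"
    using reducible_factor by metis
  have "rect l * (f * rect_basis n) \<in> ideal_span"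
    by (intro rect_mult_ideal_span ln(1) V1_mult f rect_basis_V1)
  then show "f * b \<in> sf.span (rect_basis ` reducible)"
    by (simp add: ln(2) ideal_span_def mult_ac)
qed

lemma ideal_ideal_span: "ideal ideal_span (V1 k)"
proof (rule idealI)
  interpret cring "V1 k" by (rule cring_V1)
  show "ring (V1 k)" by (rule ring_axioms)
  have inv: "inv\<^bsub>add_monoid (V1 k)\<^esub> f = - f" if "f \<in> carrier (V1 k)" for f
  proof -
    have "\<ominus>\<^bsub>V1 k\<^esub> f = - f"
      using minus_equality[of "- f" f] that by (simp add: V1_uminus)
    then show ?thesis by (simp add: a_inv_def)
  qed
  show "subgroup ideal_span (add_monoid (V1 k))"
  proof
    show "ideal_span \<subseteq> carrier (add_monoid (V1 k))" using ideal_span_V1 by simp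
    fix f assume f: "f \<in> ideal_span"
    then show "inv\<^bsub>add_monoid (V1 k)\<^esub> f \<in> ideal_span"
      using inv[of f] ideal_span_V1 sf.span_neg[of f] by (auto simp: ideal_span_def)
  qed (simp_all add: ideal_span_def sf.span_add sf.span_zero)
  show "f \<otimes>\<^bsub>V1 k\<^esub> g \<in> ideal_span" if "g \<in> ideal_span" "f \<in> carrier (V1 k)" for f g
    using ideal_span_mult[OF that(2,1)] by simp
  show "g \<otimes>\<^bsub>V1 k\<^esub> f \<in> ideal_span" if "g \<in> ideal_span" "f \<in> carrier (V1 k)" for f g
    using ideal_span_mult[OF that(2,1)] by (simp add: mult.commute)
qed

text \<open>Each reducible basis element is a multiple of some \<open>rect l\<close>, and conversely a product of \<open>rect l\<close> with a
  basis element is a reducible basis element.\<close>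

lemma rect_ideal_eq: "rect_ideal k = ideal_span"
proof
  interpret cring "V1 k" by (rule cring_V1)
  have k: "{1..k} = {0<..k}" by auto
  show "rect_ideal k \<subseteq> ideal_span"
    unfolding rect_ideal_def k Suc_eq_plus1[symmetric]
  proof (rule genideal_minimal[OF ideal_ideal_span])
    show "rect ` {0<..k} \<subseteq> ideal_span"
      using rect_mult_ideal_span[OF _ V1_1] by auto
  qed
  show "ideal_span \<subseteq> rect_ideal k"
    unfolding rect_ideal_def k genideal_def Suc_eq_plus1[symmetric]
  proof (rule Inter_greatest, safe)
    fix I f assume I: "ideal I (V1 k)" "rect ` {0<..k} \<subseteq> I" and f: "f \<in> ideal_span"
    interpret I: ideal I "V1 k" by (rule I(1))
    have mult: "g * h \<in> I" if "g \<in> I" "h \<in> carrier (V1 k)" for g h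
      using I.I_r_closed[OF that] by simp
    have sub: "sf.subspace I"
    proof (rule sf.subspaceI)
      show "0 \<in> I" using I.zero_closed by simp
      show "x + y \<in> I" if "x \<in> I" "y \<in> I" for x y using I.a_closed[OF that] by simp
      show "sf_scale c x \<in> I" if "x \<in> I" for c x
        using mult[OF that V1_const[of c k]] by (simp add: sf_scale_def mult.commute)
    qed
    have "rect_basis ` reducible \<subseteq> I"
    proof
      fix b assume "b \<in> rect_basis ` reducible"
      then obtain m where "m \<in> reducible" "b = rect_basis m" by blast
      then obtain l n where "l \<in> {0<..k}" "b = rect l * rect_basis n"
        using reducible_factor by metis
      moreover from this have "rect l \<in> I" using I(2) by blast
      ultimately show "b \<in> I" using mult[OF _ rect_basis_V1] by simp
    qed
    then show "f \<in> I" using f sf.span_minimal[OF _ sub] unfolding ideal_span_def by blast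
  qed
qed

theorem ring_basis_irreducible:
  "ring_basis (quotient_ring k) (residue_class k ` range sf_const)
     (\<lambda>p. residue_class k (A p)) {p. irreducible_partition k p}"
proof -
  interpret V: cring "V1 k" by (rule cring_V1)
  interpret I: ideal ideal_span "V1 k" by (rule ideal_ideal_span)
  define c where "c = residue_class k"
  have Q: "quotient_ring k = V1 k Quot ideal_span"
    by (simp add: quotient_ring_def rect_ideal_eq)
  interpret Q: ring "quotient_ring k" unfolding Q by (rule I.quotient_is_ring)
  have c: "c f = ideal_span +>\<^bsub>V1 k\<^esub> f" for f
    by (simp add: c_def residue_class_def rect_ideal_eq)
  have hom: "c \<in> Ring.ring_hom (V1 k) (quotient_ring k)"
  proof -
    have "c = (+>\<^bsub>V1 k\<^esub>) ideal_span" by (rule ext) (rule c)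
    then show ?thesis unfolding Q using I.rcos_ring_hom by simp
  qed
  have c_add: "c f \<oplus>\<^bsub>quotient_ring k\<^esub> c g = c (f + g)"
    if "f \<in> carrier (V1 k)" "g \<in> carrier (V1 k)" for f g
    using ring_hom_add[OF hom that] by simp
  have c_mult: "c f \<otimes>\<^bsub>quotient_ring k\<^esub> c g = c (f * g)"
    if "f \<in> carrier (V1 k)" "g \<in> carrier (V1 k)" for f g
    using ring_hom_mult[OF hom that] by simp
  have c_eq: "c f = c g \<longleftrightarrow> f - g \<in> ideal_span"
    if "f \<in> carrier (V1 k)" "g \<in> carrier (V1 k)" for f g
    using V.quotient_eq_iff_same_a_r_cos[OF ideal_ideal_span that] V1_a_minus[OF that] by (simp add: c)
  have c_zero: "\<zero>\<^bsub>quotient_ring k\<^esub> = c 0"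
    unfolding c using V.a_rcos_zero[OF ideal_ideal_span, of 0]
    by (simp add: Q FactRing_def ideal_span_def sf.span_zero)
  have carrier: "carrier (quotient_ring k) = c ` carrier (V1 k)"
    unfolding Q by (auto simp: FactRing_def A_RCOSETS_def' c)
  let ?K = "c ` range sf_const"
  note Q.Span.simps [simp del]
  have sub: "sf.subspace (carrier (V1 k))"
    by (intro sf.subspaceI V1_0 V1_add V1_scale)
  have span_V1: "sf.span (A ` set ps) \<subseteq> carrier (V1 k)"
    if "set ps \<subseteq> {p. irreducible_partition k p}" for ps
    using that by (intro sf.span_minimal sub) (auto simp: irreducible_iff A_V1)
  have Span: "Q.Span ?K (map (\<lambda>p. c (A p)) ps) = c ` sf.span (A ` set ps)"
    if "set ps \<subseteq> {p. irreducible_partition k p}" for ps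
    using that
  proof (induction ps)
    case Nil
    then show ?case by (simp add: c_zero Q.Span.simps)
  next
    case (Cons p ps)
    have A: "A p \<in> carrier (V1 k)" using Cons.prems by (auto simp: irreducible_iff A_V1)
    have IH: "Q.Span ?K (map (\<lambda>p. c (A p)) ps) = c ` sf.span (A ` set ps)" using Cons by simp
    have val: "c (sf_const a) \<otimes>\<^bsub>quotient_ring k\<^esub> c (A p) \<oplus>\<^bsub>quotient_ring k\<^esub> c g = c (sf_scale a (A p) + g)"
      if "g \<in> sf.span (A ` set ps)" for a g
    proof -
      have "g \<in> carrier (V1 k)" using that span_V1[of ps] Cons.prems by auto
      then show ?thesis
        by (simp add: c_mult c_add V1_const A V1_mult sf_scale_def)
    qed
    have "Q.Span ?K (map (\<lambda>p. c (A p)) (p # ps)) =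
        Q.line_extension ?K (c (A p)) (c ` sf.span (A ` set ps))"
      using IH by (simp add: Q.Span.simps)
    also have "\<dots> = {c (sf_scale a (A p) + g) |a g. g \<in> sf.span (A ` set ps)}"
    proof (intro equalityI subsetI)
      fix x assume "x \<in> Q.line_extension ?K (c (A p)) (c ` sf.span (A ` set ps))"
      then obtain a g where "g \<in> sf.span (A ` set ps)"
        "x = c (sf_const a) \<otimes>\<^bsub>quotient_ring k\<^esub> c (A p) \<oplus>\<^bsub>quotient_ring k\<^esub> c g"
        unfolding Q.line_extension_mem_iff by blast
      then show "x \<in> {c (sf_scale a (A p) + g) |a g. g \<in> sf.span (A ` set ps)}"
        using val[of g a] by blast
    next
      fix x assume "x \<in> {c (sf_scale a (A p) + g) |a g. g \<in> sf.span (A ` set ps)}"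
      then obtain a g where g: "g \<in> sf.span (A ` set ps)" "x = c (sf_scale a (A p) + g)" by blast
      show "x \<in> Q.line_extension ?K (c (A p)) (c ` sf.span (A ` set ps))"
        unfolding Q.line_extension_mem_iff g(2) val[OF g(1), symmetric]
        using g(1) by (intro bexI[of _ "c (sf_const a)"] bexI[of _ "c g"] refl) auto
    qed
    also have "\<dots> = c ` sf.span (insert (A p) (A ` set ps))"
    proof (intro equalityI subsetI)
      fix x assume "x \<in> {c (sf_scale a (A p) + g) |a g. g \<in> sf.span (A ` set ps)}"
      then obtain a g where ag: "x = c (sf_scale a (A p) + g)" "g \<in> sf.span (A ` set ps)" by blast
      have "sf_scale a (A p) + g \<in> sf.span (insert (A p) (A ` set ps))"
      proof (intro sf.span_add sf.span_scale)
        show "A p \<in> sf.span (insert (A p) (A ` set ps))" by (intro sf.span_base) simp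
        show "g \<in> sf.span (insert (A p) (A ` set ps))"
          using ag(2) sf.span_mono[OF subset_insertI] by blast
      qed
      then show "x \<in> c ` sf.span (insert (A p) (A ` set ps))" unfolding ag(1) by (rule imageI)
    next
      fix x assume "x \<in> c ` sf.span (insert (A p) (A ` set ps))"
      then obtain f a where "x = c f" "f - sf_scale a (A p) \<in> sf.span (A ` set ps)"
        unfolding sf.span_insert by blast
      then show "x \<in> {c (sf_scale a (A p) + g) |a g. g \<in> sf.span (A ` set ps)}"
        by (intro CollectI exI[of _ a] exI[of _ "f - sf_scale a (A p)"]) simp
    qed
    finally show ?case by simp
  qed
  (* a relation modulo the ideal would express an irreducible basis element by other basis elements *)
  have indep: "Q.independent ?K (map (\<lambda>p. c (A p)) ps)"
    if "set ps \<subseteq> {p. irreducible_partition k p}" "distinct ps" for ps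
    using that
  proof (induction ps)
    case (Cons p ps)
    have p: "irreducible_partition k p" using Cons.prems by simp
    have A: "A p \<in> carrier (V1 k)" using p by (simp add: irreducible_iff A_V1)
    have "c (A p) \<notin> Q.Span ?K (map (\<lambda>p. c (A p)) ps)"
    proof
      assume "c (A p) \<in> Q.Span ?K (map (\<lambda>p. c (A p)) ps)"
      then obtain g where g: "g \<in> sf.span (A ` set ps)" "c (A p) = c g"
        using Span[of ps] Cons.prems by auto
      then have "A p - g \<in> ideal_span"
        using c_eq[OF A, of g] span_V1[of ps] Cons.prems by auto
      moreover have sub1: "rect_basis ` reducible \<subseteq> rect_basis ` monomials - {A p}"
      proof
        fix b assume "b \<in> rect_basis ` reducible"
        then obtain m where m: "m \<in> reducible" "b = rect_basis m" by blast
        have "m \<in> monomials" "part_monomial p \<in> monomials" "m \<noteq> part_monomial p"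
          using m(1) p monomials_split part_monomial_not_reducible[OF p] by auto
        then show "b \<in> rect_basis ` monomials - {A p}"
          using inj_onD[OF inj_monomials, of m "part_monomial p"] m(2) rect_basis_irreducible[OF p]
          by auto
      qed
      moreover have sub2: "A ` set ps \<subseteq> rect_basis ` monomials - {A p}"
      proof
        fix b assume "b \<in> A ` set ps"
        then obtain q where q: "q \<in> set ps" "b = A q" by blast
        then have qi: "irreducible_partition k q" "q \<noteq> p" using Cons.prems by auto
        have mon: "part_monomial q \<in> monomials" "part_monomial p \<in> monomials"
          using qi(1) p monomials_split by auto
        have "part_monomial q \<noteq> part_monomial p"
          using part_monomial_inj[of q p] qi p by (auto simp: irreducible_iff bounded_partition_def)
        then have "A q \<noteq> A p"
          using inj_onD[OF inj_monomials _ mon] rect_basis_irreducible[OF p]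
            rect_basis_irreducible[OF qi(1)] by auto
        then show "b \<in> rect_basis ` monomials - {A p}"
          using q(2) rect_basis_irreducible[OF qi(1)] mon(1) by (metis DiffI imageI singletonD)
      qed
      ultimately have "(A p - g) + g \<in> sf.span (rect_basis ` monomials - {A p})"
        using sf.span_mono[OF sub1] sf.span_mono[OF sub2] g(1)
        by (intro sf.span_add) (auto simp: ideal_span_def)
      moreover have "A p \<in> rect_basis ` monomials"
        using p monomials_split rect_basis_irreducible[OF p] by (metis UnI2 imageI mem_Collect_eq)
      ultimately have "sf.dependent (rect_basis ` monomials)"
        unfolding sf.dependent_def by auto
      then show False using independent_monomials by contradiction
    qed
    moreover have "c (A p) \<in> carrier (quotient_ring k)" using A carrier by simp
    ultimately show ?case
      using Cons by (auto intro: Q.li_Cons)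
  qed simp
  obtain ps where ps: "distinct ps" "set ps = {p. irreducible_partition k p}"
    using finite_distinct_list[OF finite_irreducible] by blast
  have "c ` sf.span (A ` set ps) = carrier (quotient_ring k)"
    unfolding carrier
  proof (intro equalityI subsetI)
    fix x assume "x \<in> c ` sf.span (A ` set ps)"
    then show "x \<in> c ` carrier (V1 k)" using span_V1[of ps] ps(2) by auto
  next
    fix x assume "x \<in> c ` carrier (V1 k)"
    then obtain f where f: "x = c f" "f \<in> carrier (V1 k)" by blast
    have "rect_basis ` monomials = rect_basis ` reducible \<union> A ` set ps"
      unfolding monomials_split image_Un image_image ps(2)
      using rect_basis_irreducible by (intro arg_cong2[of _ _ _ _ "(\<union>)"] image_cong) auto
    then have "f \<in> sf.span (rect_basis ` reducible \<union> A ` set ps)"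
      using f(2) span_monomials by simp
    then obtain g h where gh: "f = g + h" "g \<in> ideal_span" "h \<in> sf.span (A ` set ps)"
      unfolding sf.span_Un ideal_span_def by blast
    have "h \<in> carrier (V1 k)" using gh(3) span_V1[of ps] ps(2) by auto
    then have "c f = c h" using c_eq[OF f(2)] gh(1,2) by simp
    then show "x \<in> c ` sf.span (A ` set ps)" using gh(3) f(1) by auto
  qed
  then have "Q.Span ?K (map (\<lambda>p. c (A p)) ps) = carrier (quotient_ring k)"
    using Span[of ps] ps(2) by simp
  then show ?thesis
    unfolding ring_basis_def c_def[symmetric]
    using ps indep[of ps] by (intro exI[of _ ps]) simp
qed

end

section \<open>Shifting the alphabet\<close>

lemma pCons_hom: "comm_ring_hom (\<lambda>x :: 'b::comm_ring_1. [:x:])"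
  by unfold_locales (simp_all add: one_pCons)

lemma poly_point_hom: "comm_ring_hom (\<lambda>F :: 'b::comm_ring_1 poly. poly F x)"
  by unfold_locales simp_all

text \<open>The substitution \<open>X \<mapsto> X + (1 - t) u\<close>, as a polynomial in \<open>u\<close>.\<close>

definition shift :: "'a::field \<Rightarrow> 'a sf \<Rightarrow> 'a sf poly" where
  "shift t = poly_eval (\<lambda>c. [:sf_const c:]) (\<lambda>i. [:power_sum i:] + monom (sf_const (1 - t ^ i)) i)"

lemma shift_hom: "comm_ring_hom (shift t)"
  unfolding shift_def by (rule poly_eval_hom[OF hom_compose[OF pCons_hom sf_const_hom]])

lemma shift_const: "shift t (sf_const a) = [:sf_const a:]"
  unfolding shift_def by (rule poly_eval_const[OF hom_compose[OF pCons_hom sf_const_hom]])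

lemma shift_power_sum: "shift t (power_sum i) = [:power_sum i:] + monom (sf_const (1 - t ^ i)) i"
  unfolding shift_def by (rule poly_eval_power_sum[OF hom_compose[OF pCons_hom sf_const_hom]])

lemma plethysm_eq: "plethysm t = poly_eval sf_const (\<lambda>i. sf_scale (1 / (1 - t ^ i)) (power_sum i))"
  by (rule ext) (simp add: plethysm_def poly_eval_def mono_eval_def sf_scale_def)

lemma plethysm_hom: "comm_ring_hom (plethysm t)"
  unfolding plethysm_eq by (rule poly_eval_hom[OF sf_const_hom])

lemma plethysm_power_sum: "plethysm t (power_sum i) = sf_scale (1 / (1 - t ^ i)) (power_sum i)"
  unfolding plethysm_eq by (rule poly_eval_power_sum[OF sf_const_hom])

text \<open>The recursion for \<open>K\<close> is that of the generating series \<open>K(z) = g(z) / (1 - u z)\<close>.  For \<open>g\<close> the series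
  of the complete functions, adjoining the variable \<open>u\<close> to the alphabet has this effect on them, and
  adds \<open>u\<^sup>i\<close> to the power sums.\<close>

lemma newton_shift:
  fixes g p K :: "nat \<Rightarrow> 'b::comm_ring_1"
  assumes g: "g 0 = 1" "\<And>n. of_nat (Suc n) * g (Suc n) = (\<Sum>i\<le>n. p (Suc i) * g (n - i))"
    and K: "K 0 = 1" "\<And>n. K (Suc n) = g (Suc n) + u * K n"
  shows "of_nat (Suc n) * K (Suc n) = (\<Sum>i\<le>n. (p (Suc i) + u ^ Suc i) * K (n - i))"
proof (induction n)
  case 0
  show ?case using g(2)[of 0] by (simp add: K g(1) algebra_simps)
next
  case (Suc m)
  have closed: "K n = (\<Sum>i\<le>n. u ^ i * g (n - i))" for n
  proof (induction n)
    case (Suc n)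
    have "(\<Sum>i\<le>Suc n. u ^ i * g (Suc n - i)) = g (Suc n) + (\<Sum>i\<le>n. u ^ Suc i * g (n - i))"
      by (subst sum.atMost_Suc_shift) simp
    then show ?case by (simp add: K(2) Suc sum_distrib_left mult.assoc)
  qed (simp add: K g(1))
  have "(\<Sum>i\<le>Suc m. (p (Suc i) + u ^ Suc i) * K (Suc m - i)) =
      (\<Sum>i\<le>m. (p (Suc i) + u ^ Suc i) * K (Suc m - i)) + (p (Suc (Suc m)) + u ^ Suc (Suc m)) * g 0"
    by (simp add: K g(1))
  also have "(\<Sum>i\<le>m. (p (Suc i) + u ^ Suc i) * K (Suc m - i)) =
      (\<Sum>i\<le>m. (p (Suc i) + u ^ Suc i) * g (Suc m - i) + u * ((p (Suc i) + u ^ Suc i) * K (m - i)))"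
    by (intro sum.cong refl) (simp add: Suc_diff_le K(2) algebra_simps)
  also have "\<dots> = (\<Sum>i\<le>m. (p (Suc i) + u ^ Suc i) * g (Suc m - i)) + u * (of_nat (Suc m) * K (Suc m))"
    unfolding Suc sum_distrib_left by (rule sum.distrib)
  finally have "(\<Sum>i\<le>Suc m. (p (Suc i) + u ^ Suc i) * K (Suc m - i)) =
      (\<Sum>i\<le>Suc m. (p (Suc i) + u ^ Suc i) * g (Suc m - i)) + u * (of_nat (Suc m) * K (Suc m))"
    by (simp add: add_ac)
  also have "(\<Sum>i\<le>Suc m. (p (Suc i) + u ^ Suc i) * g (Suc m - i)) =
      of_nat (Suc (Suc m)) * g (Suc (Suc m)) + u * K (Suc m)"
    unfolding g(2) closed[of "Suc m"] sum_distrib_left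
    by (simp add: sum.distrib distrib_right mult.assoc del: sum.atMost_Suc)
  also have "\<dots> + u * (of_nat (Suc m) * K (Suc m)) = of_nat (Suc (Suc m)) * K (Suc (Suc m))"
    by (simp add: K(2)[of "Suc m"] algebra_simps)
  finally show ?case by simp
qed

text \<open>The Jacobi--Trudi matrix of a sequence \<open>H\<close> with \<open>H\<^sub>n = g\<^sub>n + u H\<^sub>n\<^sub>-\<^sub>1\<close> arises by unitriangular
  column operations from a matrix with entries \<open>g\<close> outside the first column.\<close>

lemma degree_jacobi_trudi:
  fixes H :: "nat \<Rightarrow> 'b::comm_ring_1 poly" and g :: "nat \<Rightarrow> 'b" and p :: "nat list"
  assumes H: "H 0 = 1" "\<And>n. H (Suc n) = [:g (Suc n):] + monom 1 1 * H n" and g: "g 0 = 1"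
    and p: "\<forall>x\<in>set p. x \<le> k"
  shows "degree (det (mat (length p) (length p)
     (\<lambda>(i, j). if i \<le> p ! i + j then H (p ! i + j - i) else 0))) \<le> k"
proof -
  let ?n = "length p" and ?u = "monom 1 1 :: 'b poly"
  (* N is the matrix after the column operations, and C reverts them *)
  define N where "N i j = (if p ! i + j < i then 0 else if j = 0 then H (p ! i - i)
      else [:g (p ! i + j - i):])" for i j
  define C where "C l j = (if l \<le> j then ?u ^ (j - l) else 0)" for l j :: nat
  have entry: "(if i \<le> p ! i + j then H (p ! i + j - i) else 0) = (\<Sum>l\<le>j. N i l * ?u ^ (j - l))" for i j
  proof (induction j)
    case (Suc j)
    have "(\<Sum>l\<le>Suc j. N i l * ?u ^ (Suc j - l)) = ?u * (\<Sum>l\<le>j. N i l * ?u ^ (j - l)) + N i (Suc j)"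
      by (simp add: sum_distrib_left Suc_diff_le mult_ac)
    also have "\<dots> = ?u * (if i \<le> p ! i + j then H (p ! i + j - i) else 0) + N i (Suc j)"
      by (simp only: Suc)
    also have "\<dots> = (if i \<le> p ! i + Suc j then H (p ! i + Suc j - i) else 0)"
    proof -
      consider "i \<le> p ! i + j" | "i = p ! i + Suc j" | "i > p ! i + Suc j" by linarith
      then show ?thesis
      proof cases
        case 1
        then show ?thesis by (simp add: N_def Suc_diff_le H(2) add.commute)
      next
        case 2
        then have "p ! i + Suc j - i = 0" "\<not> i \<le> p ! i + j" "i \<le> p ! i + Suc j" "\<not> p ! i + Suc j < i"
          by linarith+
        then show ?thesis by (simp add: N_def H(1) g one_pCons)
      next
        case 3
        then have "\<not> i \<le> p ! i + j" "\<not> i \<le> p ! i + Suc j" by linarith+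
        then show ?thesis using 3 by (simp add: N_def)
      qed
    qed
    finally show ?case by simp
  qed (simp add: N_def)
  let ?N = "mat ?n ?n (\<lambda>(i, j). N i j)" and ?C = "mat ?n ?n (\<lambda>(i, j). C i j)"
  have "mat ?n ?n (\<lambda>(i, j). if i \<le> p ! i + j then H (p ! i + j - i) else 0) = ?N * ?C"
  proof (rule eq_matI)
    fix i j assume ij: "i < dim_row (?N * ?C)" "j < dim_col (?N * ?C)"
    then have "(?N * ?C) $$ (i, j) = (\<Sum>l = 0..<?n. N i l * C l j)"
      by (simp add: scalar_prod_def)
    also have "\<dots> = (\<Sum>l\<le>j. N i l * ?u ^ (j - l))"
      using ij by (intro sum.mono_neutral_cong_right) (auto simp: C_def)
    also have "\<dots> = mat ?n ?n (\<lambda>(i, j). if i \<le> p ! i + j then H (p ! i + j - i) else 0) $$ (i, j)"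
      using ij entry[of i j] by simp
    finally show "mat ?n ?n (\<lambda>(i, j). if i \<le> p ! i + j then H (p ! i + j - i) else 0) $$ (i, j) =
        (?N * ?C) $$ (i, j)" by simp
  qed auto
  moreover have "det (?N * ?C) = det ?N * det ?C" by (rule det_mult) auto
  moreover have "det ?C = 1"
  proof -
    have "upper_triangular ?C" by (auto simp: C_def)
    then have "det ?C = prod_list (diag_mat ?C)" by (rule det_upper_triangular) auto
    also have "diag_mat ?C = replicate ?n 1"
      by (rule nth_equalityI) (auto simp: diag_mat_def C_def)
    finally show ?thesis by simp
  qed
  moreover have "degree (det ?N) \<le> k"
  proof -
    have deg_H: "degree (H n) \<le> n" for n
    proof (induction n)
      case (Suc n)
      have "degree (?u * H n) \<le> Suc n"
        using degree_mult_le[of ?u "H n"] degree_monom_le[of "1::'b" 1] Suc by linarith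
      then show ?case unfolding H(2) by (intro degree_add_le) auto
    qed (simp add: H(1))
    have deg_N: "degree (N i j) \<le> (if j = 0 then k else 0)" if "i < ?n" for i j
    proof -
      have "p ! i \<le> k" using p that by auto
      then have "degree (H (p ! i - i)) \<le> k" using deg_H[of "p ! i - i"] by linarith
      then show ?thesis by (simp add: N_def)
    qed
    have "degree (signof \<pi> * (\<Prod>i = 0..<?n. ?N $$ (i, \<pi> i))) \<le> k"
      if perm: "\<pi> permutes {0..<?n}" for \<pi>
    proof -
      have "degree (\<Prod>i = 0..<?n. ?N $$ (i, \<pi> i)) \<le> (\<Sum>i = 0..<?n. degree (?N $$ (i, \<pi> i)))"
        using degree_prod_sum_le[of "{0..<?n}" "\<lambda>i. ?N $$ (i, \<pi> i)"] by (simp add: o_def)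
      also have "\<dots> \<le> (\<Sum>i = 0..<?n. if \<pi> i = 0 then k else 0)"
        using permutes_in_image[OF perm] by (intro sum_mono) (simp add: deg_N)
      also have "\<dots> = (\<Sum>i \<in> {0..<?n}. if i = 0 then k else 0)"
        using sum.permute[OF perm, of "\<lambda>i. if i = 0 then k else 0"] by (simp add: o_def)
      also have "\<dots> \<le> k" by simp
      finally have le: "degree (\<Prod>i = 0..<?n. ?N $$ (i, \<pi> i)) \<le> k" .
      then show ?thesis by (simp add: sign_def)
    qed
    then show ?thesis
      by (subst det_def'[OF mat_carrier]) (intro degree_sum_le, simp_all add: finite_permutations)
  qed
  ultimately show ?thesis by simp
qed

text \<open>The substitution \<open>X \<mapsto> X + (1 - t) u\<close> in \<open>f[X/(1 - t)]\<close> amounts to \<open>f[X/(1 - t) + u]\<close>.\<close>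

lemma degree_shift_plethysm_schur:
  fixes t :: "'a::field"
  assumes t: "\<And>i. 0 < i \<Longrightarrow> t ^ i \<noteq> 1" and char0: "\<And>n. (of_nat (Suc n) :: 'a) \<noteq> 0"
    and p: "\<forall>x\<in>set p. x \<le> k"
  shows "degree (shift t (plethysm t (schur p))) \<le> k"
proof -
  let ?\<eta> = "\<lambda>f. shift t (plethysm t f)"
  interpret pl: comm_ring_hom "plethysm t" by (rule plethysm_hom)
  interpret sh: comm_ring_hom "shift t" by (rule shift_hom)
  interpret pC: comm_ring_hom "\<lambda>x :: 'a sf. [:x:]" by (rule pCons_hom)
  have hom: "comm_ring_hom ?\<eta>" by (rule hom_compose[OF shift_hom plethysm_hom])
  interpret \<eta>: comm_ring_hom ?\<eta> by (rule hom)
  define g where "g n = plethysm t (complete_sf n)" for n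
  have g0: "g 0 = 1" unfolding g_def complete_sf.simps(1) by (rule pl.hom_one)
  define K where "K = rec_nat 1 (\<lambda>n Kn. [:g (Suc n):] + monom 1 1 * Kn)"
  have K: "K 0 = 1" "K (Suc n) = [:g (Suc n):] + monom 1 1 * K n" for n
    by (simp_all add: K_def)
  have of_nat_const: "sf_const (of_nat n) = (of_nat n :: 'a sf)" for n
    by (rule sf_const.hom_of_nat)
  have eta_p: "?\<eta> (power_sum (Suc i)) = [:plethysm t (power_sum (Suc i)):] + monom 1 1 ^ Suc i" for i
  proof -
    have nz: "1 - t ^ Suc i \<noteq> 0" using t[of "Suc i"] by simp
    have mon: "monom (1 :: 'a sf) 1 ^ Suc i = monom 1 (Suc i)"
      by (simp add: monom_power del: power_Suc)
    show ?thesis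
      unfolding plethysm_power_sum sf_scale_def sh.hom_mult shift_const shift_power_sum mon
      unfolding distrib_left using nz
      by (simp add: smult_monom sf_const.hom_mult[symmetric] del: power_Suc)
  qed
  have newton_g: "of_nat (Suc n) * [:g (Suc n):] =
      (\<Sum>i\<le>n. [:plethysm t (power_sum (Suc i)):] * [:g (n - i):])" for n
  proof -
    have "of_nat (Suc n) * g (Suc n) = (\<Sum>i\<le>n. plethysm t (power_sum (Suc i)) * g (n - i))"
      using arg_cong[OF complete_sf_Suc[OF char0[of n]], of "plethysm t"]
      by (simp only: g_def pl.hom_mult pl.hom_sum of_nat_const pl.hom_of_nat)
    then have "[:of_nat (Suc n) * g (Suc n):] = [:\<Sum>i\<le>n. plethysm t (power_sum (Suc i)) * g (n - i):]"
      by (rule arg_cong)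
    then show ?thesis by (simp only: pC.hom_mult pC.hom_sum pC.hom_of_nat)
  qed
  have eta: "?\<eta> (complete_sf n) = K n" for n
  proof (induction n rule: less_induct)
    case (less n)
    show ?case
    proof (cases n)
      case 0
      then show ?thesis by (simp add: K)
    next
      case (Suc m)
      have "of_nat (Suc m) * ?\<eta> (complete_sf (Suc m)) =
          (\<Sum>i\<le>m. ?\<eta> (power_sum (Suc i)) * ?\<eta> (complete_sf (m - i)))"
        using arg_cong[OF complete_sf_Suc[OF char0[of m]], of ?\<eta>]
        by (simp only: \<eta>.hom_mult \<eta>.hom_sum of_nat_const \<eta>.hom_of_nat)
      also have "\<dots> = (\<Sum>i\<le>m. ([:plethysm t (power_sum (Suc i)):] + monom 1 1 ^ Suc i) * K (m - i))"
        using Suc by (intro sum.cong refl arg_cong2[of _ _ _ _ "(*)"] eta_p less.IH) simp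
      also have "\<dots> = of_nat (Suc m) * K (Suc m)"
      proof (rule newton_shift[symmetric, where K=K and u="monom 1 1" and n=m and g="\<lambda>n. [:g n:]" and p="\<lambda>i. [:plethysm t (power_sum i):]"])
        show "[:g 0:] = 1" unfolding g0 by (rule pC.hom_one)
      qed (rule newton_g K)+
      finally have eq: "of_nat (Suc m) * ?\<eta> (complete_sf (Suc m)) = of_nat (Suc m) * K (Suc m)" .
      have "sf_const (1 / of_nat (Suc m)) * of_nat (Suc m) = (1 :: 'a sf)"
        unfolding of_nat_const[of "Suc m", symmetric] sf_const.hom_mult[symmetric]
        using char0[of m] by (simp del: of_nat_Suc)
      from arg_cong[OF this, of "\<lambda>x. [:x:]"]
      have "[:sf_const (1 / of_nat (Suc m)):] * of_nat (Suc m) = (1 :: 'a sf poly)"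
        by (simp only: pC.hom_mult pC.hom_of_nat pC.hom_one)
      then have "?\<eta> (complete_sf (Suc m)) = K (Suc m)"
        using arg_cong[OF eq, of "(*) [:sf_const (1 / of_nat (Suc m)):]"]
        unfolding mult.assoc[symmetric] by (simp only: mult_1_left)
      then show ?thesis using Suc by simp
    qed
  qed
  show ?thesis
    unfolding hom_schur[OF hom] eta
  proof (rule degree_jacobi_trudi[where g=g and H=K and p=p and k=k])
    show "g 0 = 1" by (rule g0)
  qed (use p in \<open>simp_all only: K\<close>)
qed

lemma degree_shift_V:
  fixes t :: "'a::field"
  assumes t: "\<And>i. 0 < i \<Longrightarrow> t ^ i \<noteq> 1" and char0: "\<And>n. (of_nat (Suc n) :: 'a) \<noteq> 0"
    and f: "f \<in> sf.span {plethysm t (schur p) |p. bounded_partition k p}"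
  shows "degree (shift t f) \<le> k"
proof -
  interpret sh: comm_ring_hom "shift t" by (rule shift_hom)
  show ?thesis using f
  proof (induction rule: sf.span_induct_alt)
    case (step c x y)
    then obtain p where "x = plethysm t (schur p)" "bounded_partition k p" by blast
    then have "degree (shift t x) \<le> k"
      using degree_shift_plethysm_schur[OF t char0, of p k] by (simp add: bounded_partition_def)
    then have "degree (shift t (sf_scale c x)) \<le> k"
      unfolding sf_scale_def sh.hom_mult shift_const using degree_smult_le[of "sf_const c" "shift t x"] by simp
    then show ?case unfolding sh.hom_add using step(2) by (intro degree_add_le)
  qed (simp add: sh.hom_zero)
qed

section \<open>The derivative of the shift at \<open>t = 1\<close>\<close>

text \<open>The substitution \<open>X \<mapsto> X + (1 - t) u\<close> with a variable parameter: \<open>t\<close> is the outer polynomial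
  variable and \<open>u\<close> the inner one.\<close>

definition deform :: "'a::field sf \<Rightarrow> 'a sf poly poly" where
  "deform = poly_eval (\<lambda>c. [:[:sf_const c:]:])
     (\<lambda>i. [:[:power_sum i:]:] + (1 - monom 1 i) * [:monom 1 i:])"

lemma const_hom2: "comm_ring_hom (\<lambda>c :: 'a::field. [:[:sf_const c:]:])"
  by (rule hom_compose[OF pCons_hom hom_compose[OF pCons_hom sf_const_hom]])

lemma deform_hom: "comm_ring_hom deform"
  unfolding deform_def by (rule poly_eval_hom[OF const_hom2])

lemma deform_const: "deform (sf_const a) = [:[:sf_const a:]:]"
  unfolding deform_def by (rule poly_eval_const[OF const_hom2])

lemma deform_power_sum:
  "deform (power_sum i) = [:[:power_sum i:]:] + (1 - monom 1 i) * [:monom 1 i:]"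
  unfolding deform_def by (rule poly_eval_power_sum[OF const_hom2])

lemma poly_deform: "poly (deform f) [:sf_const t:] = shift t f"
proof (rule sf_hom_eqI[OF hom_compose[OF poly_point_hom deform_hom] shift_hom])
  fix i
  have pow: "[:sf_const t:] ^ i = [:sf_const (t ^ i):]"
    by (induction i) (simp_all add: one_pCons sf_const.hom_mult)
  show "poly (deform (power_sum i)) [:sf_const t:] = shift t (power_sum i)"
  proof -
    have "(1 - [:sf_const (t ^ i):]) * monom 1 i = monom (1 - sf_const (t ^ i)) i"
      by (simp add: left_diff_distrib smult_monom diff_monom)
    then show ?thesis
      unfolding deform_power_sum shift_power_sum
      by (simp only: poly_add poly_mult poly_diff poly_1 poly_monom poly_pCons poly_0 pow
          mult_zero_right add_0_right mult_1_left sf_const.hom_minus sf_const.hom_one)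
  qed
qed (simp add: deform_const shift_const)

lemma poly_deform_one: "poly (deform f) 1 = [:f:]"
proof (rule sf_hom_eqI[OF hom_compose[OF poly_point_hom deform_hom] pCons_hom])
  fix i
  show "poly (deform (power_sum i)) 1 = [:power_sum i:]"
    by (simp add: deform_power_sum poly_monom)
qed (simp add: deform_const)

definition deform' :: "'a::field sf \<Rightarrow> 'a sf poly" where
  "deform' f = poly (pderiv (deform f)) 1"

lemma deform'_add: "deform' (f + g) = deform' f + deform' g"
proof -
  interpret D: comm_ring_hom deform by (rule deform_hom)
  show ?thesis by (simp add: deform'_def D.hom_add pderiv_add)
qed

lemma deform'_zero: "deform' 0 = 0"
proof -
  interpret D: comm_ring_hom deform by (rule deform_hom)
  show ?thesis by (simp add: deform'_def)
qed

lemma deform'_sum: "deform' (sum f A) = (\<Sum>x\<in>A. deform' (f x))"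
  by (induction A rule: infinite_finite_induct) (simp_all add: deform'_add deform'_zero)

lemma deform'_mult: "deform' (f * g) = deform' f * [:g:] + [:f:] * deform' g"
proof -
  interpret D: comm_ring_hom deform by (rule deform_hom)
  show ?thesis by (simp add: deform'_def D.hom_mult pderiv_mult poly_deform_one add.commute mult.commute)
qed

lemma deform'_const: "deform' (sf_const a) = 0"
  by (simp add: deform'_def deform_const)

lemma deform'_power_sum: "deform' (power_sum i) = - of_nat i * monom 1 i"
proof -
  have "poly (pderiv (monom (1::'a sf poly) i)) 1 = of_nat i"
    by (simp add: pderiv_monom poly_monom)
  then show ?thesis
    unfolding deform'_def deform_power_sum pderiv_add pderiv_mult pderiv_diff
    by (simp add: poly_monom)
qed

lemma exponent_induct [case_names zero add]:
  assumes "P 0" "\<And>m i. P m \<Longrightarrow> P (Poly_Mapping.single i 1 + m)"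
  shows "P (m :: nat \<Rightarrow>\<^sub>0 nat)"
proof (induction m rule: update_induct)
  case (update m i n)
  have "P (Poly_Mapping.single i n + m)" for n
  proof (induction n)
    case (Suc n)
    then show ?case using assms(2)[of "Poly_Mapping.single i n + m" i]
      by (simp add: single_add[symmetric] add.assoc[symmetric])
  qed (simp add: update(3))
  moreover have "Poly_Mapping.update i n m = Poly_Mapping.single i n + m"
    using update(1) by (intro poly_mapping_eqI)
      (auto simp: lookup_update lookup_add lookup_single in_keys_iff when_def)
  ultimately show ?case by simp
qed (rule assms(1))

lemma coeff_deform'_monomial:
  "coeff (deform' (Poly_Mapping.single m (1::'a::field))) b =
     - of_nat b * Poly_Mapping.single (m - Poly_Mapping.single b 1) (of_nat (Poly_Mapping.lookup m b))"
proof (induction m rule: exponent_induct)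
  case zero
  have "deform' (1 :: 'a sf) = 0"
    using deform'_const[of "1::'a"] by simp
  then show ?case by simp
next
  case (add m i)
  let ?s = "\<lambda>j. Poly_Mapping.single j (1::nat)"
  have *: "Poly_Mapping.single (?s i + m) (1::'a) = power_sum i * Poly_Mapping.single m 1"
    by (simp add: power_sum_def mult_single)
  have "coeff (deform' (Poly_Mapping.single (?s i + m) (1::'a))) b =
      (if b = i then - of_nat i * Poly_Mapping.single m 1 else 0) +
      power_sum i * (- of_nat b * Poly_Mapping.single (m - ?s b) (of_nat (Poly_Mapping.lookup m b)))"
    unfolding * deform'_mult deform'_power_sum coeff_add
    using add by (simp add: of_nat_poly smult_monom coeff_monom_mult mult.commute)
  also have "\<dots> = - of_nat b * Poly_Mapping.single (?s i + m - ?s b) (of_nat (Poly_Mapping.lookup (?s i + m) b))"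
  proof (cases "b = i")
    case True
    have "power_sum i * Poly_Mapping.single (m - ?s i) (of_nat (Poly_Mapping.lookup m i) :: 'a) =
        Poly_Mapping.single m (of_nat (Poly_Mapping.lookup m i))"
    proof (cases "Poly_Mapping.lookup m i = 0")
      case False
      then have "?s i + (m - ?s i) = m"
        by (intro poly_mapping_eqI) (auto simp: lookup_add lookup_minus lookup_single when_def)
      then show ?thesis by (simp add: power_sum_def mult_single)
    qed simp
    moreover have "Poly_Mapping.single m (1 + of_nat (Poly_Mapping.lookup m i) :: 'a) =
        Poly_Mapping.single m 1 + Poly_Mapping.single m (of_nat (Poly_Mapping.lookup m i))"
      by (rule single_add)
    moreover have "of_nat (Poly_Mapping.lookup (?s i + m) i) = (1 + of_nat (Poly_Mapping.lookup m i) :: 'a)"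
      by (simp add: lookup_add)
    moreover have "?s i + m - ?s i = m" by simp
    ultimately show ?thesis
      unfolding True mult.left_commute[of "power_sum i"] by (simp only: if_True simp_thms distrib_left)
  next
    case False
    have "power_sum i * Poly_Mapping.single (m - ?s b) (of_nat (Poly_Mapping.lookup m b) :: 'a) =
        Poly_Mapping.single (?s i + m - ?s b) (of_nat (Poly_Mapping.lookup m b))"
    proof (cases "Poly_Mapping.lookup m b = 0")
      case nz: False
      have "?s i + (m - ?s b) = ?s i + m - ?s b"
        using False nz by (intro poly_mapping_eqI) (auto simp: lookup_add lookup_minus lookup_single when_def)
      then show ?thesis by (simp add: power_sum_def mult_single)
    qed simp
    then show ?thesis using False
      by (simp add: lookup_add lookup_single mult.left_commute)
  qed
  finally show ?case .
qed

text \<open>The derivative at \<open>t = 1\<close> of the coefficient of \<open>u\<^sup>b\<close> is \<open>-b\<close> times the partial derivative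
  by the power sum of index \<open>b\<close>.\<close>

lemma deform'_support:
  fixes f :: "rat sf"
  assumes b: "0 < b" and z: "coeff (deform' f) b = 0" and m: "m \<in> Poly_Mapping.keys f"
  shows "b \<notin> Poly_Mapping.keys m"
proof
  assume bm: "b \<in> Poly_Mapping.keys m"
  let ?s = "Poly_Mapping.single b (1::nat)"
  have f: "f = (\<Sum>n\<in>Poly_Mapping.keys f. sf_const (Poly_Mapping.lookup f n) * Poly_Mapping.single n 1)"
  proof (rule poly_mapping_eqI)
    fix x
    show "Poly_Mapping.lookup f x =
        Poly_Mapping.lookup (\<Sum>n\<in>Poly_Mapping.keys f. sf_const (Poly_Mapping.lookup f n) * Poly_Mapping.single n 1) x"
      by (auto simp: lookup_sum sf_const_def mult_single lookup_single when_def in_keys_iff)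
  qed
  have neg: "(- of_nat b :: rat sf) = sf_const (- of_nat b)"
    by (simp only: sf_const.hom_uminus sf_const.hom_of_nat)
  have "coeff (deform' f) b = (\<Sum>n\<in>Poly_Mapping.keys f. sf_const (Poly_Mapping.lookup f n) *
      (- of_nat b * Poly_Mapping.single (n - ?s) (of_nat (Poly_Mapping.lookup n b))))"
    by (subst f) (simp add: deform'_sum deform'_mult deform'_const coeff_sum coeff_deform'_monomial)
  then have "0 = (\<Sum>n\<in>Poly_Mapping.keys f. Poly_Mapping.lookup (sf_const (Poly_Mapping.lookup f n) *
      (- of_nat b * Poly_Mapping.single (n - ?s) (of_nat (Poly_Mapping.lookup n b)))) (m - ?s))"
    using z by (simp only: lookup_sum[symmetric] lookup_zero)
  also have "\<dots> = (\<Sum>n\<in>Poly_Mapping.keys f. if n = m then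
      - of_nat b * (Poly_Mapping.lookup f m * of_nat (Poly_Mapping.lookup m b)) else 0)"
  proof (intro sum.cong refl)
    fix n assume n: "n \<in> Poly_Mapping.keys f"
    have "sf_const (Poly_Mapping.lookup f n) *
        (- of_nat b * Poly_Mapping.single (n - ?s) (of_nat (Poly_Mapping.lookup n b))) =
        Poly_Mapping.single (n - ?s) (- of_nat b * (Poly_Mapping.lookup f n * of_nat (Poly_Mapping.lookup n b)))"
      unfolding neg sf_const_def mult_single by (simp only: add_0_left mult.left_commute mult.commute)
    moreover have "n = m" if "n - ?s = m - ?s" "Poly_Mapping.lookup n b \<noteq> 0"
    proof (rule poly_mapping_eqI)
      fix x
      have "Poly_Mapping.lookup (n - ?s) x = Poly_Mapping.lookup (m - ?s) x" using that(1) by simp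
      then show "Poly_Mapping.lookup n x = Poly_Mapping.lookup m x"
        using that(2) bm by (cases "x = b") (auto simp: lookup_minus lookup_single in_keys_iff)
    qed
    ultimately show "Poly_Mapping.lookup (sf_const (Poly_Mapping.lookup f n) *
        (- of_nat b * Poly_Mapping.single (n - ?s) (of_nat (Poly_Mapping.lookup n b)))) (m - ?s) =
        (if n = m then - of_nat b * (Poly_Mapping.lookup f m * of_nat (Poly_Mapping.lookup m b)) else 0)"
      by (cases "Poly_Mapping.lookup n b = 0") (auto simp: lookup_single when_def)
  qed
  also have "\<dots> = - of_nat b * (Poly_Mapping.lookup f m * of_nat (Poly_Mapping.lookup m b))"
    using m by simp
  finally show False using b m bm by (simp add: in_keys_iff)
qed

section \<open>From \<open>V\<^sub>k\<close> to the ring at \<open>t = 1\<close>\<close>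

definition qt_const :: "rat \<Rightarrow> rat_qt" where
  "qt_const c = Fract [:[:c:]:] 1"

lemma qt_const_hom: "comm_ring_hom qt_const"
  by unfold_locales (simp_all add: qt_const_def Zero_fract_def One_fract_def one_pCons)

interpretation qt_const: comm_ring_hom qt_const by (rule qt_const_hom)

lemma qt_const_eq_0: "qt_const c = 0 \<longleftrightarrow> c = 0"
  by (simp add: qt_const_def Zero_fract_def eq_fract)

lemma of_nat_rat_qt: "(of_nat (Suc n) :: rat_qt) \<noteq> 0"
  using qt_const_eq_0[of "of_nat (Suc n)"] by (simp add: qt_const.hom_of_nat del: of_nat_Suc)

lemma t_var_power: "t_var ^ n = Fract (monom 1 n) 1"
proof (induction n)
  case 0
  show ?case by (simp add: One_fract_def)
next
  case (Suc n)
  have "[:0, 1:] * monom 1 n = (monom 1 (Suc n) :: rat poly poly)" by (simp add: monom_Suc)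
  then show ?case unfolding power_Suc Suc unfolding t_var_def by simp
qed

lemma t_var_power_neq_1: "0 < i \<Longrightarrow> t_var ^ i \<noteq> 1"
proof
  assume i: "0 < i" and "t_var ^ i = 1"
  then have "monom 1 i = (1 :: rat poly poly)"
    by (simp add: t_var_power One_fract_def eq_fract)
  then have "degree (monom (1 :: rat poly) i) = 0" by simp
  then show False using i by (simp add: degree_monom_eq)
qed

text \<open>An identity between rational polynomials in \<open>t\<close> is an identity of their coefficients.\<close>

lemma t_var_transcendental:
  assumes "(\<Sum>i\<le>n. qt_const (r i) * t_var ^ i) = 0" and "i \<le> n"
  shows "r i = 0"
proof -
  have "(\<Sum>i\<in>S. qt_const (r i) * t_var ^ i) = Fract (\<Sum>i\<in>S. monom [:r i:] i) 1" for S
  proof (induction S rule: infinite_finite_induct)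
    case (insert i S)
    have "qt_const (r i) * t_var ^ i = Fract (monom [:r i:] i) 1"
      by (simp add: t_var_power qt_const_def smult_monom)
    then show ?case using insert by simp
  qed (simp_all add: Zero_fract_def)
  then have "(\<Sum>i\<le>n. monom [:r i:] i) = 0"
    using assms(1) by (simp add: Zero_fract_def eq_fract)
  then have "coeff (\<Sum>i\<le>n. monom [:r i:] i) i = 0" by simp
  then show ?thesis using assms(2) by (simp add: coeff_sum)
qed

definition extend_scalars :: "rat sf \<Rightarrow> rat_qt sf" where
  "extend_scalars = poly_eval (\<lambda>c. sf_const (qt_const c)) power_sum"

lemma extend_scalars_const_hom: "comm_ring_hom (\<lambda>c. sf_const (qt_const c))"
  by (rule hom_compose[OF sf_const_hom qt_const_hom])

lemma extend_scalars_hom: "comm_ring_hom extend_scalars"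
  unfolding extend_scalars_def by (rule poly_eval_hom[OF extend_scalars_const_hom])

interpretation extend_scalars: comm_ring_hom extend_scalars by (rule extend_scalars_hom)

lemma extend_scalars_const: "extend_scalars (sf_const a) = sf_const (qt_const a)"
  unfolding extend_scalars_def by (rule poly_eval_const[OF extend_scalars_const_hom])

lemma extend_scalars_power_sum: "extend_scalars (power_sum i) = power_sum i"
  unfolding extend_scalars_def by (rule poly_eval_power_sum[OF extend_scalars_const_hom])

lemma lookup_extend_scalars: "Poly_Mapping.lookup (extend_scalars f) m = qt_const (Poly_Mapping.lookup f m)"
proof (induction f rule: sf_induct)
  case (monomial n a)
  have "extend_scalars (Poly_Mapping.single n a) = Poly_Mapping.single n (qt_const a)"
    unfolding single_eq_mono_eval extend_scalars.hom_mult extend_scalars_const hom_mono_eval[OF extend_scalars_hom]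
      extend_scalars_power_sum ..
  then show ?case by (simp add: lookup_single when_def)
qed (simp_all add: lookup_add extend_scalars.hom_add qt_const.hom_add)

lemma extend_scalars_complete_sf: "extend_scalars (complete_sf n) = complete_sf n"
proof (induction n rule: less_induct)
  case (less n)
  show ?case
  proof (cases n)
    case 0
    then show ?thesis by simp
  next
    case (Suc m)
    have "qt_const (1 / of_nat (Suc m)) * of_nat (Suc m) = 1"
      unfolding qt_const.hom_of_nat[symmetric] qt_const.hom_mult[symmetric]
      by (simp del: of_nat_Suc)
    then have inv: "qt_const (1 / of_nat (Suc m)) = 1 / of_nat (Suc m)"
      using of_nat_rat_qt[of m] by (simp add: eq_divide_eq del: of_nat_Suc)
    show ?thesis
      unfolding Suc complete_sf.simps(2) sf_scale_def extend_scalars.hom_mult extend_scalars.hom_sum extend_scalars_const inv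
        extend_scalars_power_sum
      using Suc by (intro arg_cong2[of _ _ _ _ "(*)"] sum.cong refl less.IH) simp
  qed
qed

lemma extend_scalars_schur: "extend_scalars (schur p) = schur p"
  by (subst hom_schur[OF extend_scalars_hom]) (simp only: extend_scalars_complete_sf schur_def)

text \<open>\<open>F\<close> arises from \<open>G\<close> by extension of the scalars.\<close>

definition rational_coeffs :: "rat_qt sf poly poly \<Rightarrow> rat sf poly poly \<Rightarrow> bool" where
  "rational_coeffs F G \<longleftrightarrow> (\<forall>a b. coeff (coeff F a) b = extend_scalars (coeff (coeff G a) b))"

lemma rational_coeffs_add:
  "rational_coeffs F G \<Longrightarrow> rational_coeffs F' G' \<Longrightarrow> rational_coeffs (F + F') (G + G')"
  by (simp add: rational_coeffs_def extend_scalars.hom_add)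

lemma rational_coeffs_diff:
  "rational_coeffs F G \<Longrightarrow> rational_coeffs F' G' \<Longrightarrow> rational_coeffs (F - F') (G - G')"
  by (simp add: rational_coeffs_def extend_scalars.hom_minus)

lemma rational_coeffs_mult:
  assumes "rational_coeffs F G" "rational_coeffs F' G'"
  shows "rational_coeffs (F * F') (G * G')"
  using assms
  by (simp add: rational_coeffs_def coeff_mult coeff_sum extend_scalars.hom_sum extend_scalars.hom_mult)

lemma rational_coeffs_const: "rational_coeffs [:[:extend_scalars f:]:] [:[:f:]:]"
  by (simp add: rational_coeffs_def coeff_pCons split: nat.split)

lemma rational_coeffs_monom: "rational_coeffs (monom 1 i) (monom 1 i)"
  by (simp add: rational_coeffs_def)

lemma rational_coeffs_monom_const: "rational_coeffs [:monom 1 i:] [:monom 1 i:]"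
  by (simp add: rational_coeffs_def coeff_pCons split: nat.split)

lemma rational_coeffs_one: "rational_coeffs 1 1"
  using rational_coeffs_monom[of 0] by simp

lemma rational_coeffs_power: "rational_coeffs F G \<Longrightarrow> rational_coeffs (F ^ n) (G ^ n)"
  by (induction n) (simp_all add: rational_coeffs_one rational_coeffs_mult)

lemma rational_coeffs_prod:
  "(\<And>x. x \<in> A \<Longrightarrow> rational_coeffs (F x) (G x)) \<Longrightarrow> rational_coeffs (prod F A) (prod G A)"
  by (induction A rule: infinite_finite_induct) (simp_all add: rational_coeffs_one rational_coeffs_mult)

lemma rational_coeffs_deform: "rational_coeffs (deform (extend_scalars f)) (deform f)"
proof (induction f rule: sf_induct)
  case zero
  interpret D: comm_ring_hom "deform :: rat sf \<Rightarrow> _" by (rule deform_hom)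
  interpret D': comm_ring_hom "deform :: rat_qt sf \<Rightarrow> _" by (rule deform_hom)
  show ?case by (simp add: rational_coeffs_def)
next
  case (add f g)
  interpret D: comm_ring_hom "deform :: rat sf \<Rightarrow> _" by (rule deform_hom)
  interpret D': comm_ring_hom "deform :: rat_qt sf \<Rightarrow> _" by (rule deform_hom)
  show ?case unfolding extend_scalars.hom_add D.hom_add D'.hom_add using add by (rule rational_coeffs_add)
next
  case (monomial m a)
  interpret D: comm_ring_hom "deform :: rat sf \<Rightarrow> _" by (rule deform_hom)
  interpret D': comm_ring_hom "deform :: rat_qt sf \<Rightarrow> _" by (rule deform_hom)
  have gen: "rational_coeffs (deform (power_sum i)) (deform (power_sum i))" for i
    unfolding deform_power_sum
    using rational_coeffs_const[of "power_sum i"] unfolding extend_scalars_power_sum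
    by (intro rational_coeffs_add rational_coeffs_mult rational_coeffs_diff rational_coeffs_one
        rational_coeffs_monom rational_coeffs_monom_const)
  have c: "rational_coeffs (deform (extend_scalars (sf_const a))) (deform (sf_const a))"
    using rational_coeffs_const[of "sf_const a"] by (simp only: extend_scalars_const deform_const)
  show ?case
    unfolding single_eq_mono_eval extend_scalars.hom_mult D.hom_mult D'.hom_mult hom_mono_eval[OF extend_scalars_hom]
      extend_scalars_power_sum hom_mono_eval[OF deform_hom]
    by (intro rational_coeffs_mult c) (unfold mono_eval_def, intro rational_coeffs_prod rational_coeffs_power gen)
qed

text \<open>The deformation of a sum of terms \<open>t\<^sup>c S\<^sub>p\<close>, with the power of \<open>t\<close> made a power of the outer variable
  as well.\<close>

definition weighted_deform :: "(nat \<times> ptn) multiset \<Rightarrow> 'a::field sf poly poly" where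
  "weighted_deform S = (\<Sum>x\<in>#S. monom 1 (fst x) * deform (schur (snd x)))"

lemma rational_coeffs_weighted_deform: "rational_coeffs (weighted_deform S) (weighted_deform S)"
proof (induction S)
  case empty
  show ?case by (simp add: weighted_deform_def rational_coeffs_def)
next
  case (add x S)
  have "rational_coeffs (monom 1 (fst x) * deform (schur (snd x))) (monom 1 (fst x) * deform (schur (snd x)))"
    using rational_coeffs_deform[of "schur (snd x)"] unfolding extend_scalars_schur
    by (intro rational_coeffs_mult rational_coeffs_monom)
  then show ?case using add unfolding weighted_deform_def by (simp add: rational_coeffs_add)
qed

lemma poly_const_power: "[:sf_const t:] ^ i = [:sf_const (t ^ i):]"
  by (induction i) (simp_all add: one_pCons sf_const.hom_mult)

lemma poly_weighted_deform:
  "poly (weighted_deform S) [:sf_const t:] = shift t (\<Sum>x\<in>#S. sf_scale (t ^ fst x) (schur (snd x)))"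
proof (induction S)
  case empty
  interpret sh: comm_ring_hom "shift t" by (rule shift_hom)
  show ?case by (simp add: weighted_deform_def)
next
  case (add x S)
  interpret sh: comm_ring_hom "shift t" by (rule shift_hom)
  have "poly (monom 1 (fst x) * deform (schur (snd x))) [:sf_const t:] =
      shift t (sf_scale (t ^ fst x) (schur (snd x)))"
    unfolding sf_scale_def sh.hom_mult shift_const poly_mult poly_deform poly_monom poly_const_power
    by simp
  then show ?case using add unfolding weighted_deform_def by (simp add: sh.hom_add)
qed

text \<open>The derivatives of the factors \<open>t\<^sup>c\<close> only contribute terms without \<open>u\<close>.\<close>

lemma derivative_weighted_deform:
  assumes "0 < b"
  shows "coeff (poly (pderiv (weighted_deform S)) 1) b = coeff (deform' (\<Sum>x\<in>#S. schur (snd x))) b"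
proof (induction S)
  case empty
  show ?case by (simp add: weighted_deform_def deform'_zero)
next
  case (add x S)
  have "poly (pderiv (monom 1 c * deform f)) 1 = of_nat c * [:f:] + deform' f" for c and f :: "'a sf"
    by (simp add: pderiv_mult pderiv_monom poly_monom deform'_def poly_deform_one)
  moreover have "coeff (of_nat c * [:f:]) b = 0" for c and f :: "'a sf"
    using assms by (simp add: of_nat_poly coeff_pCons split: nat.split)
  ultimately have "coeff (poly (pderiv (monom 1 c * deform f)) 1) b = coeff (deform' f) b"
    for c and f :: "'a sf"
    by (simp only: coeff_add add_0)
  then show ?case using add unfolding weighted_deform_def
    by (simp add: pderiv_add deform'_add)
qed

lemma coeff_eval_const:
  "Poly_Mapping.lookup (coeff (poly F [:sf_const t:]) b) m =
     (\<Sum>i\<le>degree F. Poly_Mapping.lookup (coeff (coeff F i) b) m * t ^ i)"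
proof -
  have "Poly_Mapping.lookup (coeff (G * [:sf_const c:]) b) m = Poly_Mapping.lookup (coeff G b) m * c"
    for G :: "'a sf poly" and c
  proof -
    have "coeff (G * [:sf_const c:]) b = sf_scale c (coeff G b)"
      by (simp add: sf_scale_def)
    then show ?thesis by (simp add: sf_scale_def sf_const_def flip: mult_map_scale_conv_mult)
      (simp add: Poly_Mapping.map.rep_eq when_def mult.commute)
  qed
  then show ?thesis
    by (simp only: poly_altdef poly_const_power coeff_sum lookup_sum)
qed

text \<open>Membership in \<open>V\<^sub>k\<close> bounds the degree in \<open>u\<close> identically in \<open>t\<close>, hence also that of the
  derivative at \<open>t = 1\<close>, and so excludes the power sums of index beyond \<open>k\<close>.\<close>

theorem specialization_in_V1:
  assumes V: "(\<Sum>x\<in>#S. sf_scale (t_var ^ fst x) (schur (snd x))) \<in> V k"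
  shows "(\<Sum>x\<in>#S. schur (snd x)) \<in> carrier (V1 k)"
proof -
  let ?F = "weighted_deform S :: rat_qt sf poly poly" and ?G = "weighted_deform S :: rat sf poly poly"
  let ?f = "(\<Sum>x\<in>#S. schur (snd x)) :: rat sf"
  have deg: "degree (poly ?F [:sf_const t_var:]) \<le> k"
    unfolding poly_weighted_deform
  proof (rule degree_shift_V)
    show "t_var ^ i \<noteq> 1" if "0 < i" for i using that by (rule t_var_power_neq_1)
    show "(of_nat (Suc n) :: rat_qt) \<noteq> 0" for n by (rule of_nat_rat_qt)
    show "(\<Sum>x\<in>#S. sf_scale (t_var ^ fst x) (schur (snd x))) \<in>
        sf.span {plethysm t_var (schur p) |p. bounded_partition k p}"
      using V unfolding V_def .
  qed
  have zero: "coeff (coeff ?G i) b = 0" if b: "k < b" for b i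
  proof (rule poly_mapping_eqI)
    fix m
    let ?r = "\<lambda>i. Poly_Mapping.lookup (coeff (coeff ?G i) b) m"
    have r: "Poly_Mapping.lookup (coeff (coeff ?F i) b) m = qt_const (?r i)" for i
      using rational_coeffs_weighted_deform[of S] by (simp add: rational_coeffs_def lookup_extend_scalars)
    have "?r i = 0"
    proof (cases "i \<le> degree ?F")
      case True
      have "(\<Sum>i\<le>degree ?F. qt_const (?r i) * t_var ^ i) = 0"
        unfolding r[symmetric] coeff_eval_const[symmetric] using deg b by (simp add: coeff_eq_0)
      then show ?thesis using True by (rule t_var_transcendental)
    next
      case False
      then show ?thesis using r[of i] qt_const_eq_0[of "?r i"] by (simp add: coeff_eq_0)
    qed
    then show "?r i = Poly_Mapping.lookup 0 m" by simp
  qed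
  have "coeff (deform' ?f) b = 0" if b: "k < b" for b
  proof -
    have "coeff (poly (pderiv ?G) 1) b = 0"
      unfolding poly_altdef coeff_sum
    proof (rule sum.neutral, rule ballI)
      fix i
      have "coeff (of_nat n * H) b = of_nat n * coeff H b" for n and H :: "rat sf poly"
        by (simp add: of_nat_poly)
      then show "coeff (coeff (pderiv ?G) i * 1 ^ i) b = 0"
        using zero[OF b, of "Suc i"] by (simp add: coeff_pderiv del: of_nat_Suc)
    qed
    then show ?thesis using derivative_weighted_deform[where 'a=rat, of b S] b by simp
  qed
  then have small: "b \<notin> Poly_Mapping.keys m" if "m \<in> Poly_Mapping.keys ?f" "k < b" for m b
    using deform'_support[OF _ _ that(1), of b] that(2) by simp
  have positive: "?f \<in> supported {0<..}"
    by (induction S) (simp_all add: supported_add supported_schur)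
  have "Poly_Mapping.keys m \<subseteq> {0<..k}" if m: "m \<in> Poly_Mapping.keys ?f" for m
  proof
    fix b assume b: "b \<in> Poly_Mapping.keys m"
    have "0 < b" using positive m b unfolding supported_def by blast
    moreover have "\<not> k < b" using small[OF m, of b] b by blast
    ultimately show "b \<in> {0<..k}" by simp
  qed
  then have "?f \<in> supported {0<..k}" by (simp add: supported_def)
  then show ?thesis by (rule supported_subset_V1)
qed

section \<open>Atoms at \<open>t = 1\<close>\<close>

lemma sum_list_map_part:
  assumes "c 0 = 0" "length p \<le> n"
  shows "(\<Sum>x\<leftarrow>p. c x) = (\<Sum>i<n. c (part p i) :: nat)"
proof -
  have "(\<Sum>i<n. c (part p i)) = (\<Sum>i<length p. c (part p i))"
    using assms by (intro sum.mono_neutral_right) (auto simp: part_simps)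
  also have "\<dots> = (\<Sum>i<length p. c (p ! i))" by (intro sum.cong) (auto simp: part_simps)
  finally show ?thesis by (simp add: sum_list_sum_nth atLeast0LessThan)
qed

lemma spread_dominates:
  assumes p: "is_partition p" and s: "dominates s p" "s \<noteq> p"
  shows "spread (part_monomial p) < spread (part_monomial s)"
proof -
  let ?n = "length s + length p"
  define a where "a i = int (part p i)" for i
  define d where "d i = int (part s i) - int (part p i)" for i
  obtain i where i: "part s i \<noteq> part p i"
    using part_eqI[of s p] s p by (auto simp: dominates_def)
  then have "i < ?n" by (auto simp: part_def split: if_splits)
  have sums: "(\<Sum>i<j. d i) = int (\<Sum>i<j. part s i) - int (\<Sum>i<j. part p i)" for j
    by (simp add: d_def sum_subtractf)
  have "(\<Sum>i<?n. a i * a i) < (\<Sum>i<?n. (a i + d i) * (a i + d i))"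
  proof (rule sum_squares_dominance)
    show "a (Suc i) \<le> a i" for i using part_antimono[OF p, of i "Suc i"] by (simp add: a_def)
    show "0 \<le> (\<Sum>i<j. d i)" for j
      using s(1) unfolding sums dominates_def by (simp del: of_nat_sum)
    show "(\<Sum>i<?n. d i) = 0"
      using s(1) sum_part[of s ?n] sum_part[of p ?n] unfolding sums dominates_def by simp
    show "i < ?n" by fact
    show "d i \<noteq> 0" using i by (simp add: d_def)
  qed
  also have "(\<Sum>i<?n. (a i + d i) * (a i + d i)) = int (\<Sum>i<?n. part s i * part s i)"
    by (simp add: a_def d_def)
  also have "(\<Sum>i<?n. a i * a i) = int (\<Sum>i<?n. part p i * part p i)"
    by (simp add: a_def)
  finally have "(\<Sum>i<?n. part p i * part p i) < (\<Sum>i<?n. part s i * part s i)"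
    by (simp only: of_nat_less_iff)
  then show ?thesis
    unfolding linear_weight_part_monomial
    using sum_list_map_part[of "\<lambda>x. x * x" p ?n] sum_list_map_part[of "\<lambda>x. x * x" s ?n] by simp
qed

text \<open>The leading monomial of a Schur function indexed by a strictly dominating partition has a larger spread.\<close>

lemma higher_schur:
  assumes p: "is_partition p" and s: "dominates s p" "s \<noteq> p"
  shows "higher (part_monomial p) (h_coords (schur s))"
proof -
  have "leads (part_monomial s) (h_coords (schur s))"
    using s(1) by (intro leads_schur) (simp add: dominates_def)
  then have hi: "higher (part_monomial s) (h_coords (schur s) - Poly_Mapping.single (part_monomial s) 1)"
    by (simp add: leads_def)
  have less: "spread (part_monomial p) < spread (part_monomial s)" by (rule spread_dominates[OF p s])
  have deg: "degree_of (part_monomial s) = degree_of (part_monomial p)"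
    using s(1) by (simp add: linear_weight_part_monomial dominates_def)
  have "higher (part_monomial p) (h_coords (schur s) - Poly_Mapping.single (part_monomial s) 1)"
    unfolding higher_def
  proof
    fix n assume "n \<in> Poly_Mapping.keys (h_coords (schur s) - Poly_Mapping.single (part_monomial s) 1)"
    then have "degree_of n = degree_of (part_monomial s) \<and> spread (part_monomial s) < spread n"
      using hi unfolding higher_def by blast
    then show "degree_of n = degree_of (part_monomial p) \<and> spread (part_monomial p) < spread n"
      using less deg by simp
  qed
  moreover have "higher (part_monomial p) (Poly_Mapping.single (part_monomial s) 1)"
    using less deg by (simp add: higher_def)
  ultimately have "higher (part_monomial p) (h_coords (schur s) -
      Poly_Mapping.single (part_monomial s) 1 + Poly_Mapping.single (part_monomial s) 1)"
    by (rule higher_add)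
  then show ?thesis by simp
qed

lemma atom_sf_one: "atom_sf k p 1 = (\<Sum>T\<in>#super_atom k p. schur (shape T))"
  by (simp add: atom_sf_def sf_scale_def)

lemma higher_sum_mset:
  "(\<And>x. x \<in># A \<Longrightarrow> higher m (f x)) \<Longrightarrow> higher m (\<Sum>x\<in>#A. f x)"
  by (induction A) (simp_all add: higher_add, simp_all add: higher_def)

lemma h_coords_sum_mset: "h_coords (\<Sum>x\<in>#A. f x) = (\<Sum>x\<in>#A. h_coords (f x))"
  by (induction A) (simp_all add: h_coords.hom_add)

text \<open>One tableau of the super atom has the shape \<open>p\<close>; the shapes of the others strictly dominate \<open>p\<close>.\<close>

lemma atom_leads:
  assumes p: "is_partition p"
  shows "leads (part_monomial p) (h_coords (atom_sf k p 1))"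
proof -
  let ?A = "super_atom k p"
  note sa = super_atom_shapes[OF p, of k]
  obtain T0 where T0: "filter_mset (\<lambda>T. shape T = p) ?A = {#T0#}"
    using size_1_singleton_mset[OF sa[THEN conjunct2]] by blast
  have "T0 \<in># filter_mset (\<lambda>T. shape T = p) ?A" unfolding T0 by simp
  then have "shape T0 = p" by simp
  have "(\<Sum>T\<in>#?A. h_coords (schur (shape T))) =
      (\<Sum>T\<in>#filter_mset (\<lambda>T. shape T = p) ?A. h_coords (schur (shape T))) +
      (\<Sum>T\<in>#filter_mset (\<lambda>T. shape T \<noteq> p) ?A. h_coords (schur (shape T)))"
    by (subst multiset_partition[of ?A "\<lambda>T. shape T = p"]) (simp only: image_mset_union sum_mset.union)
  also have "\<dots> = h_coords (schur p) +
      (\<Sum>T\<in>#filter_mset (\<lambda>T. shape T \<noteq> p) ?A. h_coords (schur (shape T)))"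
    unfolding T0 using \<open>shape T0 = p\<close> by simp
  finally have "h_coords (atom_sf k p 1) = h_coords (schur p) +
      (\<Sum>T\<in>#filter_mset (\<lambda>T. shape T \<noteq> p) ?A. h_coords (schur (shape T)))"
    unfolding atom_sf_one h_coords_sum_mset .
  moreover have "higher (part_monomial p)
      (\<Sum>T\<in>#filter_mset (\<lambda>T. shape T \<noteq> p) ?A. h_coords (schur (shape T)))"
  proof (rule higher_sum_mset)
    fix T assume "T \<in># filter_mset (\<lambda>T. shape T \<noteq> p) ?A"
    then have "T \<in># ?A" "shape T \<noteq> p" by auto
    then show "higher (part_monomial p) (h_coords (schur (shape T)))"
      using sa[THEN conjunct1] by (intro higher_schur[OF p]) blast+
  qed
  ultimately show ?thesis using leads_add_higher[OF leads_schur[OF p]] by simp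
qed

theorem corollary27:
  fixes k :: nat
  assumes rectangle_conjecture:
    "\<And>n l p T \<T>. 1 \<le> n \<Longrightarrow> l \<in> {1..n} \<Longrightarrow> bounded_partition n p \<Longrightarrow>
       is_copy n T \<T> \<Longrightarrow> shape T = p \<Longrightarrow>
       \<exists>T' \<T>'. shape T' = partition_union p (replicate (n - l + 1) l) \<and> is_copy n T' \<T>' \<and>
         extend_linearly (rect_promotion l (n - l + 1)) (mset_set \<T>) = mset_set \<T>'"
    and "1 \<le> k"
    and atom_basis: "sf_basis (\<lambda>p. atom_sf k p t_var) {p. bounded_partition k p} (V k)"
  shows "ring_basis (quotient_ring k) (residue_class k ` range sf_const)
           (\<lambda>p. residue_class k (atom_sf k p 1)) {p. irreducible_partition k p}"
proof -
  interpret unitriangular_family k "\<lambda>p. atom_sf k p 1"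
  proof
    fix p assume p: "bounded_partition k p"
    show "leads (part_monomial p) (h_coords (atom_sf k p 1))"
      using p by (intro atom_leads) (simp add: bounded_partition_def)
    let ?S = "image_mset (\<lambda>T. (charge T, shape T)) (super_atom k p)"
    have "atom_sf k p t_var \<in> (\<lambda>p. atom_sf k p t_var) ` {p. bounded_partition k p}"
      using p by blast
    from sf.span_base[OF this] have "atom_sf k p t_var \<in> V k"
      using atom_basis by (simp only: sf_basis_def)
    then have "(\<Sum>x\<in>#?S. sf_scale (t_var ^ fst x) (schur (snd x))) \<in> V k"
      by (simp add: atom_sf_def multiset.map_comp o_def)
    then have "(\<Sum>x\<in>#?S. schur (snd x)) \<in> carrier (V1 k)" by (rule specialization_in_V1)
    then show "atom_sf k p 1 \<in> carrier (V1 k)"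
      by (simp add: atom_sf_one multiset.map_comp o_def)
  qed
  show ?thesis by (rule ring_basis_irreducible)
qed

end
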